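(* Suppose that the mother wavelet $\psi$ is absolutely continuous with $\psi'\in L^1(\mathbb{R})$. Fix $0<s_1<\dots<s_d$ and $A>0$. Let $\{\epsilon_j\}_{j\in\mathbb{Z}}$ be a real random sequence admitting the causal representation $\epsilon_j=H_j(\mathcal{F}_j)$ and satisfying, for some $p>2$, $\chi>1$ and $a>\sqrt\chi+1$, the moment condition $\sup_{j\in\mathbb{Z}}\mathbb{E}[|\epsilon_j|^p]<\infty$ and the dependence condition $$\sup_{j\in\mathbb{Z}}\left(\mathbb{E}\left[|H_j(\mathcal{F}_j)-H_j(\mathcal{F}_{j,j-k})|^p\right]\right)^{1/p}=\mathcal{O}\left((k+1)^{-(\chi+1)}(\log(k+1))^{-a}\right),\qquad k\ge1.$$ Then there exist mean-zero independent Gaussian random variables $\{z_j\}_{j\in\mathbb{Z}}$ satisfying $\mathrm{Var}(z_j)=\mathrm{Var}(\epsilon_j)$ for all $j\in\mathbb{Z}$ such that the Lévy–Prokhorov distance between the probability measures $\nu_\epsilon^{(n)}$ of $\{\sqrt{s_\ell}\,\widetilde W_\epsilon(t_i,s_\ell)\mid1\le i\le n,\ 1\le\ell\le d\}$ and $\nu_z^{(n)}$ of $\{\sqrt{s_\ell}\,\widetilde W_z(t_i,s_\ell)\mid1\le i\le n,\ 1\le\ell\le d\}$ satisfies $$\pi(\nu_\epsilon^{(n)},\nu_z^{(n)})=o\left(n^{-G(p,\chi)/3}(\log n)^{4/3+\delta}\right)\qquad\text{as }n\to\infty,$$ where $\delta>0$ is arbitrary.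
   Context: The mother wavelet $\psi:\mathbb{R}\to\mathbb{C}$ belongs to $L^1(\mathbb{R})\cap L^2(\mathbb{R})$; $[-A,A]$ is an interval outside of which $|\psi|$ is regarded as negligibly small. Discretized transform: for $n\in\mathbb{N}$, $t_i=i/\sqrt n$, $D^{(\ell)}=[-\lceil\sqrt nAs_\ell\rceil,\lceil\sqrt nAs_\ell\rceil]\cap\mathbb{Z}$, $\psi_j^{(\ell)}=\frac{1}{n^{1/4}s_\ell^{1/2}}\psi\left(\frac{j}{\sqrt n\,s_\ell}\right)$, and for a sequence $x=\{x_j\}_{j\in\mathbb{Z}}$ (here $x=\epsilon$ or $x=z$), $$\widetilde W_x(t_i,s_\ell)=\frac{1}{n^{1/4}}\sum_{j\in D^{(\ell)}}x_{i+j}\overline{\psi_j^{(\ell)}}.$$ Causal representation: $\{e_j\}_{j\in\mathbb{Z}}$ is a sequence of i.i.d. (real) random variables, $\mathcal{F}_j=(\ldots,e_{j-2},e_{j-1},e_j)$, and each $H_j:\mathbb{R}^\infty\to\mathbb{R}$ is measurable. With $\{\widehat e_j\}_{j\in\mathbb{Z}}$ an independent copy of $\{e_j\}_{j\in\mathbb{Z}}$, $\mathcal{F}_{j,j-k}=(\ldots,e_{j-k-1},\widehat e_{j-k},e_{j-k+1},\ldots,e_{j-1},e_j)$, i.e. $e_{j-k}$ is replaced by $\widehat e_{j-k}$. The function $G:(2,\infty)\times(1,\infty)\to(0,\infty)$ is $$G(p,\chi)=\frac{1}{1-\frac1\kappa-\frac1p}\left(\frac12-\frac1p-\frac1\kappa+\frac{2}{p\kappa}\right),$$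 where $$\frac1\kappa=\max\left\{\frac1p,\ \frac{1}{\sqrt{\chi+1}\,p}+\left(\frac12-\frac{1}{\sqrt{\chi+1}\,p}\right)\max\left\{\frac{2}{\sqrt{\chi+1}\,p},\ \frac1\chi\left(\frac12-\frac1p\right)\right\}\right\}.$$ The Lévy–Prokhorov distance between probability measures $\nu_1,\nu_2$ on $\mathbb{C}^{n\times d}$ is $\pi(\nu_1,\nu_2)=\inf\{\varepsilon>0:\nu_1(B)\le\nu_2(B^\varepsilon)+\varepsilon\text{ and }\nu_2(B)\le\nu_1(B^\varepsilon)+\varepsilon\text{ for all Borel }B\subset\mathbb{C}^{n\times d}\}$, with $B^\varepsilon=\{x\in\mathbb{C}^{n\times d}:\inf_{x'\in B}|x-x'|_\infty<\varepsilon\}$ and $|\cdot|_\infty$ the supremum norm.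
   Formalization: The random sequence ε_j is additionally assumed to have mean zero for every j; without this the claim fails, e.g. for ε_j = 1 with ψ of nonzero integral over [-A,A], where z_j = 0 and the distance does not tend to 0. *)

theory Defs
  imports "HOL-Probability.Probability"
begin

subsection \<open>Absolute continuity\<close>

text \<open>
  The non-overlapping intervals of the usual epsilon-delta definition are the members of a
  division \<open>D\<close> (finitely many compact intervals with pairwise disjoint interiors).
  On the whole line absolute continuity is required on every compact interval; together with
  integrability of the derivative this is the same as the uniform version on the line.
\<close>

definition abs_continuous_on :: "real set \<Rightarrow> (real \<Rightarrow> 'a::real_normed_vector) \<Rightarrow> bool" where
  "abs_continuous_on S f \<longleftrightarrow>
    (\<forall>\<epsilon>>0. \<exists>\<delta>>0. \<forall>D. D division_of \<Union>D \<and> \<Union>D \<subseteq> S \<and> (\<Sum>K\<in>D. Sup K - Inf K) < \<delta>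
        \<longrightarrow> (\<Sum>K\<in>D. norm (f (Sup K) - f (Inf K))) < \<epsilon>)"

definition abs_continuous :: "(real \<Rightarrow> 'a::real_normed_vector) \<Rightarrow> bool" where
  "abs_continuous f \<longleftrightarrow> (\<forall>a b. abs_continuous_on {a..b} f)"


subsection \<open>Discretized wavelet transform\<close>

definition wt_window :: "real \<Rightarrow> nat \<Rightarrow> real \<Rightarrow> int set" where
  "wt_window A n s = {- \<lceil>sqrt n * A * s\<rceil> .. \<lceil>sqrt n * A * s\<rceil>}"

definition wt_coeff :: "(real \<Rightarrow> complex) \<Rightarrow> nat \<Rightarrow> real \<Rightarrow> int \<Rightarrow> complex" where
  "wt_coeff \<psi> n s j =
    of_real (1 / (real n powr (1/4) * s powr (1/2))) * \<psi> (real_of_int j / (sqrt n * s))"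

text \<open>\<open>disc_wt \<psi> A n x i s\<close> is the transform at time \<open>i / sqrt n\<close> and scale \<open>s\<close>.\<close>

definition disc_wt ::
  "(real \<Rightarrow> complex) \<Rightarrow> real \<Rightarrow> nat \<Rightarrow> (int \<Rightarrow> real) \<Rightarrow> nat \<Rightarrow> real \<Rightarrow> complex" where
  "disc_wt \<psi> A n x i s =
    of_real (1 / real n powr (1/4)) *
    (\<Sum>j\<in>wt_window A n s. of_real (x (int i + j)) * cnj (wt_coeff \<psi> n s j))"

text \<open>
  Complex \<open>n \<times> d\<close> matrices are the extensional functions on \<open>{1..n} \<times> {1..d}\<close>. The index set
  is finite, so the product sigma-algebra is the Borel sigma-algebra.
\<close>

abbreviation cmat_idx :: "nat \<Rightarrow> nat \<Rightarrow> (nat \<times> nat) set" where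
  "cmat_idx n d \<equiv> {1..n} \<times> {1..d}"

definition wt_law ::
  "'a measure \<Rightarrow> (real \<Rightarrow> complex) \<Rightarrow> real \<Rightarrow> nat \<Rightarrow> (nat \<Rightarrow> real) \<Rightarrow> (int \<Rightarrow> 'a \<Rightarrow> real) \<Rightarrow> nat
    \<Rightarrow> (nat \<times> nat \<Rightarrow> complex) measure" where
  "wt_law M \<psi> A d s x n =
    distr M (PiM (cmat_idx n d) (\<lambda>_. borel))
      (\<lambda>\<omega>. \<lambda>(i, l)\<in>cmat_idx n d. of_real (sqrt (s l)) * disc_wt \<psi> A n (\<lambda>j. x j \<omega>) i (s l))"


subsection \<open>Levy--Prokhorov distance for the supremum norm\<close>

text \<open>The infimum is taken in \<open>ennreal\<close>, so that the neighbourhood of the empty set is empty.\<close>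

definition sup_nbhd :: "'i set \<Rightarrow> real \<Rightarrow> ('i \<Rightarrow> complex) set \<Rightarrow> ('i \<Rightarrow> complex) set" where
  "sup_nbhd I \<epsilon> B =
    {x \<in> I \<rightarrow>\<^sub>E UNIV. (INF y\<in>B. SUP k\<in>I. ennreal (norm (x k - y k))) < ennreal \<epsilon>}"

definition levy_prokhorov ::
  "'i set \<Rightarrow> ('i \<Rightarrow> complex) measure \<Rightarrow> ('i \<Rightarrow> complex) measure \<Rightarrow> real" where
  "levy_prokhorov I \<mu> \<nu> =
    Inf {\<epsilon>. \<epsilon> > 0 \<and> (\<forall>B\<in>sets (PiM I (\<lambda>_. borel)).
          measure \<mu> B \<le> measure \<nu> (sup_nbhd I \<epsilon> B) + \<epsilon> \<and>
          measure \<nu> B \<le> measure \<mu> (sup_nbhd I \<epsilon> B) + \<epsilon>)}"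


subsection \<open>Causal representation and dependence\<close>

definition iid_sequence :: "'a measure \<Rightarrow> (int \<Rightarrow> 'a \<Rightarrow> real) \<Rightarrow> bool" where
  "iid_sequence M e \<longleftrightarrow>
    prob_space.indep_vars M (\<lambda>_. borel) e UNIV \<and> (\<forall>i j. distr M borel (e i) = distr M borel (e j))"

definition indep_copy :: "'a measure \<Rightarrow> (int \<Rightarrow> 'a \<Rightarrow> real) \<Rightarrow> (int \<Rightarrow> 'a \<Rightarrow> real) \<Rightarrow> bool" where
  "indep_copy M e e' \<longleftrightarrow>
    prob_space.indep_var M (PiM UNIV (\<lambda>_. borel)) (\<lambda>\<omega> j. e j \<omega>) (PiM UNIV (\<lambda>_. borel)) (\<lambda>\<omega> j. e' j \<omega>) \<and>
    distr M (PiM UNIV (\<lambda>_. borel)) (\<lambda>\<omega> j. e' j \<omega>) = distr M (PiM UNIV (\<lambda>_. borel)) (\<lambda>\<omega> j. e j \<omega>)"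

text \<open>The past up to time \<open>j\<close> is stored backwards: entry \<open>k\<close> is \<open>e (j - k)\<close>.\<close>

definition past :: "(int \<Rightarrow> 'a \<Rightarrow> real) \<Rightarrow> int \<Rightarrow> 'a \<Rightarrow> nat \<Rightarrow> real" where
  "past e j \<omega> = (\<lambda>k. e (j - int k) \<omega>)"

definition past_coupled ::
  "(int \<Rightarrow> 'a \<Rightarrow> real) \<Rightarrow> (int \<Rightarrow> 'a \<Rightarrow> real) \<Rightarrow> int \<Rightarrow> nat \<Rightarrow> 'a \<Rightarrow> nat \<Rightarrow> real" where
  "past_coupled e e' j k \<omega> = (past e j \<omega>)(k := e' (j - int k) \<omega>)"

text \<open>
  Integrals and supremum are real-valued here. If the \<open>p\<close>-th moments of \<open>H j (past e j)\<close> are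
  bounded in \<open>j\<close>, then all integrands are integrable and the supremum is over a bounded set.
\<close>

definition dep_measure ::
  "'a measure \<Rightarrow> (int \<Rightarrow> (nat \<Rightarrow> real) \<Rightarrow> real) \<Rightarrow> (int \<Rightarrow> 'a \<Rightarrow> real) \<Rightarrow> (int \<Rightarrow> 'a \<Rightarrow> real)
    \<Rightarrow> real \<Rightarrow> nat \<Rightarrow> real" where
  "dep_measure M H e e' p k =
    (SUP j. (prob_space.expectation M
        (\<lambda>\<omega>. \<bar>H j (past e j \<omega>) - H j (past_coupled e e' j k \<omega>)\<bar> powr p)) powr (1/p))"


subsection \<open>Gaussian variables\<close>

text \<open>Constants count as Gaussian with variance zero, since the prescribed variances may vanish.\<close>

definition gaussian_var :: "'a measure \<Rightarrow> ('a \<Rightarrow> real) \<Rightarrow> bool" where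
  "gaussian_var M X \<longleftrightarrow> X \<in> borel_measurable M \<and>
    ((\<exists>\<mu>. AE \<omega> in M. X \<omega> = \<mu>) \<or>
     (\<exists>\<mu> \<sigma>. \<sigma> > 0 \<and> distributed M lborel X (normal_density \<mu> \<sigma>)))"


subsection \<open>Rate exponent\<close>

definition kappa_inv :: "real \<Rightarrow> real \<Rightarrow> real" where
  "kappa_inv p chi =
    max (1/p)
      (1 / (sqrt (chi + 1) * p) +
       (1/2 - 1 / (sqrt (chi + 1) * p)) * max (2 / (sqrt (chi + 1) * p)) (1/chi * (1/2 - 1/p)))"

definition rate_G :: "real \<Rightarrow> real \<Rightarrow> real" where
  "rate_G p chi =
    1 / (1 - kappa_inv p chi - 1/p) * (1/2 - 1/p - kappa_inv p chi + 2/p * kappa_inv p chi)"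

end

theory Submission
  imports Defs
begin

text \<open>
  The rate is weak enough for a direct argument. One finds \<open>G(p, \<chi>) \<le> 1/2 - 1/p\<close>, so the claimed
  bound is never smaller than \<open>n powr (- (p - 2) / (6 * p))\<close> times a power of \<open>ln n\<close>. On the other
  hand, both random matrices lie close to the zero matrix: if \<open>W\<close> denotes either of them, then
  \<open>P (|W|\<^sub>\<infinity> > \<eta>) \<le> C * n powr (1/2 - p/4) / \<eta> powr p\<close>. The choice
  \<open>\<eta> = c * n powr (- (p - 2) / (4 * (p + 1)))\<close> makes this probability at most \<open>\<eta>\<close>, and two laws that
  give mass at least \<open>1 - \<eta>\<close> to the \<open>\<eta>\<close>-ball around zero have distance at most \<open>3 * \<eta>\<close>. Since
  \<open>4 * (p + 1) < 6 * p\<close> for \<open>p > 2\<close>, this is a smaller power of \<open>n\<close> than the one claimed.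
  
  The tail bound rests on a single property of the input sequence: a sum of \<open>m\<close> consecutive
  terms has \<open>p\<close>-th absolute moment at most \<open>K * m powr (p/2)\<close>. An entry of \<open>W\<close> is \<open>n powr (-1/2)\<close> times
  a sum over a window of length of order \<open>sqrt n\<close>, with weights of bounded variation because \<open>\<psi>\<close>
  is absolutely continuous. Abel summation (\<open>disc_wt_bound\<close>) bounds it by the largest
  unweighted sum over a subinterval of the window. All of these short sums are controlled at once
  by dyadic chaining (\<open>short_sums_tail\<close>); as \<open>p > 2\<close>, the union bounds over the dyadic blocks of
  each length add up to a geometric series.
  
  The moment bound for causal sequences (\<open>block_moment_bound\<close>) comes from martingale
  differences. A sum \<open>f\<close> of consecutive terms is a function of i.i.d. coordinates. Integrating out
  all coordinates after \<open>i\<close> gives its conditional expectation on the past up to \<open>i\<close>; the increment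
  from \<open>i - 1\<close> to \<open>i\<close> is dominated in \<open>L\<^sup>p\<close> by the effect of resampling coordinate \<open>i\<close>, hence by a sum of
  values of the dependence measure. As these are summable, the squares of the \<open>L\<^sup>p\<close> norms of the
  increments add up to \<open>O(m)\<close>, and an inequality for sums with orthogonal increments
  (\<open>orthogonal_increment_moment\<close>) turns this into the moment bound. The martingale has no first
  time; the contribution of the remote past vanishes because a function of i.i.d. coordinates is
  approximated in \<open>L\<^sup>1\<close> by functions of finitely many of them (\<open>remote_gap_tendsto_0\<close>). The
  independent Gaussian sequence is covered as well, being causal with \<open>j\<close>-th term \<open>\<sigma> j * x j\<close>.
\<close>

section \<open>Sums with orthogonal increments\<close>

lemma exp_le_quadratic:
  fixes x c :: real
  assumes "\<bar>x\<bar> \<le> c"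
  shows "exp x \<le> 1 + x + exp c * x\<^sup>2"
proof -
  obtain t where t: "\<bar>t\<bar> \<le> \<bar>x\<bar>" "exp x = (\<Sum>m<2. (x ^ m) / fact m) + (exp t / fact 2) * x ^ 2"
    using Maclaurin_exp_le[of x 2] by blast
  have "exp t / 2 \<le> exp c"
    using t(1) assms by (smt (verit) exp_gt_zero exp_le_cancel_iff field_sum_of_halves)
  then have "exp t / 2 * x\<^sup>2 \<le> exp c * x\<^sup>2" by (intro mult_right_mono) auto
  then show ?thesis using t(2) by (simp add: numeral_2_eq_2 lessThan_Suc)
qed

text \<open>
  An explicit constant for the second-order expansion of \<open>y \<mapsto> \<bar>y\<bar> powr p\<close> below: the first two
  summands serve large increments, the third one small increments.
\<close>

definition power_const :: "real \<Rightarrow> real" where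
  "power_const p = 3 powr p + p * 2 powr (p - 1) + p\<^sup>2 * exp p + 1"

lemma power_const_ge_1: "p > 0 \<Longrightarrow> power_const p \<ge> 1"
  unfolding power_const_def by simp

text \<open>
  If \<open>d\<close> is at least comparable to \<open>y\<close>, all terms are of order \<open>\<bar>d\<bar> powr p\<close>. Otherwise dividing by
  \<open>\<bar>y\<bar> powr p\<close> reduces the claim to \<open>(1 + x) powr p \<le> exp (p * x)\<close> with \<open>\<bar>x\<bar> \<le> 1/2\<close> and the quadratic bound
  for \<open>exp\<close>. The linear term is kept without an absolute value because its integral vanishes when the
  increment is orthogonal to the signed power of \<open>y\<close>.
\<close>

lemma abs_add_powr_le:
  fixes y d p :: real
  assumes p: "p > 2"
  shows "\<bar>y + d\<bar> powr p \<le> \<bar>y\<bar> powr p + p * (sgn y * \<bar>y\<bar> powr (p - 1) * d)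
           + power_const p * (\<bar>y\<bar> powr (p - 2) * d\<^sup>2 + \<bar>d\<bar> powr p)"
proof (cases "\<bar>y\<bar> \<le> 2 * \<bar>d\<bar>")
  case True
  have "\<bar>y + d\<bar> powr p \<le> (3 * \<bar>d\<bar>) powr p"
    using True p by (intro powr_mono2) auto
  also have "\<dots> = 3 powr p * \<bar>d\<bar> powr p" by (simp add: powr_mult)
  finally have 1: "\<bar>y + d\<bar> powr p \<le> 3 powr p * \<bar>d\<bar> powr p" .
  have "\<bar>y\<bar> powr (p - 1) * \<bar>d\<bar> \<le> (2 * \<bar>d\<bar>) powr (p - 1) * \<bar>d\<bar>"
    using True p by (intro mult_right_mono powr_mono2) auto
  also have "\<dots> = 2 powr (p - 1) * (\<bar>d\<bar> powr (p - 1) * \<bar>d\<bar>)" by (simp add: powr_mult)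
  also have "\<bar>d\<bar> powr (p - 1) * \<bar>d\<bar> = \<bar>d\<bar> powr p"
    using powr_mult_base[of "\<bar>d\<bar>" "p - 1"] by (simp add: mult.commute)
  finally have 2: "\<bar>y\<bar> powr (p - 1) * \<bar>d\<bar> \<le> 2 powr (p - 1) * \<bar>d\<bar> powr p" .
  have "- (sgn y * \<bar>y\<bar> powr (p - 1) * d) \<le> \<bar>sgn y * \<bar>y\<bar> powr (p - 1) * d\<bar>" by linarith
  also have "\<dots> \<le> \<bar>y\<bar> powr (p - 1) * \<bar>d\<bar>"
    by (auto simp: abs_mult abs_sgn_eq)
  finally have "- (sgn y * \<bar>y\<bar> powr (p - 1) * d) \<le> 2 powr (p - 1) * \<bar>d\<bar> powr p"
    using 2 by linarith
  then have 3: "- (p * (sgn y * \<bar>y\<bar> powr (p - 1) * d)) \<le> p * (2 powr (p - 1) * \<bar>d\<bar> powr p)"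
    using p by (metis minus_mult_right mult_left_mono less_eq_real_def order.strict_trans zero_less_numeral)
  have 4: "3 powr p * \<bar>d\<bar> powr p + p * (2 powr (p - 1) * \<bar>d\<bar> powr p) \<le> power_const p * \<bar>d\<bar> powr p"
    unfolding power_const_def by (simp add: algebra_simps)
  have 5: "0 \<le> power_const p * (\<bar>y\<bar> powr (p - 2) * d\<^sup>2)" "0 \<le> \<bar>y\<bar> powr p"
    using power_const_ge_1[of p] p by auto
  show ?thesis using 1 3 4 5 unfolding distrib_left[of "power_const p"] by linarith
next
  case False
  then have y: "y \<noteq> 0" by auto
  define x where "x = d / y"
  have x: "\<bar>x\<bar> \<le> 1 / 2" using False y by (simp add: x_def field_simps)
  have d: "d = y * x" using y by (simp add: x_def)
  have "\<bar>y + d\<bar> powr p = \<bar>y\<bar> powr p * (1 + x) powr p"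
  proof -
    have "y + d = y * (1 + x)" by (simp add: d algebra_simps)
    then show ?thesis using x by (simp add: abs_mult powr_mult)
  qed
  also have "(1 + x) powr p \<le> exp (p * x)"
  proof -
    have "ln (1 + x) \<le> x" using x by (intro ln_add_one_self_le_self2) auto
    then show ?thesis using x p by (simp add: powr_def)
  qed
  also have "\<dots> \<le> 1 + p * x + exp p * (p * x)\<^sup>2"
    using x p by (intro exp_le_quadratic) (auto simp: abs_mult)
  finally have 1: "\<bar>y + d\<bar> powr p \<le> \<bar>y\<bar> powr p * (1 + p * x + exp p * (p * x)\<^sup>2)"
    by (simp add: mult_left_mono)
  have a: "\<bar>y\<bar> powr p * x = sgn y * \<bar>y\<bar> powr (p - 1) * d"
  proof -
    have "\<bar>y\<bar> powr p = \<bar>y\<bar> powr (p - 1) * \<bar>y\<bar>"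
      using y powr_mult_base[of "\<bar>y\<bar>" "p - 1"] by (simp add: mult.commute)
    moreover have "sgn y * y = \<bar>y\<bar>" by (simp add: abs_sgn mult.commute)
    ultimately show ?thesis by (simp add: d mult.left_commute mult.commute)
  qed
  have b: "\<bar>y\<bar> powr p * x\<^sup>2 = \<bar>y\<bar> powr (p - 2) * d\<^sup>2"
  proof -
    have "\<bar>y\<bar> powr p = \<bar>y\<bar> powr (p - 2) * y\<^sup>2"
      using powr_add[of "\<bar>y\<bar>" "p - 2" 2] y by simp
    then show ?thesis by (simp add: d power_mult_distrib)
  qed
  have "\<bar>y\<bar> powr p * (1 + p * x + exp p * (p * x)\<^sup>2)
      = \<bar>y\<bar> powr p + p * (\<bar>y\<bar> powr p * x) + p\<^sup>2 * exp p * (\<bar>y\<bar> powr p * x\<^sup>2)"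
    by (simp add: algebra_simps power_mult_distrib)
  also have "\<dots> = \<bar>y\<bar> powr p + p * (sgn y * \<bar>y\<bar> powr (p - 1) * d) + p\<^sup>2 * exp p * (\<bar>y\<bar> powr (p - 2) * d\<^sup>2)"
    by (simp add: a b)
  finally have 2: "\<bar>y + d\<bar> powr p \<le> \<bar>y\<bar> powr p + p * (sgn y * \<bar>y\<bar> powr (p - 1) * d)
        + p\<^sup>2 * exp p * (\<bar>y\<bar> powr (p - 2) * d\<^sup>2)" using 1 by simp
  have "p\<^sup>2 * exp p \<le> power_const p" unfolding power_const_def using p by simp
  then have "p\<^sup>2 * exp p * (\<bar>y\<bar> powr (p - 2) * d\<^sup>2) \<le> power_const p * (\<bar>y\<bar> powr (p - 2) * d\<^sup>2 + \<bar>d\<bar> powr p)"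
    by (intro mult_mono) (use p in \<open>auto simp: power_const_def\<close>)
  then show ?thesis using 2 by linarith
qed

lemma powr_Young:
  fixes x y p r :: real
  assumes "x \<ge> 0" "y \<ge> 0" "0 \<le> r" "r \<le> p"
  shows "x powr (p - r) * y powr r \<le> x powr p + y powr p"
proof -
  let ?m = "max x y"
  have "x powr (p - r) * y powr r \<le> ?m powr (p - r) * ?m powr r"
    using assms by (intro mult_mono powr_mono2) auto
  also have "\<dots> = ?m powr p" by (simp flip: powr_add)
  also have "\<dots> \<le> x powr p + y powr p" by (auto simp: max_def)
  finally show ?thesis .
qed

text \<open>
  Both variables are scaled by the size they are allowed to have, so that the expectation of the
  bracket is at most 2.
\<close>

lemma powr_Young_weighted:
  fixes y d p b q :: real
  assumes p: "p > 2" and b: "b > 0" and q: "q > 0"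
  shows "\<bar>y\<bar> powr (p - 2) * d\<^sup>2
           \<le> b powr (p/2 - 1) * q * (\<bar>y\<bar> powr p / b powr (p/2) + \<bar>d\<bar> powr p / q powr (p/2))"
proof -
  define u where "u = \<bar>y\<bar> / sqrt b"
  define v where "v = \<bar>d\<bar> / sqrt q"
  have y: "\<bar>y\<bar> = sqrt b * u" and d: "\<bar>d\<bar> = sqrt q * v" using b q by (simp_all add: u_def v_def)
  have uv: "u \<ge> 0" "v \<ge> 0" using b q by (simp_all add: u_def v_def)
  have sb: "sqrt b powr r = b powr (r/2)" if "b > 0" for r b :: real
    using that by (simp add: powr_powr flip: powr_half_sqrt)
  have y1: "\<bar>y\<bar> powr r = b powr (r/2) * u powr r" for r
    unfolding y using uv b by (simp add: powr_mult sb)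
  have d1: "\<bar>d\<bar> powr r = q powr (r/2) * v powr r" for r
    unfolding d using uv q by (simp add: powr_mult sb)
  have d2: "d\<^sup>2 = q * v powr 2"
    unfolding power2_abs[of d, symmetric] d power_mult_distrib using uv q by simp
  have "\<bar>y\<bar> powr (p - 2) * d\<^sup>2 = b powr (p/2 - 1) * q * (u powr (p - 2) * v powr 2)"
    by (simp add: y1 d2 diff_divide_distrib)
  also have "\<dots> \<le> b powr (p/2 - 1) * q * (u powr p + v powr p)"
    using powr_Young[of u v 2 p] p uv b q by (intro mult_left_mono) auto
  also have "u powr p + v powr p = \<bar>y\<bar> powr p / b powr (p/2) + \<bar>d\<bar> powr p / q powr (p/2)"
    using b q by (simp add: y1 d1)
  finally show ?thesis .
qed

lemma powr_one_add_ge: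
  fixes x r :: real
  assumes "x \<ge> 0" "r \<ge> 1"
  shows "1 + (r * x + x powr r) / 2 \<le> (1 + x) powr r"
proof -
  have 1: "1 + r * x \<le> (1 + x) powr r"
  proof (cases "x = 0")
    case False
    have "(\<lambda>t. (1 + t) powr r) (0 + x) - 1 \<ge> r * x"
    proof -
      have "\<exists>z. 0 < z \<and> z < x \<and> (1 + x) powr r - (1 + 0) powr r = (x - 0) * (r * (1 + z) powr (r - 1))"
        using False assms by (intro MVT2) (auto intro!: derivative_eq_intros simp: powr_diff field_simps)
      then obtain z where z: "0 < z" "(1 + x) powr r - 1 = x * (r * (1 + z) powr (r - 1))" by auto
      have "1 \<le> (1 + z) powr (r - 1)" using z assms by (intro ge_one_powr_ge_zero) auto
      then have "x * (r * 1) \<le> x * (r * (1 + z) powr (r - 1))"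
        using assms by (intro mult_left_mono) auto
      then show ?thesis using z by (simp add: mult.commute)
    qed
    then show ?thesis by simp
  qed (use assms in auto)
  have 2: "1 + x powr r \<le> (1 + x) powr r"
  proof -
    have "(1 + x) powr r = (1 + x) powr (r - 1) + x * (1 + x) powr (r - 1)"
      using powr_mult_base[of "1 + x" "r - 1"] assms by (simp add: algebra_simps)
    moreover have "1 \<le> (1 + x) powr (r - 1)" using assms by (intro ge_one_powr_ge_zero) auto
    moreover have "x powr r = x * x powr (r - 1)"
      using powr_mult_base[of x "r - 1"] assms by simp
    moreover have "x * x powr (r - 1) \<le> x * (1 + x) powr (r - 1)"
      using assms by (intro mult_left_mono powr_mono2) auto
    ultimately show ?thesis by linarith
  qed
  show ?thesis using 1 2 by (simp add: field_simps)
qed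

text \<open>
  Both \<open>b powr (r - 1) * q\<close> (by convexity) and \<open>q powr r\<close> (by superadditivity) are dominated by the
  increment of the \<open>r\<close>-th power from \<open>b\<close> to \<open>b + K * q\<close>; averaging the two bounds dominates half of their
  sum. This is the form in which the two
  error terms of \<open>abs_add_powr_le\<close> are absorbed.
\<close>

lemma powr_add_ge:
  fixes b q K r :: real
  assumes "b > 0" "q \<ge> 0" "K \<ge> 1" "r \<ge> 1"
  shows "b powr r + K / 2 * (b powr (r - 1) * q + q powr r) \<le> (b + K * q) powr r"
proof -
  define x where "x = K * q / b"
  have x: "x \<ge> 0" using assms by (simp add: x_def)
  have "b + K * q = b * (1 + x)" using assms by (simp add: x_def field_simps)
  then have "(b + K * q) powr r = b powr r * (1 + x) powr r"
    using assms x by (simp add: powr_mult)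
  also have "\<dots> \<ge> b powr r * (1 + (r * x + x powr r) / 2)"
    using powr_one_add_ge[OF x \<open>r \<ge> 1\<close>] by (intro mult_left_mono) auto
  also have "b powr r * (1 + (r * x + x powr r) / 2) = b powr r + (r * (b powr r * x) + b powr r * x powr r) / 2"
    by (simp add: algebra_simps)
  also have "b powr r * x = K * (b powr (r - 1) * q)"
    using assms by (simp add: x_def powr_diff)
  also have "b powr r * x powr r = K powr r * q powr r"
    using assms x by (simp add: x_def powr_divide powr_mult)
  finally have *: "b powr r + (r * (K * (b powr (r - 1) * q)) + K powr r * q powr r) / 2 \<le> (b + K * q) powr r" .
  have "1 * (K * (b powr (r - 1) * q)) \<le> r * (K * (b powr (r - 1) * q))"
    using assms by (intro mult_right_mono) auto
  moreover have "K powr 1 * q powr r \<le> K powr r * q powr r"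
    using assms by (intro mult_right_mono powr_mono) auto
  ultimately have "K * (b powr (r - 1) * q) + K * q powr r
      \<le> r * (K * (b powr (r - 1) * q)) + K powr r * q powr r"
    using assms by (intro add_mono) simp_all
  moreover have "K / 2 * (b powr (r - 1) * q + q powr r)
      = (K * (b powr (r - 1) * q) + K * q powr r) / 2"
    by (simp add: distrib_left add_divide_distrib)
  ultimately have "b powr r + K / 2 * (b powr (r - 1) * q + q powr r)
      \<le> b powr r + (r * (K * (b powr (r - 1) * q)) + K powr r * q powr r) / 2"
    by (metis add_left_mono divide_right_mono zero_le_numeral)
  with * show ?thesis by (rule order.trans[rotated])
qed

lemma nn_integral_powr_le_iff:
  fixes f :: "'a \<Rightarrow> real"
  assumes "f \<in> borel_measurable M" "c \<ge> 0"
  shows "(\<integral>\<^sup>+x. ennreal (\<bar>f x\<bar> powr p) \<partial>M) \<le> ennreal c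
     \<longleftrightarrow> integrable M (\<lambda>x. \<bar>f x\<bar> powr p) \<and> (\<integral>x. \<bar>f x\<bar> powr p \<partial>M) \<le> c"
proof safe
  assume *: "(\<integral>\<^sup>+x. ennreal (\<bar>f x\<bar> powr p) \<partial>M) \<le> ennreal c"
  show i: "integrable M (\<lambda>x. \<bar>f x\<bar> powr p)"
    using * assms(1) by (intro integrableI_bounded) (auto intro: order.strict_trans1)
  show "(\<integral>x. \<bar>f x\<bar> powr p \<partial>M) \<le> c"
    using * assms(2) i by (subst (asm) nn_integral_eq_integral) auto
next
  assume "integrable M (\<lambda>x. \<bar>f x\<bar> powr p)" "(\<integral>x. \<bar>f x\<bar> powr p \<partial>M) \<le> c"
  then show "(\<integral>\<^sup>+x. ennreal (\<bar>f x\<bar> powr p) \<partial>M) \<le> ennreal c"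
    by (subst nn_integral_eq_integral) (auto intro: ennreal_leI)
qed

definition mart_const :: "real \<Rightarrow> real" where
  "mart_const p = 4 * power_const p"

lemma mart_const_ge_1: "p > 0 \<Longrightarrow> mart_const p \<ge> 1"
  unfolding mart_const_def using power_const_ge_1[of p] by simp

text \<open>
  The parameter \<open>b\<close> bounds the squared \<open>L\<^sup>p\<close> norm of \<open>Y\<close>, and \<open>q\<close> that of \<open>D\<close>. As for orthogonal variables in
  \<open>L\<^sup>2\<close>, squared norms add, with a constant factor on the increment only. As \<open>b\<close> keeps the factor one,
  the bound can be iterated along a martingale.
\<close>

lemma orthogonal_increment_moment:
  fixes Y D :: "'a \<Rightarrow> real"
  assumes p: "p > 2" and b: "b > 0" and q: "q > 0"
    and [measurable]: "Y \<in> borel_measurable M" "D \<in> borel_measurable M"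
    and Y: "(\<integral>\<^sup>+x. ennreal (\<bar>Y x\<bar> powr p) \<partial>M) \<le> ennreal (b powr (p/2))"
    and D: "(\<integral>\<^sup>+x. ennreal (\<bar>D x\<bar> powr p) \<partial>M) \<le> ennreal (q powr (p/2))"
    and orth: "(\<integral>x. sgn (Y x) * \<bar>Y x\<bar> powr (p - 1) * D x \<partial>M) = 0"
  shows "(\<integral>\<^sup>+x. ennreal (\<bar>Y x + D x\<bar> powr p) \<partial>M) \<le> ennreal ((b + mart_const p * q) powr (p/2))"
proof -
  let ?K = "power_const p"
  have K: "?K \<ge> 1" using power_const_ge_1[of p] p by simp
  have Y': "integrable M (\<lambda>x. \<bar>Y x\<bar> powr p)" "(\<integral>x. \<bar>Y x\<bar> powr p \<partial>M) \<le> b powr (p/2)"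
    using Y nn_integral_powr_le_iff[of Y M "b powr (p/2)" p] by auto
  have D': "integrable M (\<lambda>x. \<bar>D x\<bar> powr p)" "(\<integral>x. \<bar>D x\<bar> powr p \<partial>M) \<le> q powr (p/2)"
    using D nn_integral_powr_le_iff[of D M "q powr (p/2)" p] by auto
  have i1: "integrable M (\<lambda>x. sgn (Y x) * \<bar>Y x\<bar> powr (p - 1) * D x)"
  proof (rule Bochner_Integration.integrable_bound)
    show "integrable M (\<lambda>x. \<bar>Y x\<bar> powr p + \<bar>D x\<bar> powr p)" using Y' D' by simp
    show "AE x in M. norm (sgn (Y x) * \<bar>Y x\<bar> powr (p - 1) * D x) \<le> norm (\<bar>Y x\<bar> powr p + \<bar>D x\<bar> powr p)"
    proof (rule AE_I2)
      fix x
      have "norm (sgn (Y x) * \<bar>Y x\<bar> powr (p - 1) * D x) \<le> \<bar>Y x\<bar> powr (p - 1) * \<bar>D x\<bar> powr 1"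
        by (auto simp: abs_mult abs_sgn_eq)
      also have "\<dots> \<le> \<bar>Y x\<bar> powr p + \<bar>D x\<bar> powr p" using p by (intro powr_Young) auto
      finally show "norm (sgn (Y x) * \<bar>Y x\<bar> powr (p - 1) * D x) \<le> norm (\<bar>Y x\<bar> powr p + \<bar>D x\<bar> powr p)"
        by simp
    qed
  qed measurable
  let ?R = "\<lambda>x. \<bar>Y x\<bar> powr p + p * (sgn (Y x) * \<bar>Y x\<bar> powr (p - 1) * D x)
     + ?K * (b powr (p/2 - 1) * q * (\<bar>Y x\<bar> powr p / b powr (p/2) + \<bar>D x\<bar> powr p / q powr (p/2)) + \<bar>D x\<bar> powr p)"
  have R: "integrable M ?R" using Y' D' i1 by (intro Bochner_Integration.integrable_add integrable_mult_right integrable_divide) auto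
  have le: "\<bar>Y x + D x\<bar> powr p \<le> ?R x" for x
  proof -
    have "?K * (\<bar>Y x\<bar> powr (p - 2) * (D x)\<^sup>2 + \<bar>D x\<bar> powr p) \<le>
       ?K * (b powr (p/2 - 1) * q * (\<bar>Y x\<bar> powr p / b powr (p/2) + \<bar>D x\<bar> powr p / q powr (p/2)) + \<bar>D x\<bar> powr p)"
      using powr_Young_weighted[OF p b q, of "Y x" "D x"] K by (intro mult_left_mono add_right_mono) auto
    then show ?thesis using abs_add_powr_le[OF p, of "Y x" "D x"] by linarith
  qed
  have i2: "integrable M (\<lambda>x. \<bar>Y x + D x\<bar> powr p)"
    by (rule Bochner_Integration.integrable_bound[OF R]) (auto intro!: AE_I2 order.trans[OF le] abs_ge_self)
  have "(\<integral>x. \<bar>Y x + D x\<bar> powr p \<partial>M) \<le> (\<integral>x. ?R x \<partial>M)"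
    using i2 R le by (intro integral_mono) auto
  also have "\<dots> = (\<integral>x. \<bar>Y x\<bar> powr p \<partial>M) + ?K * (b powr (p/2 - 1) * q * ((\<integral>x. \<bar>Y x\<bar> powr p \<partial>M) / b powr (p/2)
      + (\<integral>x. \<bar>D x\<bar> powr p \<partial>M) / q powr (p/2)) + (\<integral>x. \<bar>D x\<bar> powr p \<partial>M))"
    using Y'(1) D'(1) i1 orth by simp
  also have "\<dots> \<le> b powr (p/2) + ?K * (b powr (p/2 - 1) * q * (b powr (p/2) / b powr (p/2)
      + q powr (p/2) / q powr (p/2)) + q powr (p/2))"
    using Y' D' K b q by (intro add_mono mult_left_mono divide_right_mono) auto
  also have "\<dots> \<le> b powr (p/2) + mart_const p / 2 * (b powr (p/2 - 1) * q + q powr (p/2))"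
  proof -
    have "?K * q powr (p/2) \<le> ?K * (2 * q powr (p/2))" using K by (intro mult_left_mono) auto
    then show ?thesis using b q by (simp add: mart_const_def algebra_simps)
  qed
  also have "\<dots> \<le> (b + mart_const p * q) powr (p/2)"
    using p b q mart_const_ge_1[of p] by (intro powr_add_ge) auto
  finally have "(\<integral>x. \<bar>Y x + D x\<bar> powr p \<partial>M) \<le> (b + mart_const p * q) powr (p/2)" .
  then show ?thesis using i2
    by (subst nn_integral_powr_le_iff) auto
qed

section \<open>Exchanging coordinates of two independent sequences\<close>

definition patch :: "int set \<Rightarrow> (int \<Rightarrow> 'b) \<Rightarrow> (int \<Rightarrow> 'b) \<Rightarrow> int \<Rightarrow> 'b" where
  "patch S x y = (\<lambda>k. if k \<in> S then x k else y k)"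

lemma splice_patch_left: "S \<subseteq> R \<Longrightarrow> patch S (patch R x y) z = patch S x z"
  by (auto simp: patch_def fun_eq_iff)

lemma patch_same [simp]: "patch S x x = x"
  by (auto simp: patch_def)

locale iid_space = prob_space \<mu> for \<mu> :: "'b measure"
begin

abbreviation P :: "(int \<Rightarrow> 'b) measure" where "P \<equiv> PiM UNIV (\<lambda>_. \<mu>)"
abbreviation PP :: "((int \<Rightarrow> 'b) \<times> (int \<Rightarrow> 'b)) measure" where "PP \<equiv> P \<Otimes>\<^sub>M P"

sublocale product_prob_space "\<lambda>_::int. \<mu>" UNIV ..

sublocale PP: pair_prob_space P P ..

lemma space_P: "x \<in> space P \<longleftrightarrow> (\<forall>k. x k \<in> space \<mu>)"
  by (auto simp: space_PiM)

lemma patch_in_space: "x \<in> space P \<Longrightarrow> y \<in> space P \<Longrightarrow> patch S x y \<in> space P"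
  by (auto simp: space_P patch_def)

lemma measurable_patch [measurable]:
  assumes [measurable]: "f \<in> measurable N P" "g \<in> measurable N P"
  shows "(\<lambda>z. patch S (f z) (g z)) \<in> measurable N P"
proof (rule measurable_PiM_single')
  fix k show "(\<lambda>z. patch S (f z) (g z) k) \<in> measurable N \<mu>"
  proof (cases "k \<in> S")
    case True
    then show ?thesis by (simp add: patch_def) measurable
  next
    case False
    then show ?thesis by (simp add: patch_def) measurable
  qed
qed (use measurable_space[OF assms(1)] measurable_space[OF assms(2)] in
      \<open>auto simp: space_P patch_def PiE_iff\<close>)

text \<open>
  Swaps the two sequences outside \<open>S\<close>. For two independent copies of an i.i.d. sequence this
  preserves the joint law, and the properties of the conditional expectations below follow from
  this invariance.
\<close>

definition exchange :: "int set \<Rightarrow> (int \<Rightarrow> 'b) \<times> (int \<Rightarrow> 'b) \<Rightarrow> (int \<Rightarrow> 'b) \<times> (int \<Rightarrow> 'b)" where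
  "exchange S z = (patch S (fst z) (snd z), patch S (snd z) (fst z))"

lemma measurable_exchange [measurable]: "exchange S \<in> measurable PP PP"
  unfolding exchange_def by measurable

definition cylinder :: "(int \<Rightarrow> 'b set) \<Rightarrow> (int \<Rightarrow> 'b) set" where
  "cylinder E = {x \<in> space P. \<forall>k. x k \<in> E k}"

lemma prod_algebra_cylinderE:
  assumes "A \<in> prod_algebra UNIV (\<lambda>_::int. \<mu>)"
  obtains J E where "finite J" "\<And>k. E k \<in> sets \<mu>" "\<And>k. k \<notin> J \<Longrightarrow> E k = space \<mu>" "A = cylinder E"
proof -
  from assms obtain J E where *: "A = prod_emb UNIV (\<lambda>_. \<mu>) J (\<Pi>\<^sub>E j\<in>J. E j)"
    "finite J" "\<And>i. i \<in> J \<Longrightarrow> E i \<in> sets \<mu>"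
    by (rule prod_algebraE) auto
  let ?E = "\<lambda>k. if k \<in> J then E k else space \<mu>"
  have "A = cylinder ?E"
    using *(3)[THEN sets.sets_into_space] unfolding *(1)
    by (subst prod_emb_PiE) (auto simp: cylinder_def space_P PiE_iff split: if_splits, metis subsetD)
  then show thesis using that[of J ?E] * by auto
qed

lemma emeasure_cylinder:
  assumes "finite J" "\<And>k. E k \<in> sets \<mu>" "\<And>k. k \<notin> J \<Longrightarrow> E k = space \<mu>"
  shows "emeasure P (cylinder E) = (\<Prod>k\<in>J. emeasure \<mu> (E k))" "cylinder E \<in> sets P"
proof -
  have *: "cylinder E = {x \<in> space P. \<forall>k\<in>J. x k \<in> E k}"
    using assms(3) unfolding cylinder_def by (auto simp: space_P)
  show "emeasure P (cylinder E) = (\<Prod>k\<in>J. emeasure \<mu> (E k))"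
    unfolding * using assms by (intro emeasure_PiM_Collect) auto
  have [measurable]: "E k \<in> sets \<mu>" for k by fact
  show "cylinder E \<in> sets P" unfolding * using assms(1) by measurable
qed

text \<open>
  On a rectangle of two cylinders the preimage is again such a rectangle, with the same factors in
  a different order; these rectangles form a generator that is closed under intersection.
\<close>

lemma distr_exchange: "distr PP PP (exchange S) = PP"
proof -
  let ?G = "prod_algebra UNIV (\<lambda>_::int. \<mu>)"
  let ?E = "{a \<times> b | a b. a \<in> ?G \<and> b \<in> ?G}"
  let ?\<Omega> = "space P \<times> space P"
  have G: "?G \<subseteq> Pow (space P)" "sets P = sigma_sets (space P) ?G"
    by (auto simp: space_PiM sets_PiM dest: subsetD[OF prod_algebra_sets_into_space])
  have top: "space P \<in> ?G"
  proof -
    have "prod_emb UNIV (\<lambda>_. \<mu>) {0} (\<Pi>\<^sub>E j\<in>{0}. space \<mu>) \<in> ?G"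
      by (rule prod_algebraI) auto
    also have "prod_emb UNIV (\<lambda>_. \<mu>) {0} (\<Pi>\<^sub>E j\<in>{0}. space \<mu>) = space P"
      by (subst prod_emb_PiE) (auto simp: space_PiM)
    finally show ?thesis .
  qed
  have sets_PP: "sets PP = sigma_sets ?\<Omega> ?E"
    using sets_pair_eq[OF G _ _ _ G, of "{space P}" "{space P}"] G top by (auto simp: sets_measure_of_conv)
  show ?thesis
  proof (rule measure_eqI_generator_eq[of ?E ?\<Omega>, where A = "\<lambda>_. ?\<Omega>"])
    show "Int_stable ?E"
    proof (rule Int_stableI)
      fix A B assume "A \<in> ?E" "B \<in> ?E"
      then obtain a b a' b' where "A = a \<times> b" "B = a' \<times> b'" "a \<in> ?G" "b \<in> ?G" "a' \<in> ?G" "b' \<in> ?G" by auto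
      then show "A \<inter> B \<in> ?E"
        using Int_stable_prod_algebra[of UNIV "\<lambda>_::int. \<mu>"]
        by (auto simp: Int_stable_def Times_Int_Times)
    qed
    show "?E \<subseteq> Pow ?\<Omega>" using G by auto
    show "sets PP = sigma_sets ?\<Omega> ?E" "sets (distr PP PP (exchange S)) = sigma_sets ?\<Omega> ?E"
      using sets_PP by auto
    show "range (\<lambda>_::nat. ?\<Omega>) \<subseteq> ?E" using top by auto
    show "(\<Union>i::nat. ?\<Omega>) = ?\<Omega>" by simp
    interpret D: prob_space "distr PP PP (exchange S)" by (intro PP.prob_space_distr) measurable
    show "emeasure (distr PP PP (exchange S)) ?\<Omega> \<noteq> \<infinity>" by simp
    fix X assume "X \<in> ?E"
    then obtain a b where X: "X = a \<times> b" and ab: "a \<in> ?G" "b \<in> ?G" by auto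
    obtain J E where E: "finite J" "\<And>k. E k \<in> sets \<mu>" "\<And>k. k \<notin> J \<Longrightarrow> E k = space \<mu>" "a = cylinder E"
      using prod_algebra_cylinderE[OF ab(1)] by blast
    obtain K F where F: "finite K" "\<And>k. F k \<in> sets \<mu>" "\<And>k. k \<notin> K \<Longrightarrow> F k = space \<mu>" "b = cylinder F"
      using prod_algebra_cylinderE[OF ab(2)] by blast
    let ?L = "J \<union> K"
    let ?E' = "\<lambda>k. if k \<in> S then E k else F k" and ?F' = "\<lambda>k. if k \<in> S then F k else E k"
    have fin: "finite ?L" using E F by simp
    note m = emeasure_cylinder[OF fin, of E] emeasure_cylinder[OF fin, of F]
      emeasure_cylinder[OF fin, of ?E'] emeasure_cylinder[OF fin, of ?F']
    have pre: "exchange S -` X \<inter> space PP = cylinder ?E' \<times> cylinder ?F'"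
      unfolding X E(4) F(4) cylinder_def exchange_def
      by (auto simp: space_pair_measure patch_in_space) (auto simp: patch_def split: if_splits)
    have XP: "X \<in> sets PP" unfolding X E(4) F(4) using m E F by auto
    have "emeasure (distr PP PP (exchange S)) X = emeasure PP (cylinder ?E' \<times> cylinder ?F')"
      using XP by (subst emeasure_distr) (simp_all add: pre)
    also have "\<dots> = (\<Prod>k\<in>?L. emeasure \<mu> (?E' k)) * (\<Prod>k\<in>?L. emeasure \<mu> (?F' k))"
      using m E F by (subst emeasure_pair_measure_Times) auto
    also have "\<dots> = (\<Prod>k\<in>?L. emeasure \<mu> (E k)) * (\<Prod>k\<in>?L. emeasure \<mu> (F k))"
      unfolding prod.distrib[symmetric] by (intro prod.cong) (auto simp: mult.commute)
    also have "\<dots> = emeasure PP X"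
      unfolding X E(4) F(4) using m E F by (subst emeasure_pair_measure_Times) auto
    finally show "emeasure (distr PP PP (exchange S)) X = emeasure PP X" .
  qed
qed

lemma distr_patch: "distr PP P (\<lambda>z. patch S (fst z) (snd z)) = P"
proof -
  have "distr PP P (\<lambda>z. patch S (fst z) (snd z)) = distr (distr PP PP (exchange S)) P fst"
    by (subst distr_distr) (auto simp: exchange_def comp_def)
  also have "\<dots> = P"
    unfolding distr_exchange by (rule distr_pair_fst)
  finally show ?thesis .
qed

lemma nn_integral_patch:
  assumes [measurable]: "f \<in> borel_measurable P"
  shows "(\<integral>\<^sup>+x. \<integral>\<^sup>+y. f (patch S x y) \<partial>P \<partial>P) = (\<integral>\<^sup>+x. f x \<partial>P)"
proof -
  have "(\<integral>\<^sup>+x. \<integral>\<^sup>+y. f (patch S x y) \<partial>P \<partial>P) = (\<integral>\<^sup>+z. f (patch S (fst z) (snd z)) \<partial>PP)"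
    by (subst nn_integral_fst[symmetric]) auto
  also have "\<dots> = (\<integral>\<^sup>+x. f x \<partial>distr PP P (\<lambda>z. patch S (fst z) (snd z)))"
    by (subst nn_integral_distr) auto
  finally show ?thesis by (simp only: distr_patch)
qed

lemma integrable_patch:
  fixes f :: "(int \<Rightarrow> 'b) \<Rightarrow> real"
  assumes "integrable P f"
  shows "integrable PP (\<lambda>z. f (patch S (fst z) (snd z)))"
  using assms by (subst integrable_distr_eq[of "\<lambda>z. patch S (fst z) (snd z)", symmetric, where N = P])
    (auto simp: distr_patch)

lemma integral_patch:
  fixes f :: "(int \<Rightarrow> 'b) \<Rightarrow> real"
  assumes [measurable]: "f \<in> borel_measurable P"
  shows "(\<integral>z. f (patch S (fst z) (snd z)) \<partial>PP) = (\<integral>x. f x \<partial>P)"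
proof -
  have "(\<integral>z. f (patch S (fst z) (snd z)) \<partial>PP) = (\<integral>x. f x \<partial>distr PP P (\<lambda>z. patch S (fst z) (snd z)))"
    by (subst integral_distr) auto
  then show ?thesis by (simp only: distr_patch)
qed

lemma integrable_snd_PP:
  fixes f :: "(int \<Rightarrow> 'b) \<Rightarrow> real"
  assumes "integrable P f"
  shows "integrable PP (\<lambda>z. f (snd z))"
  using integrable_patch[OF assms, of "{}"] by (simp add: patch_def)

lemma integral_snd_PP:
  fixes f :: "(int \<Rightarrow> 'b) \<Rightarrow> real"
  assumes "f \<in> borel_measurable P"
  shows "(\<integral>z. f (snd z) \<partial>PP) = (\<integral>x. f x \<partial>P)"
  using integral_patch[OF assms, of "{}"] by (simp add: patch_def)

section \<open>The remote past\<close>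

text \<open>
  The \<open>L\<^sup>1\<close> distance between \<open>f\<close> at a sequence and \<open>f\<close> after its coordinates up to \<open>- n\<close> have been
  replaced by those of an independent copy. That it vanishes as \<open>n\<close> grows is a quantitative form of
  the triviality of the remote past.
\<close>

definition remote_gap :: "((int \<Rightarrow> 'b) \<Rightarrow> real) \<Rightarrow> nat \<Rightarrow> real" where
  "remote_gap f n = (\<integral>z. \<bar>f (patch {..- int n} (fst z) (snd z)) - f (snd z)\<bar> \<partial>PP)"

lemma remote_gap_nonneg: "remote_gap f n \<ge> 0"
  by (simp add: remote_gap_def)

lemma remote_gap_triangle:
  assumes f: "integrable P f" and g: "integrable P g"
  shows "remote_gap f n \<le> remote_gap g n + 2 * (\<integral>x. \<bar>f x - g x\<bar> \<partial>P)"
proof -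
  let ?s = "\<lambda>z. patch {..- int n} (fst z) (snd z)"
  have fg: "integrable P (\<lambda>x. \<bar>f x - g x\<bar>)" using f g by simp
  note i = integrable_patch[OF f, of "{..- int n}"] integrable_patch[OF g, of "{..- int n}"]
    integrable_snd_PP[OF f] integrable_snd_PP[OF g]
    integrable_patch[OF fg, of "{..- int n}"] integrable_snd_PP[OF fg]
  have "remote_gap f n \<le> (\<integral>z. \<bar>g (?s z) - g (snd z)\<bar> + (\<bar>f (?s z) - g (?s z)\<bar> + \<bar>f (snd z) - g (snd z)\<bar>) \<partial>PP)"
    unfolding remote_gap_def using i
    by (intro integral_mono Bochner_Integration.integrable_add Bochner_Integration.integrable_diff
         integrable_abs) auto
  also have "\<dots> = remote_gap g n + ((\<integral>z. \<bar>f (?s z) - g (?s z)\<bar> \<partial>PP) + (\<integral>z. \<bar>f (snd z) - g (snd z)\<bar> \<partial>PP))"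
    unfolding remote_gap_def using i
    by (subst Bochner_Integration.integral_add; (subst Bochner_Integration.integral_add)?) auto
  also have "(\<integral>z. \<bar>f (?s z) - g (?s z)\<bar> \<partial>PP) = (\<integral>x. \<bar>f x - g x\<bar> \<partial>P)"
    using integral_patch[of "\<lambda>x. \<bar>f x - g x\<bar>"] fg by auto
  also have "(\<integral>z. \<bar>f (snd z) - g (snd z)\<bar> \<partial>PP) = (\<integral>x. \<bar>f x - g x\<bar> \<partial>P)"
    using integral_snd_PP[of "\<lambda>x. \<bar>f x - g x\<bar>"] fg by auto
  finally show ?thesis by simp
qed

lemma remote_gap_add:
  assumes f: "integrable P f" and g: "integrable P g"
  shows "remote_gap (\<lambda>x. f x + g x) n \<le> remote_gap f n + remote_gap g n"
proof -
  let ?s = "\<lambda>z. patch {..- int n} (fst z) (snd z)"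
  note i = integrable_patch[OF f, of "{..- int n}"] integrable_patch[OF g, of "{..- int n}"]
    integrable_snd_PP[OF f] integrable_snd_PP[OF g]
  have "remote_gap (\<lambda>x. f x + g x) n \<le> (\<integral>z. \<bar>f (?s z) - f (snd z)\<bar> + \<bar>g (?s z) - g (snd z)\<bar> \<partial>PP)"
    unfolding remote_gap_def using i by (intro integral_mono) auto
  also have "\<dots> = remote_gap f n + remote_gap g n"
    unfolding remote_gap_def using i by (subst Bochner_Integration.integral_add) auto
  finally show ?thesis .
qed

lemma remote_gap_limit:
  assumes f: "integrable P f" and g: "\<And>m. integrable P (g m)"
    and lim: "(\<lambda>m::nat. \<integral>x. \<bar>f x - g m x\<bar> \<partial>P) \<longlonglongrightarrow> 0"
    and gap: "\<And>m. remote_gap (g m) \<longlonglongrightarrow> 0"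
  shows "remote_gap f \<longlonglongrightarrow> 0"
proof (rule LIMSEQ_I)
  fix r :: real assume r: "r > 0"
  obtain m where m: "(\<integral>x. \<bar>f x - g m x\<bar> \<partial>P) < r / 4"
    using order_tendstoD(2)[OF lim, of "r / 4"] r by (auto simp: eventually_sequentially)
  obtain N where N: "\<And>n. n \<ge> N \<Longrightarrow> remote_gap (g m) n < r / 2"
    using order_tendstoD(2)[OF gap[of m], of "r / 2"] r by (auto simp: eventually_sequentially)
  show "\<exists>no. \<forall>n\<ge>no. norm (remote_gap f n - 0) < r"
  proof (intro exI allI impI)
    fix n assume "n \<ge> N"
    then show "norm (remote_gap f n - 0) < r"
      using remote_gap_triangle[OF f g[of m], of n] m N[of n] remote_gap_nonneg[of f n] by simp
  qed
qed

text \<open>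
  For a cylinder the gap is exactly zero once the replaced coordinates lie below its finite
  support. The sets for which the gap tends to zero are closed under complements and disjoint
  countable unions.
\<close>

lemma remote_gap_indicator:
  assumes "A \<in> sets P"
  shows "remote_gap (indicator A) \<longlonglongrightarrow> 0"
proof -
  let ?G = "prod_algebra UNIV (\<lambda>_::int. \<mu>)"
  have sets: "sets P = sigma_sets (space P) ?G"
    by (simp add: space_PiM sets_PiM)
  have int: "integrable P (indicator A :: _ \<Rightarrow> real)" if "A \<in> sets P" for A
    using that by (intro integrable_real_indicator) (auto simp: less_top[symmetric])
  have A: "A \<in> sigma_sets (space P) ?G" using assms sets by simp
  have G: "?G \<subseteq> Pow (space P)"
    by (auto simp: space_PiM dest: subsetD[OF prod_algebra_sets_into_space])
  show ?thesis
    using Int_stable_prod_algebra[of UNIV "\<lambda>_::int. \<mu>"] G A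
  proof (induction rule: sigma_sets_induct_disjoint)
    case (basic A)
    obtain J E where E: "finite J" "\<And>k. E k \<in> sets \<mu>" "\<And>k. k \<notin> J \<Longrightarrow> E k = space \<mu>" "A = cylinder E"
      using prod_algebra_cylinderE[OF basic] by blast
    obtain n0 where n0: "\<And>k. k \<in> J \<Longrightarrow> - int n0 < k"
    proof -
      have "finite ((\<lambda>k. nat (- k)) ` J)" using E by simp
      then obtain N where "\<forall>k\<in>J. nat (- k) \<le> N" by (auto simp: finite_nat_set_iff_bounded_le)
      then have "- int (Suc N) < k" if "k \<in> J" for k using that by fastforce
      then show ?thesis using that by blast
    qed
    have "remote_gap (indicator A) n = 0" if n: "n \<ge> n0" for n
    proof -
      have "indicator A (patch {..- int n} (fst z) (snd z)) = (indicator A (snd z) :: real)"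
        if z: "z \<in> space PP" for z
      proof -
        have "patch {..- int n} (fst z) (snd z) \<in> A \<longleftrightarrow> snd z \<in> A"
          unfolding E(4) cylinder_def mem_Collect_eq
        proof (intro conj_cong all_cong1)
          show "patch {..- int n} (fst z) (snd z) \<in> space P \<longleftrightarrow> snd z \<in> space P"
            using z by (auto simp: space_pair_measure patch_in_space)
          fix k
          show "patch {..- int n} (fst z) (snd z) k \<in> E k \<longleftrightarrow> snd z k \<in> E k"
            using z n n0[of k] E(3)[of k]
            by (cases "k \<in> J") (simp_all add: patch_def space_pair_measure mem_Times_iff space_P)
        qed
        then show ?thesis by (simp add: indicator_def)
      qed
      then have "remote_gap (indicator A) n = (\<integral>z. 0 \<partial>PP)"
        unfolding remote_gap_def by (intro Bochner_Integration.integral_cong) auto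
      then show ?thesis by simp
    qed
    then show ?case by (intro tendsto_eventually) (auto simp: eventually_sequentially)
  next
    case empty show ?case by (simp add: remote_gap_def)
  next
    case (compl A)
    have "remote_gap (indicator (space P - A)) n = remote_gap (indicator A) n" for n
      unfolding remote_gap_def
      by (intro Bochner_Integration.integral_cong)
        (auto simp: space_pair_measure patch_in_space indicator_def)
    then show ?case using compl by simp
  next
    case (union A)
    have A: "A i \<in> sets P" for i using union sets by auto
    let ?f = "indicator (\<Union>i. A i) :: _ \<Rightarrow> real"
    let ?g = "\<lambda>m x. \<Sum>i<m. indicator (A i) x :: real"
    have gint: "integrable P (?g m)" for m
      by (intro Bochner_Integration.integrable_sum int A)
    have geq: "?g m x = indicator (\<Union>i<m. A i) x" for m x
    proof -
      have "disjoint_family_on A {..<m}"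
        using union(1) by (rule disjoint_family_on_mono[rotated]) simp
      then show "?g m x = indicator (\<Union>i<m. A i) x"
        by (subst indicator_UN_disjoint) simp_all
    qed
    show ?case
    proof (rule remote_gap_limit[where g = ?g])
      show "integrable P ?f" by (intro int sets.countable_UN) (use A in auto)
      show "integrable P (?g m)" for m by fact
      show "(\<lambda>m. \<integral>x. \<bar>?f x - ?g m x\<bar> \<partial>P) \<longlonglongrightarrow> 0"
      proof -
        have "(\<lambda>m. \<integral>x. \<bar>?f x - ?g m x\<bar> \<partial>P) \<longlonglongrightarrow> (\<integral>x. 0 \<partial>P)"
        proof (rule integral_dominated_convergence[where w = "\<lambda>_. 1"])
          show "(\<lambda>x. 0::real) \<in> borel_measurable P" "integrable P (\<lambda>_. 1::real)" by simp_all
          note [measurable] = A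
          show "(\<lambda>x. \<bar>?f x - ?g m x\<bar>) \<in> borel_measurable P" for m
            by measurable
          show "AE x in P. (\<lambda>m. \<bar>?f x - ?g m x\<bar>) \<longlonglongrightarrow> 0"
          proof (rule AE_I2)
            fix x
            have "eventually (\<lambda>m. \<bar>?f x - ?g m x\<bar> = 0) sequentially"
            proof (cases "x \<in> (\<Union>i. A i)")
              case True
              then obtain i where "x \<in> A i" by auto
              then show ?thesis unfolding geq
                by (intro eventually_sequentiallyI[of "Suc i"]) (auto simp: indicator_def)
            next
              case False
              then show ?thesis unfolding geq by (auto simp: indicator_def)
            qed
            then show "(\<lambda>m. \<bar>?f x - ?g m x\<bar>) \<longlonglongrightarrow> 0" by (rule tendsto_eventually)
          qed
          show "AE x in P. norm \<bar>?f x - ?g m x\<bar> \<le> 1" for m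
            unfolding geq by (auto simp: indicator_def)
        qed
        then show ?thesis by simp
      qed
      show "remote_gap (?g m) \<longlonglongrightarrow> 0" for m
      proof (induction m)
        case 0 show ?case by (simp add: remote_gap_def)
      next
        case (Suc m)
        have "(\<lambda>n. remote_gap (?g m) n + remote_gap (indicator (A m)) n) \<longlonglongrightarrow> 0 + 0"
          by (intro tendsto_add Suc union)
        then show ?case
          using remote_gap_add[OF gint[of m] int[OF A[of m]]]
          by (intro tendsto_sandwich[of "\<lambda>_. 0" "remote_gap (?g (Suc m))" sequentially])
             (auto simp: remote_gap_nonneg)
      qed
    qed
  qed
qed

lemma remote_gap_tendsto_0:
  assumes "integrable P f"
  shows "remote_gap f \<longlonglongrightarrow> 0"
  using assms
proof (induction rule: integrable_induct)
  case (base A c)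
  have "remote_gap (\<lambda>x. indicator A x *\<^sub>R c) n = remote_gap (indicator A) n * \<bar>c\<bar>" for n
    by (simp add: remote_gap_def abs_mult flip: left_diff_distrib)
  then show ?case using tendsto_mult_right[OF remote_gap_indicator[OF base(1)], of "\<bar>c\<bar>"]
    by (simp add: mult.commute)
next
  case (add f g)
  have "(\<lambda>n. remote_gap f n + remote_gap g n) \<longlonglongrightarrow> 0 + 0" by (intro tendsto_add add)
  then show ?case
    using remote_gap_add[OF add.hyps]
    by (intro tendsto_sandwich[of "\<lambda>_. 0" "remote_gap (\<lambda>x. f x + g x)" sequentially])
      (auto simp: remote_gap_nonneg)
next
  case (lim f s)
  have [measurable]: "f \<in> borel_measurable P" "s m \<in> borel_measurable P" for m using lim by auto
  have "(\<lambda>m. \<integral>x. \<bar>f x - s m x\<bar> \<partial>P) \<longlonglongrightarrow> (\<integral>x. 0 \<partial>P)"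
  proof (rule integral_dominated_convergence[where w = "\<lambda>x. 3 * \<bar>f x\<bar>"])
    show "integrable P (\<lambda>x. 3 * \<bar>f x\<bar>)" using lim by simp
    show "AE x in P. (\<lambda>m. \<bar>f x - s m x\<bar>) \<longlonglongrightarrow> 0"
      using lim.hyps(2) by (auto intro!: AE_I2 tendsto_eq_intros)
    show "AE x in P. norm \<bar>f x - s m x\<bar> \<le> 3 * \<bar>f x\<bar>" for m
    proof (rule AE_I2)
      fix x assume "x \<in> space P"
      with lim.hyps(3)[OF this, of m] show "norm \<bar>f x - s m x\<bar> \<le> 3 * \<bar>f x\<bar>" by simp
    qed
  qed auto
  then show ?case using lim by (intro remote_gap_limit[of f s]) auto
qed

end

section \<open>Convexity inequalities for absolute moments\<close>

text \<open>
  The graph of \<open>x powr p\<close> lies above its tangent at \<open>m\<close>. This form of convexity includes \<open>m = 0\<close> and yields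
  both Jensen's inequality and the triangle inequality in \<open>L\<^sup>p\<close>.
\<close>

lemma powr_tangent_le:
  fixes x m p :: real
  assumes p: "p > 1" and "x \<ge> 0" "m \<ge> 0"
  shows "m powr p + p * m powr (p - 1) * (x - m) \<le> x powr p"
proof -
  define q where "q = p / (p - 1)"
  have q: "q > 1" "1 / p + 1 / q = 1" using p by (auto simp: q_def field_simps)
  have mq: "(m powr (p - 1)) powr q = m powr p"
    using p by (simp add: powr_powr q_def)
  have "x * m powr (p - 1) \<le> x powr p / p + m powr p / q"
    using Youngs_inequality[of p q x "m powr (p - 1)"] p q assms by (simp add: mq)
  then have "p * (x * m powr (p - 1)) \<le> p * (x powr p / p + m powr p / q)"
    using p by (intro mult_left_mono) auto
  also have "\<dots> = x powr p + (p - 1) * m powr p" using p by (simp add: q_def field_simps)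
  finally have "p * (x * m powr (p - 1)) \<le> x powr p + (p - 1) * m powr p" .
  moreover have "m * m powr (p - 1) = m powr p" using powr_mult_base[of m "p - 1"] assms by simp
  ultimately show ?thesis by (simp add: algebra_simps)
qed

lemma sum_powr_weighted_le:
  fixes f w :: "'i \<Rightarrow> real"
  assumes p: "p > 1" and I: "finite I" and w: "\<And>i. i \<in> I \<Longrightarrow> w i > 0"
  shows "\<bar>\<Sum>i\<in>I. f i\<bar> powr p \<le> (\<Sum>i\<in>I. w i) powr (p - 1) * (\<Sum>i\<in>I. w i powr (1 - p) * \<bar>f i\<bar> powr p)"
proof (cases "I = {}")
  case False
  define W where "W = (\<Sum>i\<in>I. w i)"
  have W: "W > 0" unfolding W_def using I False w by (intro sum_pos) auto
  define m where "m = \<bar>\<Sum>i\<in>I. f i\<bar> / W"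
  have m: "m \<ge> 0" using W by (simp add: m_def)
  have "W * m powr p \<le> W * m powr p + p * m powr (p - 1) * ((\<Sum>i\<in>I. \<bar>f i\<bar>) - W * m)"
  proof -
    have "W * m = \<bar>\<Sum>i\<in>I. f i\<bar>" using W by (simp add: m_def)
    then have "W * m \<le> (\<Sum>i\<in>I. \<bar>f i\<bar>)" by (simp add: sum_abs)
    then show ?thesis using p by simp
  qed
  also have "\<dots> = (\<Sum>i\<in>I. w i * (m powr p + p * m powr (p - 1) * (\<bar>f i\<bar> / w i - m)))"
  proof -
    have "(\<Sum>i\<in>I. w i * (m powr p + p * m powr (p - 1) * (\<bar>f i\<bar> / w i - m)))
        = (\<Sum>i\<in>I. w i * m powr p + p * m powr (p - 1) * (\<bar>f i\<bar> - w i * m))"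
      using w by (intro sum.cong) (force simp: field_simps)+
    then show ?thesis
      by (simp add: sum.distrib sum_subtractf flip: sum_distrib_left sum_distrib_right W_def)
  qed
  also have "\<dots> \<le> (\<Sum>i\<in>I. w i * (\<bar>f i\<bar> / w i) powr p)"
    using w m p
    by (intro sum_mono mult_left_mono powr_tangent_le divide_nonneg_pos) (auto intro: less_imp_le)
  also have "\<dots> = (\<Sum>i\<in>I. w i powr (1 - p) * \<bar>f i\<bar> powr p)"
    using w by (intro sum.cong) (auto simp: powr_divide powr_diff less_imp_le)
  finally have *: "W * m powr p \<le> (\<Sum>i\<in>I. w i powr (1 - p) * \<bar>f i\<bar> powr p)" .
  have "\<bar>\<Sum>i\<in>I. f i\<bar> powr p = W powr (p - 1) * (W * m powr p)"
    using W by (simp add: m_def powr_divide powr_diff)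
  also have "\<dots> \<le> W powr (p - 1) * (\<Sum>i\<in>I. w i powr (1 - p) * \<bar>f i\<bar> powr p)"
    using * by (intro mult_left_mono) auto
  finally show ?thesis by (simp add: W_def)
qed (use p in simp)

text \<open>
  The triangle inequality in \<open>L\<^sup>p\<close>. The weights are the bounds on the norms themselves, which makes
  the weighted convexity bound sharp.
\<close>

lemma nn_integral_sum_powr_le:
  fixes f :: "'i \<Rightarrow> 'a \<Rightarrow> real" and w :: "'i \<Rightarrow> real"
  assumes p: "p > 1" and I: "finite I" and w: "\<And>i. i \<in> I \<Longrightarrow> w i > 0"
    and [measurable]: "\<And>i. i \<in> I \<Longrightarrow> f i \<in> borel_measurable M"
    and f: "\<And>i. i \<in> I \<Longrightarrow> (\<integral>\<^sup>+x. ennreal (\<bar>f i x\<bar> powr p) \<partial>M) \<le> ennreal (w i powr p)"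
  shows "(\<integral>\<^sup>+x. ennreal (\<bar>\<Sum>i\<in>I. f i x\<bar> powr p) \<partial>M) \<le> ennreal ((\<Sum>i\<in>I. w i) powr p)"
proof -
  define W where "W = (\<Sum>i\<in>I. w i)"
  have W: "W \<ge> 0" unfolding W_def using w by (intro sum_nonneg) (auto intro: less_imp_le)
  have "(\<integral>\<^sup>+x. ennreal (\<bar>\<Sum>i\<in>I. f i x\<bar> powr p) \<partial>M)
     \<le> (\<integral>\<^sup>+x. ennreal (W powr (p - 1)) * (\<Sum>i\<in>I. ennreal (w i powr (1 - p)) * ennreal (\<bar>f i x\<bar> powr p)) \<partial>M)"
  proof (intro nn_integral_mono)
    fix x
    have "ennreal (\<bar>\<Sum>i\<in>I. f i x\<bar> powr p)
        \<le> ennreal (W powr (p - 1) * (\<Sum>i\<in>I. w i powr (1 - p) * \<bar>f i x\<bar> powr p))"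
      unfolding W_def by (intro ennreal_leI sum_powr_weighted_le assms)
    also have "\<dots> = ennreal (W powr (p - 1)) * (\<Sum>i\<in>I. ennreal (w i powr (1 - p)) * ennreal (\<bar>f i x\<bar> powr p))"
      by (simp add: ennreal_mult sum_nonneg sum_ennreal flip: ennreal_mult)
    finally show "ennreal (\<bar>\<Sum>i\<in>I. f i x\<bar> powr p)
      \<le> ennreal (W powr (p - 1)) * (\<Sum>i\<in>I. ennreal (w i powr (1 - p)) * ennreal (\<bar>f i x\<bar> powr p))" .
  qed
  also have "\<dots> = ennreal (W powr (p - 1)) * (\<Sum>i\<in>I. ennreal (w i powr (1 - p)) * (\<integral>\<^sup>+x. ennreal (\<bar>f i x\<bar> powr p) \<partial>M))"
    by (simp add: nn_integral_cmult nn_integral_sum)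
  also have "\<dots> \<le> ennreal (W powr (p - 1)) * (\<Sum>i\<in>I. ennreal (w i powr (1 - p)) * ennreal (w i powr p))"
    by (intro mult_left_mono sum_mono f) auto
  also have "(\<Sum>i\<in>I. ennreal (w i powr (1 - p)) * ennreal (w i powr p)) = (\<Sum>i\<in>I. ennreal (w i))"
  proof (intro sum.cong refl)
    fix i assume "i \<in> I"
    with w[OF this] show "ennreal (w i powr (1 - p)) * ennreal (w i powr p) = ennreal (w i)"
      by (simp flip: ennreal_mult powr_add)
  qed
  also have "\<dots> = ennreal W" using w by (simp add: W_def sum_ennreal less_imp_le)
  also have "ennreal (W powr (p - 1)) * ennreal W = ennreal (W powr p)"
    using powr_mult_base[OF W, of "p - 1"] W by (simp add: mult.commute flip: ennreal_mult)
  finally show ?thesis by (simp add: W_def)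
qed

text \<open>
  Jensen's inequality without integrability assumptions: the left-hand side is zero if \<open>g\<close> is not
  integrable, and the right-hand side is infinite if \<open>\<bar>g\<bar> powr p\<close> is not.
\<close>

lemma (in prob_space) abs_expectation_powr_le:
  fixes g :: "'a \<Rightarrow> real"
  assumes p: "p > 1" and [measurable]: "g \<in> borel_measurable M"
  shows "ennreal (\<bar>\<integral>x. g x \<partial>M\<bar> powr p) \<le> (\<integral>\<^sup>+x. ennreal (\<bar>g x\<bar> powr p) \<partial>M)"
proof (cases "integrable M g \<and> integrable M (\<lambda>x. \<bar>g x\<bar> powr p)")
  case True
  define m where "m = (\<integral>x. \<bar>g x\<bar> \<partial>M)"
  have m: "m \<ge> 0" unfolding m_def by simp
  have i: "integrable M (\<lambda>x. \<bar>g x\<bar>)" using True by simp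
  have "\<bar>\<integral>x. g x \<partial>M\<bar> powr p \<le> m powr p"
    unfolding m_def using p integral_abs_bound[of M g] by (intro powr_mono2) auto
  also have "m powr p = m powr p + p * m powr (p - 1) * (m - m)" by simp
  also have "\<dots> = (\<integral>x. m powr p + p * m powr (p - 1) * (\<bar>g x\<bar> - m) \<partial>M)"
    using i by (simp add: prob_space m_def)
  also have "\<dots> \<le> (\<integral>x. \<bar>g x\<bar> powr p \<partial>M)"
    using i True p m by (intro integral_mono powr_tangent_le) auto
  finally show ?thesis using True by (subst nn_integral_eq_integral) (auto intro: ennreal_leI)
next
  case False
  then consider "\<not> integrable M g" | "\<not> integrable M (\<lambda>x. \<bar>g x\<bar> powr p)" by auto
  then show ?thesis
  proof cases
    case 1 then show ?thesis using p by (simp add: not_integrable_integral_eq)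
  next
    case 2
    then have "(\<integral>\<^sup>+x. ennreal (\<bar>g x\<bar> powr p) \<partial>M) = \<infinity>"
      by (simp add: integrable_iff_bounded) (simp add: less_top[symmetric])
    then show ?thesis by simp
  qed
qed

lemma (in prob_space) integrable_if_integrable_powr:
  fixes f :: "'a \<Rightarrow> real"
  assumes p: "p > 1" and [measurable]: "f \<in> borel_measurable M"
    and f: "integrable M (\<lambda>x. \<bar>f x\<bar> powr p)"
  shows "integrable M f"
proof (rule Bochner_Integration.integrable_bound)
  show "integrable M (\<lambda>x. 1 + \<bar>f x\<bar> powr p)" using f by simp
  show "AE x in M. norm (f x) \<le> norm (1 + \<bar>f x\<bar> powr p)"
  proof (rule AE_I2)
    fix x
    have "\<bar>f x\<bar> \<le> 1 + \<bar>f x\<bar> powr p"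
    proof (cases "\<bar>f x\<bar> \<le> 1")
      case False
      then show ?thesis using powr_mono[of 1 p "\<bar>f x\<bar>"] p by simp
    qed (simp add: add_increasing2)
    then show "norm (f x) \<le> norm (1 + \<bar>f x\<bar> powr p)" by simp
  qed
qed measurable

section \<open>Moments of causal functions of i.i.d. coordinates\<close>

context iid_space
begin

text \<open>
  The conditional expectation of \<open>f\<close> given the coordinates up to \<open>i\<close>, as a function defined
  everywhere: the later coordinates are integrated out.
\<close>

definition cexp :: "int \<Rightarrow> ((int \<Rightarrow> 'b) \<Rightarrow> real) \<Rightarrow> (int \<Rightarrow> 'b) \<Rightarrow> real" where
  "cexp i f x = (\<integral>y. f (patch {..i} x y) \<partial>P)"

lemma measurable_cexp [measurable]:
  assumes [measurable]: "f \<in> borel_measurable P"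
  shows "cexp i f \<in> borel_measurable P"
  unfolding cexp_def[abs_def] by measurable

lemma cexp_local: "{..i} \<subseteq> S \<Longrightarrow> cexp i f (patch S x y) = cexp i f x"
  by (simp add: cexp_def splice_patch_left)

lemma cexp_eq_self: "(\<And>y. f (patch {..i} x y) = f x) \<Longrightarrow> cexp i f x = f x"
  by (simp add: cexp_def P.prob_space)

text \<open>
  The two conditional expectations integrate \<open>f\<close> at sequences that differ in coordinate \<open>i\<close> only,
  where the second one carries an independent value.
\<close>

lemma cexp_increment_le:
  assumes p: "p > 1" and f: "integrable P f"
  shows "(\<integral>\<^sup>+x. ennreal (\<bar>cexp i f x - cexp (i - 1) f x\<bar> powr p) \<partial>P)
     \<le> (\<integral>\<^sup>+x. \<integral>\<^sup>+y. ennreal (\<bar>f x - f (patch (- {i}) x y)\<bar> powr p) \<partial>P \<partial>P)"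
proof -
  have [measurable]: "f \<in> borel_measurable P" using f by auto
  have ae: "AE x in P. integrable P (\<lambda>y. f (patch {..j} x y))" for j
    using PP.AE_integrable_fst'[OF integrable_patch[OF f, of "{..j}"]] by simp
  have "(\<integral>\<^sup>+x. ennreal (\<bar>cexp i f x - cexp (i - 1) f x\<bar> powr p) \<partial>P)
     \<le> (\<integral>\<^sup>+x. \<integral>\<^sup>+y. ennreal (\<bar>f (patch {..i} x y) - f (patch {..i - 1} x y)\<bar> powr p) \<partial>P \<partial>P)"
  proof (intro nn_integral_mono_AE)
    show "AE x in P. ennreal (\<bar>cexp i f x - cexp (i - 1) f x\<bar> powr p)
      \<le> (\<integral>\<^sup>+y. ennreal (\<bar>f (patch {..i} x y) - f (patch {..i - 1} x y)\<bar> powr p) \<partial>P)"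
      using ae[of i] ae[of "i - 1"] AE_space
    proof eventually_elim
      case (elim x)
      then have [measurable]: "x \<in> space P" by simp
      have "cexp i f x - cexp (i - 1) f x = (\<integral>y. f (patch {..i} x y) - f (patch {..i - 1} x y) \<partial>P)"
        unfolding cexp_def using elim by simp
      then show ?case
        using P.abs_expectation_powr_le[OF p, of "\<lambda>y. f (patch {..i} x y) - f (patch {..i - 1} x y)"] elim
        by simp
    qed
  qed
  also have "\<dots> = (\<integral>\<^sup>+z. ennreal (\<bar>f (patch {..i} (fst z) (snd z)) - f (patch {..i - 1} (fst z) (snd z))\<bar> powr p) \<partial>PP)"
    by (subst P.nn_integral_fst[symmetric]) auto
  also have "\<dots> = (\<integral>\<^sup>+z. ennreal (\<bar>f (fst (exchange {..i} z))
       - f (patch (- {i}) (fst (exchange {..i} z)) (snd (exchange {..i} z)))\<bar> powr p) \<partial>PP)"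
  proof -
    \<comment> \<open>The exchanged pair again consists of two independent copies.\<close>
    have "patch {..i - 1} x y = patch (- {i}) (patch {..i} x y) (patch {..i} y x)" for x y :: "int \<Rightarrow> 'b"
      by (auto simp: patch_def fun_eq_iff)
    then show ?thesis by (simp add: exchange_def)
  qed
  also have "\<dots> = (\<integral>\<^sup>+z. ennreal (\<bar>f (fst z) - f (patch (- {i}) (fst z) (snd z))\<bar> powr p) \<partial>distr PP PP (exchange {..i}))"
    by (subst nn_integral_distr) auto
  also have "\<dots> = (\<integral>\<^sup>+x. \<integral>\<^sup>+y. ennreal (\<bar>f x - f (patch (- {i}) x y)\<bar> powr p) \<partial>P \<partial>P)"
    unfolding distr_exchange by (subst P.nn_integral_fst[symmetric]) auto
  finally show ?thesis .
qed

text \<open>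
  A factor that depends on the coordinates up to \<open>i\<close> only can be pulled out of the conditional
  expectation. This makes martingale increments orthogonal to functions of the past.
\<close>

lemma cexp_mult:
  assumes [measurable]: "f \<in> borel_measurable P" "g \<in> borel_measurable P"
    and g: "\<And>x y. g (patch {..i} x y) = g x"
    and gf: "integrable P (\<lambda>x. g x * f x)"
  shows "integrable P (\<lambda>x. g x * cexp i f x)" "(\<integral>x. g x * cexp i f x \<partial>P) = (\<integral>x. g x * f x \<partial>P)"
proof -
  note i = integrable_patch[OF gf, of "{..i}", unfolded g]
  have e: "(\<integral>y. g (fst (x, y)) * f (patch {..i} (fst (x, y)) (snd (x, y))) \<partial>P) = g x * cexp i f x" for x
    by (simp add: cexp_def)
  show "integrable P (\<lambda>x. g x * cexp i f x)"
    using PP.integrable_fst'[OF i] by (simp only: e)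
  have "(\<integral>x. g x * cexp i f x \<partial>P) = (\<integral>z. g (fst z) * f (patch {..i} (fst z) (snd z)) \<partial>PP)"
    using PP.integral_fst'[OF i] by (simp only: e)
  also have "\<dots> = (\<integral>x. g x * f x \<partial>P)"
    using integral_patch[of "\<lambda>x. g x * f x" "{..i}"] by (simp add: g)
  finally show "(\<integral>x. g x * cexp i f x \<partial>P) = (\<integral>x. g x * f x \<partial>P)" .
qed

lemma cexp_remote_le:
  assumes f: "integrable P f" and f0: "(\<integral>x. f x \<partial>P) = 0"
  shows "integrable P (cexp (- int n) f)" "(\<integral>x. \<bar>cexp (- int n) f x\<bar> \<partial>P) \<le> remote_gap f n"
proof -
  let ?s = "patch {..- int n}"
  have [measurable]: "f \<in> borel_measurable P" using f by auto
  note i = integrable_patch[OF f, of "{..- int n}"] integrable_snd_PP[OF f]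
  have i': "integrable PP (\<lambda>z. \<bar>f (?s (fst z) (snd z)) - f (snd z)\<bar>)" using i by auto
  show c: "integrable P (cexp (- int n) f)"
    using PP.integrable_fst'[OF i(1)] by (simp add: cexp_def[abs_def])
  have ae: "AE x in P. integrable P (\<lambda>y. f (?s x y))"
    using PP.AE_integrable_fst'[OF i(1)] by simp
  have "(\<integral>x. \<bar>cexp (- int n) f x\<bar> \<partial>P) \<le> (\<integral>x. (\<integral>y. \<bar>f (?s x y) - f y\<bar> \<partial>P) \<partial>P)"
  proof (rule integral_mono_AE)
    show "integrable P (\<lambda>x. \<bar>cexp (- int n) f x\<bar>)" using c by simp
    show "integrable P (\<lambda>x. \<integral>y. \<bar>f (?s x y) - f y\<bar> \<partial>P)"
      using PP.integrable_fst'[OF i'] by simp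
    show "AE x in P. \<bar>cexp (- int n) f x\<bar> \<le> (\<integral>y. \<bar>f (?s x y) - f y\<bar> \<partial>P)"
      using ae
    proof eventually_elim
      case (elim x)
      then have "cexp (- int n) f x = (\<integral>y. f (?s x y) - f y \<partial>P)"
        using f f0 by (simp add: cexp_def)
      then show ?case by simp
    qed
  qed
  also have "\<dots> = remote_gap f n"
    using PP.integral_fst'[OF i'] by (simp add: remote_gap_def)
  finally show "(\<integral>x. \<bar>cexp (- int n) f x\<bar> \<partial>P) \<le> remote_gap f n" .
qed

text \<open>
  Starting the martingale at time \<open>a\<close> with the value zero avoids any assumption on the far past. The
  positive \<open>b\<close> stands for the (zero) initial norm, because the one-step inequality divides by it.
\<close>

lemma cexp_difference_moment:
  assumes p: "p > 2" and [measurable]: "f \<in> borel_measurable P"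
    and f: "integrable P (\<lambda>x. \<bar>f x\<bar> powr p)"
    and q: "\<And>i. i \<le> n \<Longrightarrow> q i > 0"
    and coupling: "\<And>i. i \<le> n \<Longrightarrow> (\<integral>\<^sup>+x. \<integral>\<^sup>+y. ennreal (\<bar>f x - f (patch (- {i}) x y)\<bar> powr p) \<partial>P \<partial>P)
             \<le> ennreal (q i powr (p/2))"
    and b: "b > 0" and k: "a + int k \<le> n"
  shows "(\<integral>\<^sup>+x. ennreal (\<bar>cexp (a + int k) f x - cexp a f x\<bar> powr p) \<partial>P)
           \<le> ennreal ((b + mart_const p * (\<Sum>i\<in>{a<..a + int k}. q i)) powr (p/2))"
  using k
proof (induction k)
  case 0 show ?case using p by simp
next
  case (Suc k)
  have p1: "p > 1" using p by simp
  let ?i = "a + int (Suc k)"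
  let ?Y = "\<lambda>x. cexp (a + int k) f x - cexp a f x"
  let ?D = "\<lambda>x. cexp ?i f x - cexp (?i - 1) f x"
  let ?B = "b + mart_const p * (\<Sum>i\<in>{a<..a + int k}. q i)"
  let ?g = "\<lambda>x. sgn (?Y x) * \<bar>?Y x\<bar> powr (p - 1)"
  have K: "mart_const p \<ge> 1" using mart_const_ge_1[of p] p by simp
  have B: "?B > 0"
  proof -
    have "0 \<le> (\<Sum>i\<in>{a<..a + int k}. q i)" using q Suc.prems by (intro sum_nonneg less_imp_le) auto
    then have "0 \<le> mart_const p * (\<Sum>i\<in>{a<..a + int k}. q i)" using K by (intro mult_nonneg_nonneg) auto
    then show ?thesis using b by linarith
  qed
  have fint: "integrable P f" by (rule P.integrable_if_integrable_powr[OF p1 _ f]) measurable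
  have Y: "(\<integral>\<^sup>+x. ennreal (\<bar>?Y x\<bar> powr p) \<partial>P) \<le> ennreal (?B powr (p/2))"
    using Suc by simp
  have D: "(\<integral>\<^sup>+x. ennreal (\<bar>?D x\<bar> powr p) \<partial>P) \<le> ennreal (q ?i powr (p/2))"
    using cexp_increment_le[OF p1 fint, of ?i] coupling[of ?i] Suc.prems by (auto intro: order.trans)
  have Yint: "integrable P (\<lambda>x. \<bar>?Y x\<bar> powr p)"
    using Y by (subst (asm) nn_integral_powr_le_iff) auto
  have gf: "integrable P (\<lambda>x. ?g x * f x)"
  proof (rule Bochner_Integration.integrable_bound)
    show "integrable P (\<lambda>x. \<bar>?Y x\<bar> powr p + \<bar>f x\<bar> powr p)" using Yint f by simp
    show "AE x in P. norm (?g x * f x) \<le> norm (\<bar>?Y x\<bar> powr p + \<bar>f x\<bar> powr p)"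
    proof (rule AE_I2)
      fix x
      have "norm (?g x * f x) \<le> \<bar>?Y x\<bar> powr (p - 1) * \<bar>f x\<bar> powr 1"
        by (auto simp: abs_mult abs_sgn_eq)
      also have "\<dots> \<le> \<bar>?Y x\<bar> powr p + \<bar>f x\<bar> powr p" using p by (intro powr_Young) auto
      finally show "norm (?g x * f x) \<le> norm (\<bar>?Y x\<bar> powr p + \<bar>f x\<bar> powr p)" by simp
    qed
  qed measurable
  have orth: "(\<integral>x. ?g x * ?D x \<partial>P) = 0"
  proof -
    have gl: "?g (patch {..j} x y) = ?g x" if "j \<ge> a + int k" for j x y
    proof -
      have "{..a + int k} \<subseteq> {..j}" "{..a} \<subseteq> {..j}" using that by auto
      then show ?thesis by (simp add: cexp_local)
    qed
    have gm: "?g \<in> borel_measurable P" by measurable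
    have "(\<integral>x. ?g x * ?D x \<partial>P) = (\<integral>x. ?g x * cexp ?i f x - ?g x * cexp (?i - 1) f x \<partial>P)"
      by (simp add: right_diff_distrib)
    also have "\<dots> = (\<integral>x. ?g x * cexp ?i f x \<partial>P) - (\<integral>x. ?g x * cexp (?i - 1) f x \<partial>P)"
      by (intro Bochner_Integration.integral_diff cexp_mult(1) gf gl gm) auto
    also have "\<dots> = (\<integral>x. ?g x * f x \<partial>P) - (\<integral>x. ?g x * f x \<partial>P)"
      by (intro arg_cong2[where f = "(-)"] cexp_mult(2) gf gl gm) auto
    finally show ?thesis by simp
  qed
  have "(\<integral>\<^sup>+x. ennreal (\<bar>?Y x + ?D x\<bar> powr p) \<partial>P) \<le> ennreal ((?B + mart_const p * q ?i) powr (p/2))"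
    using q[of ?i] Suc.prems by (intro orthogonal_increment_moment p B Y D orth) measurable
  also have "{a<..?i} = insert ?i {a<..a + int k}" by auto
  then have "?B + mart_const p * q ?i = b + mart_const p * (\<Sum>i\<in>{a<..?i}. q i)"
    by (simp add: algebra_simps)
  finally show ?case by (simp add: add.commute add.left_commute)
qed

text \<open>
  The bound for \<open>f - cexp a f\<close> is uniform in \<open>a\<close>. As \<open>a\<close> tends to \<open>-\<infinity>\<close>, \<open>cexp a f\<close> tends to the mean
  of \<open>f\<close> in \<open>L\<^sup>1\<close>, hence almost surely along a subsequence, and Fatou's lemma gives the claim.
\<close>

theorem causal_moment_bound:
  assumes p: "p > 2" and [measurable]: "f \<in> borel_measurable P"
    and f: "integrable P (\<lambda>x. \<bar>f x\<bar> powr p)" and f0: "(\<integral>x. f x \<partial>P) = 0"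
    and causal: "\<And>x y. f (patch {..n} x y) = f x"
    and q: "\<And>i. i \<le> n \<Longrightarrow> q i > 0"
    and coupling: "\<And>i. i \<le> n \<Longrightarrow> (\<integral>\<^sup>+x. \<integral>\<^sup>+y. ennreal (\<bar>f x - f (patch (- {i}) x y)\<bar> powr p) \<partial>P \<partial>P)
             \<le> ennreal (q i powr (p/2))"
    and V: "V > 0" "\<And>a. a \<le> n \<Longrightarrow> (\<Sum>i\<in>{a<..n}. q i) \<le> V"
  shows "(\<integral>\<^sup>+x. ennreal (\<bar>f x\<bar> powr p) \<partial>P) \<le> ennreal ((2 * mart_const p * V) powr (p/2))"
proof -
  let ?C = "ennreal ((2 * mart_const p * V) powr (p/2))"
  have K: "mart_const p \<ge> 1" using mart_const_ge_1[of p] p by simp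
  have fint: "integrable P f" by (rule P.integrable_if_integrable_powr[OF _ _ f]) (use p in auto)
  have bound: "(\<integral>\<^sup>+x. ennreal (\<bar>f x - cexp a f x\<bar> powr p) \<partial>P) \<le> ?C" for a
  proof (cases "a \<le> n")
    case True
    define k where "k = nat (n - a)"
    have ak: "a + int k = n" using True by (simp add: k_def)
    have cn: "cexp n f = f" using causal by (intro ext cexp_eq_self)
    have "(\<integral>\<^sup>+x. ennreal (\<bar>f x - cexp a f x\<bar> powr p) \<partial>P)
        \<le> ennreal ((mart_const p * V + mart_const p * (\<Sum>i\<in>{a<..n}. q i)) powr (p/2))"
      \<comment> \<open>The free initial value is chosen equal to the bound for the accumulated increments.\<close>
      using cexp_difference_moment[OF p _ f q coupling, of n "mart_const p * V" a k] K V(1)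
      by (simp add: ak cn)
    also have "\<dots> \<le> ?C"
    proof (intro ennreal_leI powr_mono2)
      have "0 \<le> (\<Sum>i\<in>{a<..n}. q i)" using q by (intro sum_nonneg less_imp_le) auto
      then show "0 \<le> mart_const p * V + mart_const p * (\<Sum>i\<in>{a<..n}. q i)" using K V(1) by simp
      have "mart_const p * (\<Sum>i\<in>{a<..n}. q i) \<le> mart_const p * V"
        using K V(2)[OF True] by (intro mult_left_mono) auto
      then show "mart_const p * V + mart_const p * (\<Sum>i\<in>{a<..n}. q i) \<le> 2 * mart_const p * V" by linarith
    qed (use p in auto)
    finally show ?thesis .
  next
    case False
    have "cexp a f x = f x" for x
    proof (rule cexp_eq_self)
      fix y
      have "f (patch {..a} x y) = f (patch {..n} (patch {..a} x y) y)" by (simp add: causal)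
      also have "patch {..n} (patch {..a} x y) y = patch {..n} x y"
        using False by (intro splice_patch_left) auto
      finally show "f (patch {..a} x y) = f x" by (simp add: causal)
    qed
    then show ?thesis using p by simp
  qed
  have "(\<lambda>n. \<integral>x. norm (cexp (- int n) f x) \<partial>P) \<longlonglongrightarrow> 0"
  proof (rule tendsto_sandwich)
    show "(\<lambda>_. 0 :: real) \<longlonglongrightarrow> 0" by simp
    show "remote_gap f \<longlonglongrightarrow> 0" by (rule remote_gap_tendsto_0[OF fint])
  qed (use cexp_remote_le(2)[OF fint f0] in auto)
  \<comment> \<open>\<open>L\<^sup>1\<close> convergence only yields an almost surely convergent subsequence, which is enough for Fatou.\<close>
  from tendsto_L1_AE_subseq[OF cexp_remote_le(1)[OF fint f0] this]
  obtain r where r: "AE x in P. (\<lambda>n. cexp (- int (r n)) f x) \<longlonglongrightarrow> 0" by auto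
  have "(\<integral>\<^sup>+x. ennreal (\<bar>f x\<bar> powr p) \<partial>P)
     = (\<integral>\<^sup>+x. liminf (\<lambda>m. ennreal (\<bar>f x - cexp (- int (r m)) f x\<bar> powr p)) \<partial>P)"
  proof (rule nn_integral_cong_AE)
    show "AE x in P. ennreal (\<bar>f x\<bar> powr p) = liminf (\<lambda>m. ennreal (\<bar>f x - cexp (- int (r m)) f x\<bar> powr p))"
      using r
    proof eventually_elim
      case (elim x)
      have "(\<lambda>m. f x - cexp (- int (r m)) f x) \<longlonglongrightarrow> f x - 0"
        by (intro tendsto_diff tendsto_const elim)
      then have "(\<lambda>m. \<bar>f x - cexp (- int (r m)) f x\<bar> powr p) \<longlonglongrightarrow> \<bar>f x - 0\<bar> powr p"
        by (rule tendsto_powr'[OF tendsto_rabs tendsto_const]) (use p in simp)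
      then have "(\<lambda>m. ennreal (\<bar>f x - cexp (- int (r m)) f x\<bar> powr p)) \<longlonglongrightarrow> ennreal (\<bar>f x\<bar> powr p)"
        by (intro tendsto_ennrealI) simp
      from lim_imp_Liminf[OF _ this] show ?case by simp
    qed
  qed
  also have "\<dots> \<le> liminf (\<lambda>m. \<integral>\<^sup>+x. ennreal (\<bar>f x - cexp (- int (r m)) f x\<bar> powr p) \<partial>P)"
    by (intro nn_integral_liminf) measurable
  also have "\<dots> \<le> limsup (\<lambda>m. \<integral>\<^sup>+x. ennreal (\<bar>f x - cexp (- int (r m)) f x\<bar> powr p) \<partial>P)"
    by (intro Liminf_le_Limsup) simp
  also have "\<dots> \<le> ?C"
    by (intro Limsup_bounded always_eventually allI bound)
  finally show ?thesis .
qed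

lemma sum_shifted_le_suminf:
  fixes \<delta> :: "nat \<Rightarrow> real" and g :: "int \<Rightarrow> int"
  assumes "summable \<delta>" "\<And>k. \<delta> k \<ge> 0" "finite J" "inj_on g J" "\<And>j. j \<in> J \<Longrightarrow> g j \<ge> 0"
  shows "(\<Sum>j\<in>J. \<delta> (nat (g j))) \<le> suminf \<delta>"
proof -
  have "inj_on (\<lambda>j. nat (g j)) J" 
    using assms(4,5) by (intro inj_onI) (metis eq_nat_nat_iff inj_onD)
  then have "(\<Sum>j\<in>J. \<delta> (nat (g j))) = (\<Sum>k\<in>(\<lambda>j. nat (g j)) ` J. \<delta> k)"
    by (simp add: sum.reindex)
  also have "\<dots> \<le> suminf \<delta>" using assms by (intro sum_le_suminf) auto
  finally show ?thesis .
qed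

text \<open>
  Resampling coordinate \<open>i\<close> changes the sum in \<open>L\<^sup>p\<close> by at most \<open>\<Delta> i\<close>, the sum of \<open>\<delta> (j - i)\<close> over
  the indices \<open>j \<ge> i\<close> of the block. Each \<open>\<Delta> i\<close> is at most \<open>suminf \<delta>\<close>, and so is the
  contribution of each \<open>j\<close> to the sum of all \<open>\<Delta> i\<close>. Thus the squares of the \<open>\<Delta> i\<close> add up to at most
  \<open>m * (suminf \<delta>)\<^sup>2\<close>, although infinitely many of them may be nonzero.
\<close>

theorem block_moment_bound:
  fixes H :: "int \<Rightarrow> (int \<Rightarrow> 'b) \<Rightarrow> real"
  assumes p: "p > 2" and H [measurable]: "\<And>j. H j \<in> borel_measurable P"
    and Hp: "\<And>j. integrable P (\<lambda>x. \<bar>H j x\<bar> powr p)" and H0: "\<And>j. (\<integral>x. H j x \<partial>P) = 0"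
    and causal: "\<And>j x y. H j (patch {..j} x y) = H j x"
    and \<delta>: "\<And>k. \<delta> k > 0" "summable \<delta>"
    and coupling: "\<And>j k. (\<integral>\<^sup>+x. \<integral>\<^sup>+y. ennreal (\<bar>H j x - H j (patch (- {j - int k}) x y)\<bar> powr p) \<partial>P \<partial>P)
             \<le> ennreal (\<delta> k powr p)"
  shows "(\<integral>\<^sup>+x. ennreal (\<bar>\<Sum>j\<in>{u<..u + int m}. H j x\<bar> powr p) \<partial>P)
      \<le> ennreal ((2 * mart_const p * (suminf \<delta>)\<^sup>2) powr (p/2) * real m powr (p/2))"
proof (cases "m = 0")
  case True then show ?thesis using p by simp
next
  case False
  define D where "D = suminf \<delta>"
  have D: "D > 0" unfolding D_def using \<delta> by (intro suminf_pos) auto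
  let ?B = "{u<..u + int m}" and ?n = "u + int m"
  let ?f = "\<lambda>x. \<Sum>j\<in>?B. H j x"
  have Hint: "integrable P (H j)" for j
    by (rule P.integrable_if_integrable_powr[OF _ _ Hp[of j]]) (use p in auto)
  have fp: "integrable P (\<lambda>x. \<bar>?f x\<bar> powr p)"
  proof (rule Bochner_Integration.integrable_bound)
    show "integrable P (\<lambda>x. (\<Sum>j\<in>?B. 1) powr (p - 1) * (\<Sum>j\<in>?B. 1 powr (1 - p) * \<bar>H j x\<bar> powr p))"
      using Hp by (intro integrable_mult_right Bochner_Integration.integrable_sum) auto
    show "AE x in P. norm (\<bar>?f x\<bar> powr p) \<le> norm ((\<Sum>j\<in>?B. 1) powr (p - 1) * (\<Sum>j\<in>?B. 1 powr (1 - p) * \<bar>H j x\<bar> powr p))"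
      using sum_powr_weighted_le[of p ?B "\<lambda>_. 1"] p
      by (intro AE_I2) (auto intro!: order.trans[OF _ abs_ge_self])
  qed measurable
  have [simp]: "finite {j. a < j \<and> j \<le> ?n \<and> Q j}" for a and Q :: "int \<Rightarrow> bool"
    by (rule finite_subset[of _ "{a<..?n}"]) auto
  \<comment> \<open>The total effect of coordinate \<open>i\<close> on the block.\<close>
  define \<Delta> where "\<Delta> i = (\<Sum>j\<in>{j\<in>?B. i \<le> j}. \<delta> (nat (j - i)))" for i
  have \<Delta>pos: "\<Delta> i > 0" if "i \<le> ?n" for i
  proof -
    have "finite {j\<in>?B. i \<le> j}" by (rule finite_subset[of _ ?B]) auto
    moreover have "?n \<in> {j\<in>?B. i \<le> j}" using that False by auto
    ultimately show ?thesis unfolding \<Delta>_def using \<delta> by (intro sum_pos) auto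
  qed
  have \<Delta>le: "\<Delta> i \<le> D" for i
    unfolding \<Delta>_def D_def using \<delta>
    by (intro sum_shifted_le_suminf) (auto simp: inj_on_def less_imp_le)
  have "(\<integral>\<^sup>+x. ennreal (\<bar>?f x\<bar> powr p) \<partial>P) \<le> ennreal ((2 * mart_const p * (real m * D\<^sup>2)) powr (p/2))"
  proof (rule causal_moment_bound[where n = ?n and q = "\<lambda>i. (\<Delta> i)\<^sup>2"])
    show "(\<integral>x. ?f x \<partial>P) = 0" using Hint H0 by simp
    show "?f (patch {..?n} x y) = ?f x" for x y
    proof (rule sum.cong[OF refl])
      fix j assume "j \<in> ?B"
      then have "patch {..j} (patch {..?n} x y) x = patch {..j} x x"
        by (intro splice_patch_left) auto
      then show "H j (patch {..?n} x y) = H j x"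
        using causal[of j "patch {..?n} x y" x] by simp
    qed
    show "(\<Delta> i)\<^sup>2 > 0" if "i \<le> ?n" for i using \<Delta>pos[OF that] by simp
    show "(\<integral>\<^sup>+x. \<integral>\<^sup>+y. ennreal (\<bar>?f x - ?f (patch (- {i}) x y)\<bar> powr p) \<partial>P \<partial>P)
        \<le> ennreal ((\<Delta> i)\<^sup>2 powr (p/2))" if i: "i \<le> ?n" for i
    proof -
      let ?J = "{j\<in>?B. i \<le> j}"
      let ?h = "\<lambda>j z. H j (fst z) - H j (patch (- {i}) (fst z) (snd z))"
      have eq: "?f x - ?f (patch (- {i}) x y) = (\<Sum>j\<in>?J. ?h j (x, y))" for x y
      proof -
        have "H j (patch (- {i}) x y) = H j x" if "\<not> i \<le> j" for j
        proof -
          \<comment> \<open>A term before \<open>i\<close> does not see coordinate \<open>i\<close>.\<close>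
          have "patch {..j} (patch (- {i}) x y) x = x"
            using that by (auto simp: patch_def fun_eq_iff)
          then show ?thesis using causal[of j "patch (- {i}) x y" x] by simp
        qed
        then have "(\<Sum>j\<in>?B. ?h j (x, y)) = (\<Sum>j\<in>?J. ?h j (x, y))"
          by (intro sum.mono_neutral_right) auto
        then show ?thesis by (simp add: sum_subtractf)
      qed
      have "(\<integral>\<^sup>+x. \<integral>\<^sup>+y. ennreal (\<bar>?f x - ?f (patch (- {i}) x y)\<bar> powr p) \<partial>P \<partial>P)
          = (\<integral>\<^sup>+z. ennreal (\<bar>\<Sum>j\<in>?J. ?h j z\<bar> powr p) \<partial>PP)"
        unfolding eq by (subst P.nn_integral_fst) (auto simp: split_beta)
      also have "\<dots> \<le> ennreal ((\<Sum>j\<in>?J. \<delta> (nat (j - i))) powr p)"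
      proof (rule nn_integral_sum_powr_le)
        fix j assume j: "j \<in> ?J"
        have "(\<integral>\<^sup>+z. ennreal (\<bar>?h j z\<bar> powr p) \<partial>PP)
            = (\<integral>\<^sup>+x. \<integral>\<^sup>+y. ennreal (\<bar>H j x - H j (patch (- {i}) x y)\<bar> powr p) \<partial>P \<partial>P)"
          by (subst P.nn_integral_fst[symmetric]) auto
        also have "\<dots> \<le> ennreal (\<delta> (nat (j - i)) powr p)"
          using coupling[of j "nat (j - i)"] j by simp
        finally show "(\<integral>\<^sup>+z. ennreal (\<bar>?h j z\<bar> powr p) \<partial>PP) \<le> ennreal (\<delta> (nat (j - i)) powr p)" .
      qed (use p \<delta> in auto)
      also have "(\<Sum>j\<in>?J. \<delta> (nat (j - i))) powr p = (\<Delta> i)\<^sup>2 powr (p/2)"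
        using \<Delta>pos[OF i] by (simp add: \<Delta>_def powr_powr flip: powr_numeral)
      finally show ?thesis .
    qed
    show "real m * D\<^sup>2 > 0" using False D by simp
    show "(\<Sum>i\<in>{a<..?n}. (\<Delta> i)\<^sup>2) \<le> real m * D\<^sup>2" if "a \<le> ?n" for a
    proof -
      have "(\<Sum>i\<in>{a<..?n}. (\<Delta> i)\<^sup>2) \<le> (\<Sum>i\<in>{a<..?n}. D * \<Delta> i)"
        using \<Delta>le \<Delta>pos by (intro sum_mono) (auto simp: power2_eq_square intro!: mult_right_mono less_imp_le)
      also have "\<dots> = D * (\<Sum>i\<in>{a<..?n}. \<Delta> i)" by (simp add: sum_distrib_left)
      also have "(\<Sum>i\<in>{a<..?n}. \<Delta> i) = (\<Sum>j\<in>?B. \<Sum>i\<in>{i\<in>{a<..?n}. i \<le> j}. \<delta> (nat (j - i)))"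
        unfolding \<Delta>_def by (intro sum.swap_restrict) auto
      also have "D * \<dots> \<le> D * (\<Sum>j\<in>?B. D)"
        using D \<delta> unfolding D_def
        by (intro mult_left_mono sum_mono sum_shifted_le_suminf) (auto simp: inj_on_def less_imp_le)
      also have "\<dots> = real m * D\<^sup>2" by (simp add: power2_eq_square)
      finally show ?thesis .
    qed
  qed (use p fp in auto)
  also have "(2 * mart_const p * (real m * D\<^sup>2)) powr (p/2) = (2 * mart_const p * D\<^sup>2) powr (p/2) * real m powr (p/2)"
    using mart_const_ge_1[of p] p by (simp add: powr_mult mult_ac)
  finally show ?thesis by (simp add: D_def)
qed

end

section \<open>Dyadic chaining for short sums\<close>

definition dyadic_sum :: "(int \<Rightarrow> real) \<Rightarrow> nat \<Rightarrow> int \<Rightarrow> real" where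
  "dyadic_sum x j b = (\<Sum>k\<in>{b * 2 ^ j<..b * 2 ^ j + int (2 ^ j)}. x k)"

lemma sum_int_concat:
  fixes x :: "int \<Rightarrow> real"
  assumes "u \<le> v" "v \<le> w"
  shows "(\<Sum>k\<in>{u<..w}. x k) = (\<Sum>k\<in>{u<..v}. x k) + (\<Sum>k\<in>{v<..w}. x k)"
proof -
  have "{u<..w} = {u<..v} \<union> {v<..w}" using assms by auto
  then show ?thesis by (simp add: sum.union_disjoint)
qed

text \<open>
  Rounding \<open>v\<close> down to multiples of \<open>1, 2, 4, \<dots>\<close> in turn moves it at level \<open>j\<close> by nothing or by exactly
  one dyadic block of length \<open>2 ^ j\<close>.
\<close>

lemma dyadic_prefix_bound:
  assumes M: "\<And>j. j < r \<Longrightarrow> \<bar>dyadic_sum x j (v div 2 ^ j - 1)\<bar> \<le> M j" and M0: "\<And>j. M j \<ge> 0"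
  shows "\<bar>\<Sum>k\<in>{(v div 2 ^ r) * 2 ^ r<..v}. x k\<bar> \<le> (\<Sum>j<r. M j)"
  using M
proof (induction r)
  case 0 then show ?case by simp
next
  case (Suc r)
  define b where "b = v div 2 ^ r"
  define c where "c = v div 2 ^ Suc r"
  have c: "c = b div 2" 
    unfolding b_def c_def power_Suc2 by (rule zdiv_zmult2_eq) simp
  have bv: "b * 2 ^ r \<le> v" unfolding b_def
    by (metis mult.commute pos_mod_sign minus_mod_eq_mult_div diff_ge_0_iff_ge minus_div_mult_eq_mod zero_less_numeral zero_less_power)
  have IH: "\<bar>\<Sum>k\<in>{b * 2 ^ r<..v}. x k\<bar> \<le> (\<Sum>j<r. M j)" unfolding b_def by (rule Suc.IH) (use Suc.prems in simp)
  have "b = 2 * c \<or> b = 2 * c + 1" unfolding c by presburger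
  then show ?case
  proof
    assume "b = 2 * c"
    then have e: "c * 2 ^ Suc r = b * 2 ^ r" by simp
    show ?thesis using IH M0[of r] unfolding c_def[symmetric] e by simp
  next
    assume b: "b = 2 * c + 1"
    then have e: "c * 2 ^ Suc r = (b - 1) * 2 ^ r" "b * 2 ^ r = (b - 1) * 2 ^ r + int (2 ^ r)"
      by (simp_all add: algebra_simps)
    have "(\<Sum>k\<in>{c * 2 ^ Suc r<..v}. x k) = dyadic_sum x r (b - 1) + (\<Sum>k\<in>{b * 2 ^ r<..v}. x k)"
      unfolding dyadic_sum_def e(1) e(2)[symmetric]
      by (rule sum_int_concat) (use bv in \<open>simp_all add: algebra_simps\<close>)
    moreover have "\<bar>dyadic_sum x r (b - 1)\<bar> \<le> M r" using Suc.prems[of r] by (simp add: b_def)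
    ultimately show ?thesis using IH unfolding c_def[symmetric] by simp
  qed
qed

text \<open>
  Both ends are rounded down to multiples of \<open>2 ^ r\<close>. As they are at most \<open>2 ^ r\<close> apart, the results
  agree or are neighbours, so one block of the top level suffices in addition to the two prefixes.
\<close>

lemma dyadic_chaining:
  assumes M: "\<And>j b. j \<le> r \<Longrightarrow> b \<in> {lo div 2 ^ j - 1..hi div 2 ^ j} \<Longrightarrow> \<bar>dyadic_sum x j b\<bar> \<le> M j"
    and M0: "\<And>j. M j \<ge> 0"
    and uv: "lo \<le> u" "u \<le> v" "v \<le> hi" "v \<le> u + 2 ^ r"
  shows "\<bar>\<Sum>k\<in>{u<..v}. x k\<bar> \<le> 2 * (\<Sum>j\<le>r. M j)"
proof -
  let ?b = "\<lambda>w. (w div 2 ^ r) * 2 ^ r :: int"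
  have div_in: "w div 2 ^ j \<in> {lo div 2 ^ j..hi div 2 ^ j}" if "lo \<le> w" "w \<le> hi" for w j
    using that by (auto intro: zdiv_mono1)
  have pre: "\<bar>\<Sum>k\<in>{?b w<..w}. x k\<bar> \<le> (\<Sum>j<r. M j)" if w: "lo \<le> w" "w \<le> hi" for w
  proof (intro dyadic_prefix_bound M0 M)
    fix j
    show "w div 2 ^ j - 1 \<in> {lo div 2 ^ j - 1..hi div 2 ^ j}" using div_in[OF w, of j] by simp
  qed simp
  have bw: "?b w \<le> w" "w < ?b w + 2 ^ r" for w
  proof -
    have "w = ?b w + w mod 2 ^ r" by (simp only: div_mult_mod_eq)
    moreover have "0 \<le> w mod 2 ^ r" "w mod 2 ^ r < 2 ^ r" by simp_all
    ultimately show "?b w \<le> w" "w < ?b w + 2 ^ r" by linarith+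
  qed
  have S: "(\<Sum>j\<le>r. M j) = (\<Sum>j<r. M j) + M r" by (simp flip: lessThan_Suc_atMost)
  have "u div 2 ^ r \<le> v div 2 ^ r" using uv by (intro zdiv_mono1) auto
  moreover have "v div 2 ^ r \<le> (u + 2 ^ r) div 2 ^ r" using uv by (intro zdiv_mono1) auto
  ultimately have "v div 2 ^ r = u div 2 ^ r \<or> v div 2 ^ r = u div 2 ^ r + 1" by auto
  then show ?thesis
  proof
    assume *: "v div 2 ^ r = u div 2 ^ r"
    have "(\<Sum>k\<in>{?b u<..v}. x k) = (\<Sum>k\<in>{?b u<..u}. x k) + (\<Sum>k\<in>{u<..v}. x k)"
      by (rule sum_int_concat) (use bw uv in auto)
    then show ?thesis using pre[of u] pre[of v] uv * S M0[of r] by simp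
  next
    assume *: "v div 2 ^ r = u div 2 ^ r + 1"
    then have e: "?b v = ?b u + int (2 ^ r)" by (simp add: algebra_simps)
    have "(\<Sum>k\<in>{?b u<..v}. x k) = (\<Sum>k\<in>{?b u<..u}. x k) + (\<Sum>k\<in>{u<..v}. x k)"
      by (rule sum_int_concat) (use bw uv in auto)
    moreover have "(\<Sum>k\<in>{?b u<..v}. x k) = dyadic_sum x r (u div 2 ^ r) + (\<Sum>k\<in>{?b v<..v}. x k)"
      unfolding dyadic_sum_def e[symmetric]
      by (rule sum_int_concat) (use bw[of v] e in auto)
    moreover have "\<bar>dyadic_sum x r (u div 2 ^ r)\<bar> \<le> M r"
      using div_in[of u r] uv by (intro M) auto
    ultimately show ?thesis using pre[of u] pre[of v] uv S M0[of r] by simp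
  qed
qed

lemma sum_geometric_reversed_le:
  fixes q :: real
  assumes "0 < q" "q < 1"
  shows "(\<Sum>j\<le>r. q ^ (r - j)) \<le> 1 / (1 - q)"
proof -
  have "(\<Sum>j\<le>r. q ^ (r - j)) = (\<Sum>j\<le>r. q ^ j)"
    by (rule sum.reindex_bij_witness[of _ "\<lambda>j. r - j" "\<lambda>j. r - j"]) auto
  also have "\<dots> = (1 - q ^ Suc r) / (1 - q)" using assms by (simp only: sum_gp0) auto
  also have "\<dots> \<le> 1 / (1 - q)" using assms by (intro divide_right_mono) auto
  finally show ?thesis .
qed

lemma (in prob_space) powr_Markov:
  fixes X :: "'a \<Rightarrow> real"
  assumes [measurable]: "X \<in> borel_measurable M" and t: "t > 0" and p: "p > 0" and c: "c \<ge> 0"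
    and X: "(\<integral>\<^sup>+x. ennreal (\<bar>X x\<bar> powr p) \<partial>M) \<le> ennreal c"
  shows "prob {x \<in> space M. t < \<bar>X x\<bar>} \<le> c / t powr p"
proof -
  have X': "integrable M (\<lambda>x. \<bar>X x\<bar> powr p)" "expectation (\<lambda>x. \<bar>X x\<bar> powr p) \<le> c"
    using X c nn_integral_powr_le_iff[of X M c p] by auto
  have "prob {x \<in> space M. t < \<bar>X x\<bar>} \<le> prob {x \<in> space M. t powr p \<le> \<bar>X x\<bar> powr p}"
    using t p by (intro finite_measure_mono) (auto intro: powr_mono2)
  also have "\<dots> \<le> expectation (\<lambda>x. \<bar>X x\<bar> powr p) / t powr p"
    using t X' by (intro integral_Markov_inequality_measure[where A = "{}"]) auto
  also have "\<dots> \<le> c / t powr p" using X' t by (intro divide_right_mono) auto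
  finally show ?thesis .
qed

text \<open>
  The threshold \<open>t\<close> is split over the levels with geometric weights \<open>q ^ (r - j)\<close>. At level \<open>j\<close> there
  are of the order of \<open>(hi - lo) / 2 ^ j\<close> blocks, whose sums have \<open>p\<close>-th moment of order \<open>2 ^ (j * p / 2)\<close>. As
  \<open>p > 2\<close>, the product grows with \<open>j\<close>, and for weights that decay slowly enough the top level
  dominates the union bound. The exceptional event does not depend on the window, and speaking of
  an event \<open>E\<close> avoids any question about the measurability of the supremum.
\<close>

theorem (in prob_space) short_sums_tail:
  fixes X :: "int \<Rightarrow> 'a \<Rightarrow> real"
  assumes p: "p > 2" and [measurable]: "\<And>j. X j \<in> borel_measurable M" and K: "K \<ge> 0"
    and mom: "\<And>u m. (\<integral>\<^sup>+\<omega>. ennreal (\<bar>\<Sum>j\<in>{u<..u + int m}. X j \<omega>\<bar> powr p) \<partial>M) \<le> ennreal (K * real m powr (p/2))"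
  shows "\<exists>C\<ge>0. \<forall>lo hi r t. 2 ^ r \<le> hi - lo \<longrightarrow> t > 0 \<longrightarrow>
     (\<exists>E\<in>events. prob E \<le> C * real_of_int (hi - lo) * (2 ^ r) powr (p/2 - 1) / t powr p \<and>
        (\<forall>\<omega>\<in>space M - E. \<forall>u v. lo \<le> u \<longrightarrow> u \<le> v \<longrightarrow> v \<le> hi \<longrightarrow> v \<le> u + 2 ^ r \<longrightarrow>
            \<bar>\<Sum>k\<in>{u<..v}. X k \<omega>\<bar> \<le> t))"
proof -
  \<comment> \<open>The weights use up half of the exponent \<open>p/2 - 1\<close> of the decay towards lower levels; the
    other half remains as the ratio \<open>q'\<close> of a geometric series.\<close>
  define \<beta> where "\<beta> = (p/2 - 1) / (2 * p)"
  have \<beta>: "\<beta> > 0" "\<beta> * p = (p/2 - 1) / 2" using p by (auto simp: \<beta>_def)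
  define q where "q = (2::real) powr (- \<beta>)"
  have q: "0 < q" "q < 1" using \<beta> by (auto simp: q_def powr_less_one)
  define q' where "q' = (2::real) powr (- (\<beta> * p))"
  have "\<beta> * p > 0" using \<beta>(1) p by simp
  then have q': "0 < q'" "q' < 1" by (auto simp: q'_def powr_less_one)
  define C where "C = 4 * K * (2 / (1 - q)) powr p / (1 - q')"
  have C: "C \<ge> 0" unfolding C_def using K q q' by (intro divide_nonneg_nonneg mult_nonneg_nonneg) auto
  show ?thesis
  proof (intro exI[of _ C] conjI C allI impI)
    fix lo hi :: int and r :: nat and t :: real
    assume len: "2 ^ r \<le> hi - lo" and t: "t > 0"
    define N where "N = real_of_int (hi - lo)"
    have N: "2 ^ r \<le> N" unfolding N_def using len by (metis of_int_le_iff of_int_numeral of_int_power)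
    define T where "T j = t * (1 - q) / 2 * q ^ (r - j)" for j
    have T: "T j > 0" for j using t q by (simp add: T_def)
    define B where "B j = {lo div 2 ^ j - 1..hi div 2 ^ j}" for j :: nat
    define F where "F j b = {\<omega> \<in> space M. T j < \<bar>dyadic_sum (\<lambda>k. X k \<omega>) j b\<bar>}" for j b
    have F [measurable]: "F j b \<in> events" for j b
      unfolding F_def dyadic_sum_def by measurable
    define E where "E = (\<Union>j\<le>r. \<Union>b\<in>B j. F j b)"
    have finB: "finite (B j)" for j by (simp add: B_def)
    have probF: "prob (F j b) \<le> K * (2 ^ j) powr (p/2) / T j powr p" for j b
      unfolding F_def
    proof (rule powr_Markov)
      show "(\<integral>\<^sup>+\<omega>. ennreal (\<bar>dyadic_sum (\<lambda>k. X k \<omega>) j b\<bar> powr p) \<partial>M) \<le> ennreal (K * (2 ^ j) powr (p/2))"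
        using mom[of "b * 2 ^ j" "2 ^ j"] by (simp add: dyadic_sum_def)
    qed (use p K T in \<open>auto simp: dyadic_sum_def\<close>)
    have cardB: "real (card (B j)) \<le> 4 * N / 2 ^ j" if j: "j \<le> r" for j
    proof -
      have "real_of_int (hi div 2 ^ j) \<le> hi / 2 ^ j" using real_of_int_div4[of hi "2 ^ j"] by simp
      moreover have "real_of_int (lo div 2 ^ j) \<ge> lo / 2 ^ j - 1"
        using real_of_int_div3[of lo "2 ^ j"] by simp
      moreover have "N / 2 ^ j = hi / 2 ^ j - lo / 2 ^ j" by (simp add: N_def diff_divide_distrib)
      moreover have "1 \<le> N / 2 ^ j"
      proof -
        have "(2::real) ^ j \<le> 2 ^ r" using j by simp
        then have "2 ^ j \<le> N" using N by linarith
        then show ?thesis by (simp add: field_simps)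
      qed
      moreover have "lo div 2 ^ j \<le> hi div 2 ^ j" using len by (intro zdiv_mono1) (auto intro: order.trans[of _ "lo + 2 ^ r"])
      ultimately show ?thesis unfolding B_def by simp
    qed
    show "\<exists>E\<in>events. prob E \<le> C * real_of_int (hi - lo) * (2 ^ r) powr (p/2 - 1) / t powr p \<and>
        (\<forall>\<omega>\<in>space M - E. \<forall>u v. lo \<le> u \<longrightarrow> u \<le> v \<longrightarrow> v \<le> hi \<longrightarrow> v \<le> u + 2 ^ r \<longrightarrow>
            \<bar>\<Sum>k\<in>{u<..v}. X k \<omega>\<bar> \<le> t)"
    proof (intro bexI[of _ E] conjI ballI allI impI)
      show "E \<in> events" unfolding E_def using finB by measurable
      have "prob E \<le> (\<Sum>j\<le>r. prob (\<Union>b\<in>B j. F j b))"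
        unfolding E_def using finB by (intro finite_measure_subadditive_finite) auto
      also have "\<dots> \<le> (\<Sum>j\<le>r. \<Sum>b\<in>B j. prob (F j b))"
        using finB by (intro sum_mono finite_measure_subadditive_finite) auto
      also have "\<dots> \<le> (\<Sum>j\<le>r. \<Sum>b\<in>B j. K * (2 ^ j) powr (p/2) / T j powr p)"
        by (intro sum_mono probF)
      also have "\<dots> = (\<Sum>j\<le>r. real (card (B j)) * (K * (2 ^ j) powr (p/2) / T j powr p))" by simp
      also have "\<dots> \<le> (\<Sum>j\<le>r. 4 * N / 2 ^ j * (K * (2 ^ j) powr (p/2) / T j powr p))"
        using K T cardB by (intro sum_mono mult_right_mono) auto
      also have "\<dots> = (\<Sum>j\<le>r. 4 * K * (2 / (1 - q)) powr p * N * (2 ^ r) powr (p/2 - 1) / t powr p * q' ^ (r - j))"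
      proof (intro sum.cong refl)
        fix j assume "j \<in> {..r}"
        then have jr: "real (r - j) = real r - real j" by (simp add: of_nat_diff)
        have q1: "(q ^ (r - j)) powr p = 2 powr (- (\<beta> * p * (real r - real j)))"
          using jr by (simp add: q_def powr_powr mult_ac flip: powr_realpow)
        have q2: "q' ^ (r - j) = 2 powr (- (\<beta> * p * (real r - real j)))"
          using jr by (simp add: q'_def powr_powr mult_ac flip: powr_realpow)
        have T1: "T j powr p = t powr p * (2 / (1 - q)) powr (- p) * 2 powr (- (\<beta> * p * (real r - real j)))"
        proof -
          have "T j = (t * ((1 - q) / 2)) * q ^ (r - j)" by (simp add: T_def)
          also have "\<dots> powr p = t powr p * ((1 - q) / 2) powr p * (q ^ (r - j)) powr p"
            using t q by (subst powr_mult, simp_all del: times_divide_eq_right)+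
          also have "((1 - q) / 2) powr p = (2 / (1 - q)) powr (- p)"
            using q by (simp add: powr_minus powr_divide)
          finally show ?thesis by (simp only: q1)
        qed
        have two: "(2 ^ m :: real) powr s = 2 powr (real m * s)" for m s
          by (simp add: powr_powr flip: powr_realpow)
        have *: "1 / 2 ^ j * ((2::real) ^ j) powr (p/2) / 2 powr (- (\<beta> * p * (real r - real j)))
           = (2 ^ r) powr (p/2 - 1) * 2 powr (- (\<beta> * p * (real r - real j)))"
        proof -
          have "1 / 2 ^ j * ((2::real) ^ j) powr (p/2) / 2 powr (- (\<beta> * p * (real r - real j)))
             = 2 powr (- real j + real j * (p/2) + \<beta> * p * (real r - real j))"
          proof -
            have "1 / (2::real) ^ j = 2 powr (- real j)"
              by (simp add: powr_minus powr_realpow divide_inverse)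
            moreover have "x / 2 powr (- y) = x * 2 powr y" for x y :: real
              by (simp add: powr_minus divide_inverse)
            ultimately show ?thesis by (simp only: two powr_add)
          qed
          also have "- real j + real j * (p/2) + \<beta> * p * (real r - real j)
            = real r * (p/2 - 1) + - (\<beta> * p * (real r - real j))"
            unfolding \<beta>(2) by (simp add: field_simps)
          also have "2 powr (real r * (p/2 - 1) + - (\<beta> * p * (real r - real j)))
             = (2 ^ r) powr (p/2 - 1) * 2 powr (- (\<beta> * p * (real r - real j)))"
            unfolding powr_add by (simp add: two)
          finally show ?thesis .
        qed
        have "4 * N / 2 ^ j * (K * (2 ^ j) powr (p/2) / T j powr p)
          = 4 * K * (2 / (1 - q)) powr p * N / t powr p
             * (1 / 2 ^ j * (2 ^ j) powr (p/2) / 2 powr (- (\<beta> * p * (real r - real j))))"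
          unfolding T1 by (simp add: powr_minus field_simps)
        also have "\<dots> = 4 * K * (2 / (1 - q)) powr p * N * (2 ^ r) powr (p/2 - 1) / t powr p * q' ^ (r - j)"
          unfolding * q2 by simp
        finally show "4 * N / 2 ^ j * (K * (2 ^ j) powr (p/2) / T j powr p)
          = 4 * K * (2 / (1 - q)) powr p * N * (2 ^ r) powr (p/2 - 1) / t powr p * q' ^ (r - j)" .
      qed
      also have "\<dots> = 4 * K * (2 / (1 - q)) powr p * N * (2 ^ r) powr (p/2 - 1) / t powr p * (\<Sum>j\<le>r. q' ^ (r - j))"
        by (rule sum_distrib_left[symmetric])
      also have "\<dots> \<le> 4 * K * (2 / (1 - q)) powr p * N * (2 ^ r) powr (p/2 - 1) / t powr p * (1 / (1 - q'))"
      proof (intro mult_left_mono sum_geometric_reversed_le q')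
        have "N \<ge> 0" using N by (rule order.trans[rotated]) simp
        then show "0 \<le> 4 * K * (2 / (1 - q)) powr p * N * (2 ^ r) powr (p/2 - 1) / t powr p"
          using K by simp
      qed
      also have "\<dots> = C * N * (2 ^ r) powr (p/2 - 1) / t powr p" by (simp add: C_def)
      finally show "prob E \<le> C * real_of_int (hi - lo) * (2 ^ r) powr (p/2 - 1) / t powr p"
        by (simp add: N_def)
    next
      fix \<omega> u v assume \<omega>: "\<omega> \<in> space M - E" and uv: "lo \<le> u" "u \<le> v" "v \<le> hi" "v \<le> u + 2 ^ r"
      have "\<bar>\<Sum>k\<in>{u<..v}. X k \<omega>\<bar> \<le> 2 * (\<Sum>j\<le>r. T j)"
      proof (rule dyadic_chaining[OF _ _ uv])
        fix j b assume "j \<le> r" "b \<in> {lo div 2 ^ j - 1..hi div 2 ^ j}"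
        then show "\<bar>dyadic_sum (\<lambda>k. X k \<omega>) j b\<bar> \<le> T j"
          using \<omega> by (force simp: E_def F_def B_def)
      qed (use T in \<open>auto intro: less_imp_le\<close>)
      also have "2 * (\<Sum>j\<le>r. T j) = t * ((1 - q) * (\<Sum>j\<le>r. q ^ (r - j)))"
        unfolding T_def sum_distrib_left[symmetric] by simp
      also have "\<dots> \<le> t * ((1 - q) * (1 / (1 - q)))"
        using t q by (intro mult_left_mono sum_geometric_reversed_le) auto
      also have "\<dots> = t" using q by simp
      finally show "\<bar>\<Sum>k\<in>{u<..v}. X k \<omega>\<bar> \<le> t" .
    qed
  qed
qed

section \<open>Total variation of absolutely continuous functions\<close>

text \<open>
  The total variation of \<open>f\<close> on \<open>[a, b]\<close> is at most \<open>V\<close>. The partition points form a monotone sequence,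
  which may be constant; this makes clamping to a subinterval harmless.
\<close>

definition variation_le :: "(real \<Rightarrow> 'a::real_normed_vector) \<Rightarrow> real \<Rightarrow> real \<Rightarrow> real \<Rightarrow> bool" where
  "variation_le f a b V \<longleftrightarrow>
    (\<forall>t m. mono t \<longrightarrow> range t \<subseteq> {a..b} \<longrightarrow> (\<Sum>k<m::nat. norm (f (t (Suc k)) - f (t k))) \<le> V)"

text \<open>
  Clamping a partition at \<open>c\<close> from both sides splits each increment exactly, since
  \<open>f (min t c) + f (max t c) = f t + f c\<close>.
\<close>

lemma variation_le_join:
  assumes 1: "variation_le f a c V" and 2: "variation_le f c b W" and "a \<le> c" "c \<le> b"
  shows "variation_le f a b (V + W)"
  unfolding variation_le_def
proof (intro allI impI)
  fix t :: "nat \<Rightarrow> real" and m assume t: "mono t" "range t \<subseteq> {a..b}"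
  let ?l = "\<lambda>k. min (t k) c" and ?r = "\<lambda>k. max (t k) c"
  have "mono ?l" "mono ?r" using t(1) by (auto simp: mono_def min.coboundedI1 max.coboundedI1)
  moreover have "range ?l \<subseteq> {a..c}" "range ?r \<subseteq> {c..b}" using t(2) assms by auto
  ultimately have *: "(\<Sum>k<m. norm (f (?l (Suc k)) - f (?l k))) \<le> V" "(\<Sum>k<m. norm (f (?r (Suc k)) - f (?r k))) \<le> W"
    using 1 2 unfolding variation_le_def by blast+
  have split: "f (t k) = f (?l k) + f (?r k) - f c" for k by (simp add: min_def max_def)
  have "(\<Sum>k<m. norm (f (t (Suc k)) - f (t k)))
      \<le> (\<Sum>k<m. norm (f (?l (Suc k)) - f (?l k)) + norm (f (?r (Suc k)) - f (?r k)))"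
  proof (rule sum_mono)
    fix k
    have "f (t (Suc k)) - f (t k) = (f (?l (Suc k)) - f (?l k)) + (f (?r (Suc k)) - f (?r k))"
      unfolding split[of "Suc k"] split[of k] by (simp add: algebra_simps)
    then show "norm (f (t (Suc k)) - f (t k))
        \<le> norm (f (?l (Suc k)) - f (?l k)) + norm (f (?r (Suc k)) - f (?r k))"
      by (metis norm_triangle_ineq)
  qed
  then show "(\<Sum>k<m. norm (f (t (Suc k)) - f (t k))) \<le> V + W"
    using * by (simp add: sum.distrib)
qed

text \<open>
  The nondegenerate intervals of a partition are the members of a division, and on an interval
  shorter than \<open>\<delta>\<close> their total length is smaller than \<open>\<delta>\<close>.
\<close>

lemma abs_continuous_on_short_variation:
  assumes \<delta>: "\<And>D. D division_of \<Union>D \<Longrightarrow> \<Union>D \<subseteq> S \<Longrightarrow> (\<Sum>K\<in>D. Sup K - Inf K) < \<delta>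
        \<Longrightarrow> (\<Sum>K\<in>D. norm (f (Sup K) - f (Inf K))) < \<epsilon>"
    and S: "{c..d} \<subseteq> S" "d - c < \<delta>"
  shows "variation_le f c d \<epsilon>"
  unfolding variation_le_def
proof (intro allI impI)
  fix t :: "nat \<Rightarrow> real" and m assume t: "mono t" "range t \<subseteq> {c..d}"
  define J where "J = {k. k < m \<and> t k < t (Suc k)}"
  have J: "finite J" "J \<subseteq> {..<m}" by (auto simp: J_def)
  let ?I = "\<lambda>k. {t k..t (Suc k)}"
  have ord: "t k < t (Suc k)" "t (Suc k) \<le> t k'" if "k \<in> J" "k < k'" for k k'
    using that t(1) by (auto simp: J_def mono_def)
  have inj: "inj_on ?I J"
  proof (rule inj_onI, rule ccontr)
    fix k k' assume *: "k \<in> J" "k' \<in> J" "?I k = ?I k'" "k \<noteq> k'"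
    then have "t k = t k'" by (auto simp: J_def Icc_eq_Icc)
    then show False using ord[of k k'] ord[of k' k] * by (cases k k' rule: linorder_cases) auto
  qed
  have div: "?I ` J division_of \<Union>(?I ` J)"
    unfolding division_of_def
  proof (intro conjI ballI impI)
    fix K1 K2 assume "K1 \<in> ?I ` J" "K2 \<in> ?I ` J" "K1 \<noteq> K2"
    then obtain k k' where k: "k \<in> J" "k' \<in> J" "K1 = ?I k" "K2 = ?I k'" "k \<noteq> k'" by auto
    then show "interior K1 \<inter> interior K2 = {}"
      using ord[of k k'] ord[of k' k] by (cases k k' rule: linorder_cases) auto
  next
    fix K assume "K \<in> ?I ` J"
    then obtain k where k: "k \<in> J" "K = ?I k" by auto
    then show "K \<subseteq> \<Union>(?I ` J)" "K \<noteq> {}" by (auto simp: J_def)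
    show "\<exists>a b. K = cbox a b" using k by (auto simp: cbox_interval)
  qed (use J in auto)
  have SI: "Sup (?I k) = t (Suc k)" "Inf (?I k) = t k" if "k \<in> J" for k
    using that by (auto simp: J_def)
  have "(\<Sum>K\<in>?I ` J. Sup K - Inf K) = (\<Sum>k\<in>J. t (Suc k) - t k)"
    by (subst sum.reindex[OF inj]) (auto simp: SI)
  also have "\<dots> \<le> (\<Sum>k<m. t (Suc k) - t k)"
    using J t(1) by (intro sum_mono2) (auto simp: mono_def)
  also have "\<dots> = t m - t 0" by (rule sum_lessThan_telescope)
  also have "\<dots> \<le> d - c" using t(2) by (meson atLeastAtMost_iff diff_mono rangeI subsetD)
  finally have len: "(\<Sum>K\<in>?I ` J. Sup K - Inf K) < \<delta>" using S by simp
  have sub: "\<Union>(?I ` J) \<subseteq> S"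
  proof
    fix x assume "x \<in> \<Union>(?I ` J)"
    then obtain k where "t k \<le> x" "x \<le> t (Suc k)" by auto
    moreover have "c \<le> t k" "t (Suc k) \<le> d" using t(2) by (simp_all add: image_subset_iff)
    ultimately show "x \<in> S" using S by auto
  qed
  have "(\<Sum>k<m. norm (f (t (Suc k)) - f (t k))) = (\<Sum>k\<in>J. norm (f (t (Suc k)) - f (t k)))"
  proof (rule sum.mono_neutral_right)
    show "\<forall>k\<in>{..<m} - J. norm (f (t (Suc k)) - f (t k)) = 0"
    proof
      fix k assume "k \<in> {..<m} - J"
      then have "\<not> t k < t (Suc k)" by (auto simp: J_def)
      moreover have "t k \<le> t (Suc k)" using t(1) by (simp add: mono_def)
      ultimately have "t (Suc k) = t k" by simp
      then show "norm (f (t (Suc k)) - f (t k)) = 0" by simp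
    qed
  qed (use J in auto)
  also have "\<dots> = (\<Sum>K\<in>?I ` J. norm (f (Sup K) - f (Inf K)))"
    by (subst sum.reindex[OF inj]) (auto simp: SI)
  also have "\<dots> < \<epsilon>" by (rule \<delta>[OF div sub len])
  finally show "(\<Sum>k<m. norm (f (t (Suc k)) - f (t k))) \<le> \<epsilon>" by simp
qed

lemma abs_continuous_on_variation:
  assumes f: "abs_continuous_on {a..b} f" and ab: "a \<le> b"
  shows "\<exists>V. variation_le f a b V"
proof -
  have "\<exists>\<delta>>0. \<forall>D. D division_of \<Union>D \<and> \<Union>D \<subseteq> {a..b} \<and> (\<Sum>K\<in>D. Sup K - Inf K) < \<delta>
        \<longrightarrow> (\<Sum>K\<in>D. norm (f (Sup K) - f (Inf K))) < 1"
    using f[unfolded abs_continuous_on_def, THEN spec, of 1] by simp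
  then obtain \<delta> where \<delta>: "\<delta> > 0" "\<And>D. D division_of \<Union>D \<Longrightarrow> \<Union>D \<subseteq> {a..b} \<Longrightarrow> (\<Sum>K\<in>D. Sup K - Inf K) < \<delta>
        \<Longrightarrow> (\<Sum>K\<in>D. norm (f (Sup K) - f (Inf K))) < 1"
    by blast
  define h where "h = \<delta> / 2"
  have h: "h > 0" "h < \<delta>" using \<delta> by (auto simp: h_def)
  define e where "e N = min b (a + real N * h)" for N
  have "\<exists>V. variation_le f a (e N) V" for N
  proof (induction N)
    case 0
    have "variation_le f a a 1" by (rule abs_continuous_on_short_variation[OF \<delta>(2)]) (use ab \<delta> in auto)
    then show ?case using ab by (auto simp: e_def)
  next
    case (Suc N)
    then obtain V where V: "variation_le f a (e N) V" by auto
    have e: "a \<le> e N" "e N \<le> e (Suc N)" "e (Suc N) \<le> b" "e (Suc N) - e N \<le> h"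
      using ab h(1) by (auto simp: e_def algebra_simps min_def)
    have "variation_le f (e N) (e (Suc N)) 1"
      by (rule abs_continuous_on_short_variation[OF \<delta>(2)]) (use e h in auto)
    from variation_le_join[OF V this] e show ?case by blast
  qed
  moreover obtain N where "(b - a) / h < real N" using reals_Archimedean2 by blast
  then have "e N = b" using h by (simp add: e_def field_simps)
  ultimately show ?thesis by metis
qed

lemma abs_continuous_on_bound_and_variation:
  assumes f: "abs_continuous_on {a..b} f" and ab: "a \<le> b"
  obtains V where "V > 0" "\<And>x t m. x \<in> {a..b} \<Longrightarrow> mono t \<Longrightarrow> range t \<subseteq> {a..b} \<Longrightarrow>
     norm (f x) + (\<Sum>k<m::nat. norm (f (t (Suc k)) - f (t k))) \<le> V"
proof -
  obtain V where V: "variation_le f a b V" using abs_continuous_on_variation[OF f ab] by auto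
  have x: "norm (f x) \<le> norm (f a) + V" if "x \<in> {a..b}" for x
  proof -
    let ?t = "\<lambda>k::nat. if k = 0 then a else x"
    have "mono ?t" "range ?t \<subseteq> {a..b}" using that ab by (auto simp: mono_def)
    then have "(\<Sum>k<1. norm (f (?t (Suc k)) - f (?t k))) \<le> V" using V unfolding variation_le_def by blast
    then have "norm (f x - f a) \<le> V" by simp
    then show ?thesis using norm_triangle_sub[of "f x" "f a"] by linarith
  qed
  have "0 \<le> norm (f a) + V + V"
    using V[unfolded variation_le_def, rule_format, of "\<lambda>_. a" 0] ab by (auto simp: mono_def)
  then show thesis
  proof (intro that[of "norm (f a) + V + V + 1"])
    fix y and t :: "nat \<Rightarrow> real" and m assume "y \<in> {a..b}" "mono t" "range t \<subseteq> {a..b}"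
    moreover from this have "(\<Sum>k<m. norm (f (t (Suc k)) - f (t k))) \<le> V"
      using V unfolding variation_le_def by blast
    ultimately show "norm (f y) + (\<Sum>k<m. norm (f (t (Suc k)) - f (t k))) \<le> norm (f a) + V + V + 1"
      using x[of y] by linarith
  qed simp
qed

section \<open>Tails of the discretized wavelet transform\<close>

lemma Abel_summation_bound:
  fixes a :: "nat \<Rightarrow> real" and c :: "nat \<Rightarrow> complex"
  assumes A: "\<And>k. k \<le> m \<Longrightarrow> \<bar>\<Sum>i\<le>k. a i\<bar> \<le> T"
  shows "norm (\<Sum>k\<le>m. of_real (a k) * c k) \<le> T * (norm (c m) + (\<Sum>k<m. norm (c (Suc k) - c k)))"
proof -
  let ?A = "\<lambda>k. of_real (\<Sum>i\<le>k. a i) :: complex"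
  have "(\<Sum>k\<le>n. of_real (a k) * c k) = ?A n * c n - (\<Sum>k<n. ?A k * (c (Suc k) - c k))" for n
    by (induction n) (simp_all add: algebra_simps)
  then have "norm (\<Sum>k\<le>m. of_real (a k) * c k) \<le> norm (?A m * c m) + norm (\<Sum>k<m. ?A k * (c (Suc k) - c k))"
    by (simp add: norm_triangle_ineq4)
  also have "\<dots> \<le> T * norm (c m) + (\<Sum>k<m. T * norm (c (Suc k) - c k))"
  proof (intro add_mono order.trans[OF norm_sum] sum_mono)
    show "norm (?A m * c m) \<le> T * norm (c m)"
      unfolding norm_mult norm_of_real by (intro mult_right_mono A) auto
    show "norm (?A k * (c (Suc k) - c k)) \<le> T * norm (c (Suc k) - c k)" if "k \<in> {..<m}" for k
      unfolding norm_mult norm_of_real using that by (intro mult_right_mono A) auto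
  qed
  finally show ?thesis by (simp add: distrib_left sum_distrib_left)
qed

text \<open>
  After multiplication with \<open>sqrt s\<close> the normalizing factors combine to \<open>1 / sqrt n\<close>. The remaining
  weights are values of \<open>\<psi>\<close> on an increasing grid inside \<open>[-R, R]\<close>, so Abel summation costs the
  supremum and the variation of \<open>\<psi>\<close> there. The summand \<open>1 / s\<close> in the bound for \<open>R\<close> pays for the rounding
  up of the window.
\<close>

lemma disc_wt_bound:
  fixes \<psi> :: "real \<Rightarrow> complex" and x :: "int \<Rightarrow> real"
  assumes n: "n \<ge> 1" and s: "s > 0" and A: "A > 0" and R: "A + 1 / s \<le> R"
    and V: "\<And>y t m. y \<in> {-R..R} \<Longrightarrow> mono t \<Longrightarrow> range t \<subseteq> {-R..R} \<Longrightarrow>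
     norm (\<psi> y) + (\<Sum>k<m::nat. norm (\<psi> (t (Suc k)) - \<psi> (t k))) \<le> V"
    and J: "J = \<lceil>sqrt n * A * s\<rceil>" and T: "T \<ge> 0"
    and sums: "\<And>u v. int i - J - 1 \<le> u \<Longrightarrow> u \<le> v \<Longrightarrow> v \<le> int i + J \<Longrightarrow> \<bar>\<Sum>k\<in>{u<..v}. x k\<bar> \<le> T"
  shows "norm (of_real (sqrt s) * disc_wt \<psi> A n x i s) \<le> T * V / sqrt n"
proof -
  have n0: "sqrt n \<ge> 1" using n by simp
  have pos: "sqrt n * A * s > 0" using n0 A s by simp
  have J1: "J \<ge> 0" using pos unfolding J by simp
  define N where "N = nat J"
  have N: "J = int N" using J1 by (simp add: N_def)
  have JR: "real_of_int J \<le> sqrt n * s * R"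
  proof -
    have "real_of_int J \<le> sqrt n * A * s + 1" unfolding J by linarith
    also have "\<dots> \<le> sqrt n * A * s + sqrt n" using n0 by simp
    also have "\<dots> = sqrt n * s * (A + 1 / s)" using s by (simp add: field_simps)
    also have "\<dots> \<le> sqrt n * s * R" using R n0 s by (intro mult_left_mono) auto
    finally show ?thesis .
  qed
  \<comment> \<open>The grid of the window, continued constantly beyond its last point.\<close>
  define t where "t k = real_of_int (int (min k (2 * N)) - J) / (sqrt n * s)" for k
  define c where "c k = cnj (\<psi> (t k))" for k
  have ts: "mono t"
  proof (rule monoI)
    fix j k :: nat assume "j \<le> k"
    then have "int (min j (2 * N)) - J \<le> int (min k (2 * N)) - J" by (simp add: min_le_iff_disj)
    then have "real_of_int (int (min j (2 * N)) - J) \<le> real_of_int (int (min k (2 * N)) - J)"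
      by (simp only: of_int_le_iff)
    then show "t j \<le> t k" unfolding t_def using n0 s by (intro divide_right_mono) auto
  qed
  have tR: "t k \<in> {-R..R}" for k
  proof -
    have "- J \<le> int (min k (2 * N)) - J" "int (min k (2 * N)) - J \<le> J" by (auto simp: N)
    then have "- real_of_int J \<le> real_of_int (int (min k (2 * N)) - J)"
      "real_of_int (int (min k (2 * N)) - J) \<le> real_of_int J"
      by (simp_all only: of_int_le_iff flip: of_int_minus)
    then have "- (sqrt n * s * R) \<le> real_of_int (int (min k (2 * N)) - J)"
      "real_of_int (int (min k (2 * N)) - J) \<le> sqrt n * s * R" using JR by linarith+
    moreover have "sqrt n * s > 0" using n0 s by simp
    ultimately show ?thesis unfolding t_def by (simp add: pos_le_divide_eq pos_divide_le_eq mult_ac)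
  qed
  have "(\<Sum>j\<in>wt_window A n s. of_real (x (int i + j)) * cnj (wt_coeff \<psi> n s j))
      = of_real (1 / (real n powr (1/4) * s powr (1/2)))
         * (\<Sum>j\<in>wt_window A n s. of_real (x (int i + j)) * cnj (\<psi> (real_of_int j / (sqrt n * s))))"
    by (simp add: wt_coeff_def sum_distrib_left mult_ac)
  also have "(\<Sum>j\<in>wt_window A n s. of_real (x (int i + j)) * cnj (\<psi> (real_of_int j / (sqrt n * s))))
      = (\<Sum>k\<le>2 * N. of_real (x (int i + (int k - J))) * c k)"
  proof (rule sum.reindex_bij_witness[of _ "\<lambda>k. int k - J" "\<lambda>j. nat (j + J)"])
    fix j assume "j \<in> wt_window A n s"
    then have j: "- J \<le> j" "j \<le> J" by (auto simp: wt_window_def J mult_ac)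
    then show "int (nat (j + J)) - J = j" "nat (j + J) \<in> {..2 * N}" by (auto simp: N)
    then have "min (nat (j + J)) (2 * N) = nat (j + J)" by simp
    then show "of_real (x (int i + (int (nat (j + J)) - J))) * c (nat (j + J))
        = of_real (x (int i + j)) * cnj (\<psi> (real_of_int j / (sqrt n * s)))"
      using j by (simp add: c_def t_def)
  next
    fix k assume "k \<in> {..2 * N}"
    then show "nat (int k - J + J) = k" "int k - J \<in> wt_window A n s"
      by (auto simp: wt_window_def N simp flip: J)
  qed
  finally have sum_eq: "(\<Sum>j\<in>wt_window A n s. of_real (x (int i + j)) * cnj (wt_coeff \<psi> n s j))
      = of_real (1 / (real n powr (1/4) * s powr (1/2))) * (\<Sum>k\<le>2 * N. of_real (x (int i + (int k - J))) * c k)" .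
  have "norm (\<Sum>k\<le>2 * N. of_real (x (int i + (int k - J))) * c k)
     \<le> T * (norm (c (2 * N)) + (\<Sum>k<2 * N. norm (c (Suc k) - c k)))"
  proof (rule Abel_summation_bound)
    fix k assume k: "k \<le> 2 * N"
    have "(\<Sum>l\<le>k. x (int i + (int l - J))) = (\<Sum>j\<in>{int i - J - 1<..int i - J + int k}. x j)"
      by (rule sum.reindex_bij_witness[of _ "\<lambda>j. nat (j - int i + J)" "\<lambda>l. int i + (int l - J)"]) auto
    then show "\<bar>\<Sum>l\<le>k. x (int i + (int l - J))\<bar> \<le> T"
      using sums[of "int i - J - 1" "int i - J + int k"] k by (simp add: N)
  qed
  also have "\<dots> \<le> T * V"
  proof (intro mult_left_mono T)
    have "c (Suc k) - c k = cnj (\<psi> (t (Suc k)) - \<psi> (t k))" for k by (simp add: c_def)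
    then have "norm (c (Suc k) - c k) = norm (\<psi> (t (Suc k)) - \<psi> (t k))" for k
      by (simp only: complex_mod_cnj)
    then show "norm (c (2 * N)) + (\<Sum>k<2 * N. norm (c (Suc k) - c k)) \<le> V"
      using V[OF tR ts, of "2 * N" "2 * N"] tR by (simp add: c_def image_subset_iff)
  qed
  finally have le: "norm (\<Sum>k\<le>2 * N. of_real (x (int i + (int k - J))) * c k) \<le> T * V" .
  have scale: "sqrt s * (1 / real n powr (1/4)) * (1 / (real n powr (1/4) * s powr (1/2))) = 1 / sqrt n"
  proof -
    have "real n powr (1/4) * real n powr (1/4) = sqrt n"
      by (simp add: powr_half_sqrt flip: powr_add)
    then show ?thesis using s by (simp add: powr_half_sqrt)
  qed
  have "of_real (sqrt s) * disc_wt \<psi> A n x i s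
     = of_real (sqrt s * (1 / real n powr (1/4)) * (1 / (real n powr (1/4) * s powr (1/2))))
        * (\<Sum>k\<le>2 * N. of_real (x (int i + (int k - J))) * c k)"
    unfolding disc_wt_def sum_eq by (simp only: of_real_mult mult.assoc)
  also have "norm \<dots> = 1 / sqrt n * norm (\<Sum>k\<le>2 * N. of_real (x (int i + (int k - J))) * c k)"
    unfolding scale norm_mult norm_of_real by simp
  also have "\<dots> \<le> 1 / sqrt n * (T * V)" using le by (intro mult_left_mono) auto
  finally show ?thesis by simp
qed

lemma power_of_two_between:
  fixes y :: real
  assumes "y \<ge> 1"
  obtains r where "y \<le> 2 ^ r" "2 ^ r \<le> 2 * y"
proof -
  define r where "r = (LEAST r. y \<le> 2 ^ r)"
  have ex: "\<exists>r. y \<le> 2 ^ r" using real_arch_pow[of 2 y] by (auto intro: less_imp_le)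
  have r: "y \<le> 2 ^ r" unfolding r_def by (rule LeastI_ex[OF ex])
  have "2 ^ r \<le> 2 * y"
  proof (cases r)
    case 0 then show ?thesis using assms by simp
  next
    case (Suc k)
    then have "\<not> y \<le> 2 ^ k" using not_less_Least[of k "\<lambda>r. y \<le> 2 ^ r"] by (simp add: r_def)
    then show ?thesis using Suc by simp
  qed
  with r show thesis by (rule that)
qed

text \<open>
  There are about \<open>n\<close> window positions, the windows have length of order \<open>sqrt n\<close>, and the short sums
  must stay below \<open>\<eta> * sqrt n / V\<close>. With these values \<open>short_sums_tail\<close> gives the order
  \<open>n * (sqrt n) powr (p/2 - 1) / (\<eta> * sqrt n) powr p\<close>.
\<close>

theorem (in prob_space) wavelet_sup_tail:
  fixes X :: "int \<Rightarrow> 'a \<Rightarrow> real" and \<psi> :: "real \<Rightarrow> complex" and s :: "nat \<Rightarrow> real"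
  assumes p: "p > 2" and X: "\<And>j. X j \<in> borel_measurable M" and K: "K \<ge> 0"
    and mom: "\<And>u m. (\<integral>\<^sup>+\<omega>. ennreal (\<bar>\<Sum>j\<in>{u<..u + int m}. X j \<omega>\<bar> powr p) \<partial>M) \<le> ennreal (K * real m powr (p/2))"
    and \<psi>: "abs_continuous \<psi>" and A: "A > 0" and d: "d \<ge> 1" and s: "\<And>l. l \<in> {1..d} \<Longrightarrow> s l > 0"
  shows "\<exists>C>0. \<forall>n\<ge>1. \<forall>\<eta>>0. \<exists>E\<in>events. prob E \<le> C * real n powr (1/2 - p/4) / \<eta> powr p \<and>
     (\<forall>\<omega>\<in>space M - E. \<forall>i\<in>{1..n}. \<forall>l\<in>{1..d}.
        norm (of_real (sqrt (s l)) * disc_wt \<psi> A n (\<lambda>j. X j \<omega>) i (s l)) \<le> \<eta>)"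
proof -
  define s0 where "s0 = Min (s ` {1..d})"
  define s1 where "s1 = Max (s ` {1..d})"
  have fin: "finite (s ` {1..d})" "s ` {1..d} \<noteq> {}" using d by auto
  have s0: "s0 > 0" using Min_in[OF fin] s by (auto simp: s0_def)
  have s01: "s0 \<le> s l" "s l \<le> s1" if "l \<in> {1..d}" for l
    using that fin by (auto simp: s0_def s1_def)
  have s1: "s1 > 0" using s01[of 1] s[of 1] d by simp
  define R where "R = A + 1 / s0"
  have R: "R > 0" using A s0 by (simp add: R_def add_pos_pos)
  have acR: "abs_continuous_on {-R..R} \<psi>" "-R \<le> R"
    using \<psi> R unfolding abs_continuous_def by auto
  obtain V where V: "V > 0" "\<And>y t m. y \<in> {-R..R} \<Longrightarrow> mono t \<Longrightarrow> range t \<subseteq> {-R..R} \<Longrightarrow>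
     norm (\<psi> y) + (\<Sum>k<m::nat. norm (\<psi> (t (Suc k)) - \<psi> (t k))) \<le> V"
    by (rule abs_continuous_on_bound_and_variation[OF acR]) blast
  \<comment> \<open>Windows at all scales have length at most \<open>c * sqrt n\<close>, including the rounding at both ends.\<close>
  define c where "c = 2 * A * s1 + 4"
  have c: "c \<ge> 4" using A s1 by (simp add: c_def)
  obtain C where C: "C \<ge> 0" "\<And>lo hi r t. 2 ^ r \<le> hi - lo \<Longrightarrow> t > 0 \<Longrightarrow>
     (\<exists>E\<in>events. prob E \<le> C * real_of_int (hi - lo) * (2 ^ r) powr (p/2 - 1) / t powr p \<and>
        (\<forall>\<omega>\<in>space M - E. \<forall>u v. lo \<le> u \<longrightarrow> u \<le> v \<longrightarrow> v \<le> hi \<longrightarrow> v \<le> u + 2 ^ r \<longrightarrow>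
            \<bar>\<Sum>k\<in>{u<..v}. X k \<omega>\<bar> \<le> t))"
    using short_sums_tail[OF p X K mom] by blast
  define C' where "C' = C * (1 + 4 * c) * (2 * c) powr (p/2 - 1) * V powr p"
  have C': "C' \<ge> 0" unfolding C'_def using C(1) c by simp
  show ?thesis
  proof (intro exI[of _ "C' + 1"] conjI allI impI)
    show "C' + 1 > 0" using C' by simp
    fix n :: nat and \<eta> :: real assume n: "n \<ge> 1" and \<eta>: "\<eta> > 0"
    have n1: "sqrt n \<ge> 1" "sqrt n \<le> n"
      using n by (auto intro: real_le_lsqrt simp: power2_eq_square)
    have "c * sqrt n \<ge> 1 * 1" using c n1 by (intro mult_mono) auto
    then obtain r where r: "c * sqrt n \<le> 2 ^ r" "2 ^ r \<le> 2 * (c * sqrt n)"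
      using power_of_two_between[of "c * sqrt n"] by auto
    define lo hi :: int where "lo = - (2 ^ r)" and "hi = int n + 2 ^ r"
    define T where "T = \<eta> * sqrt n / V"
    have T: "T > 0" using \<eta> n1 V by (simp add: T_def)
    have "2 ^ r \<le> hi - lo" by (simp add: lo_def hi_def)
    from C(2)[OF this T] obtain E where E: "E \<in> events"
      "prob E \<le> C * real_of_int (hi - lo) * (2 ^ r) powr (p/2 - 1) / T powr p"
      "\<And>\<omega> u v. \<omega> \<in> space M - E \<Longrightarrow> lo \<le> u \<Longrightarrow> u \<le> v \<Longrightarrow> v \<le> hi \<Longrightarrow> v \<le> u + 2 ^ r \<Longrightarrow>
            \<bar>\<Sum>k\<in>{u<..v}. X k \<omega>\<bar> \<le> T" by blast
    show "\<exists>E\<in>events. prob E \<le> (C' + 1) * real n powr (1/2 - p/4) / \<eta> powr p \<and>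
     (\<forall>\<omega>\<in>space M - E. \<forall>i\<in>{1..n}. \<forall>l\<in>{1..d}.
        norm (of_real (sqrt (s l)) * disc_wt \<psi> A n (\<lambda>j. X j \<omega>) i (s l)) \<le> \<eta>)"
    proof (intro bexI[of _ E] conjI ballI)
      have len: "real_of_int (hi - lo) \<le> (1 + 4 * c) * n"
      proof -
        have "real_of_int (hi - lo) = n + 2 * 2 ^ r" by (simp add: lo_def hi_def)
        also have "\<dots> \<le> n + 4 * c * sqrt n" using r(2) by simp
        also have "\<dots> \<le> n + 4 * c * n" using n1 c by (intro add_left_mono mult_left_mono) auto
        finally show ?thesis by (simp add: algebra_simps)
      qed
      have sq: "sqrt n powr x = real n powr (x / 2)" for x
        by (simp add: powr_powr flip: powr_half_sqrt)
      have "prob E \<le> C * ((1 + 4 * c) * n) * (2 * (c * sqrt n)) powr (p/2 - 1) / T powr p"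
      proof (rule order.trans[OF E(2)], intro divide_right_mono mult_mono)
        show "(2 ^ r) powr (p/2 - 1) \<le> (2 * (c * sqrt n)) powr (p/2 - 1)"
          using r(2) p by (intro powr_mono2) auto
        have "lo \<le> hi" unfolding lo_def hi_def by (rule order.trans[of _ 0]) simp_all
        then show "0 \<le> real_of_int (hi - lo)" by simp
      qed (use len C(1) c in auto)
      also have "(2 * (c * sqrt n)) powr (p/2 - 1) = (2 * c) powr (p/2 - 1) * real n powr ((p/2 - 1) / 2)"
      proof -
        have "2 * (c * sqrt n) = (2 * c) * sqrt n" by simp
        also have "\<dots> powr (p/2 - 1) = (2 * c) powr (p/2 - 1) * sqrt n powr (p/2 - 1)"
          by (rule powr_mult)
        finally show ?thesis by (simp only: sq)
      qed
      also have "T powr p = \<eta> powr p * real n powr (p/2) / V powr p"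
      proof -
        have "T powr p = (\<eta> * sqrt n) powr p / V powr p"
          unfolding T_def by (rule powr_divide)
        also have "(\<eta> * sqrt n) powr p = \<eta> powr p * sqrt n powr p"
          by (rule powr_mult)
        finally show ?thesis by (simp only: sq)
      qed
      also have "C * ((1 + 4 * c) * n) * ((2 * c) powr (p/2 - 1) * real n powr ((p/2 - 1) / 2)) / (\<eta> powr p * real n powr (p/2) / V powr p)
        = C' * (n * real n powr ((p/2 - 1) / 2) / real n powr (p/2)) / \<eta> powr p"
        by (simp add: C'_def mult_ac)
      also have "n * real n powr ((p/2 - 1) / 2) / real n powr (p/2) = real n powr (1/2 - p/4)"
      proof -
        have "n * real n powr ((p/2 - 1) / 2) / real n powr (p/2) = real n powr (1 + (p/2 - 1) / 2 - p/2)"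
          using n by (simp add: powr_add powr_diff)
        also have "1 + (p/2 - 1) / 2 - p/2 = 1/2 - p/4" by (simp add: field_simps)
        finally show ?thesis .
      qed
      also have "C' * real n powr (1/2 - p/4) / \<eta> powr p \<le> (C' + 1) * real n powr (1/2 - p/4) / \<eta> powr p"
        by (intro divide_right_mono mult_right_mono) auto
      finally show "prob E \<le> (C' + 1) * real n powr (1/2 - p/4) / \<eta> powr p" .
    next
      fix \<omega> i l assume \<omega>: "\<omega> \<in> space M - E" and i: "i \<in> {1..n}" and l: "l \<in> {1..d}"
      define J where "J = \<lceil>sqrt n * A * s l\<rceil>"
      have "sqrt n * A * s l \<ge> 0" using n1 A s[OF l] by simp
      then have J0: "J \<ge> 0" unfolding J_def by linarith
      have J: "2 * J + 1 \<le> 2 ^ r"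
      proof -
        have "real_of_int (2 * J + 1) \<le> 2 * (sqrt n * A * s l) + 3" unfolding J_def by linarith
        also have "\<dots> \<le> 2 * (sqrt n * A * s1) + 4 * sqrt n"
        proof (intro add_mono mult_left_mono)
          show "s l \<le> s1" using s01[OF l] by simp
          show "3 \<le> 4 * sqrt n" using n1 by linarith
        qed (use n1 A in auto)
        also have "\<dots> = c * sqrt n" by (simp add: c_def algebra_simps)
        also have "\<dots> \<le> 2 ^ r" by (rule r(1))
        finally have "real_of_int (2 * J + 1) \<le> real_of_int (2 ^ r)" by simp
        then show ?thesis by (simp only: of_int_le_iff)
      qed
      have RV: "A + 1 / s l \<le> R"
        unfolding R_def using s0 s01[OF l] by (intro add_left_mono divide_left_mono) auto
      have "norm (of_real (sqrt (s l)) * disc_wt \<psi> A n (\<lambda>j. X j \<omega>) i (s l)) \<le> T * V / sqrt n"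
      proof (rule disc_wt_bound[OF n s[OF l] A RV V(2) J_def])
        fix u v assume "int i - J - 1 \<le> u" "u \<le> v" "v \<le> int i + J"
        then show "\<bar>\<Sum>k\<in>{u<..v}. X k \<omega>\<bar> \<le> T"
          using J J0 i by (intro E(3)[OF \<omega>]) (auto simp: lo_def hi_def)
      qed (use T in auto)
      also have "T * V / sqrt n = \<eta>" using V n1 by (simp add: T_def)
      finally show "norm (of_real (sqrt (s l)) * disc_wt \<psi> A n (\<lambda>j. X j \<omega>) i (s l)) \<le> \<eta>" .
    qed (fact E(1))
  qed
qed

section \<open>The Levy--Prokhorov distance of concentrated laws\<close>

lemma sup_nbhd_iff:
  assumes I: "finite I" and \<epsilon>: "\<epsilon> > 0"
  shows "x \<in> sup_nbhd I \<epsilon> B \<longleftrightarrow> x \<in> I \<rightarrow>\<^sub>E UNIV \<and> (\<exists>y\<in>B. \<forall>k\<in>I. norm (x k - y k) < \<epsilon>)"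
proof -
  have "(SUP k\<in>I. ennreal (norm (x k - y k))) < ennreal \<epsilon> \<longleftrightarrow> (\<forall>k\<in>I. norm (x k - y k) < \<epsilon>)" for y
  proof (cases "I = {}")
    case True then show ?thesis using \<epsilon> by (simp add: bot_ennreal)
  next
    case False
    then have "(SUP k\<in>I. ennreal (norm (x k - y k))) = Max ((\<lambda>k. ennreal (norm (x k - y k))) ` I)"
      using I by (simp add: cSup_eq_Max)
    then show ?thesis using I False by (simp add: ennreal_less_iff)
  qed
  then show ?thesis by (simp add: sup_nbhd_def INF_less_iff)
qed

text \<open>
  The measure of the neighbourhood is meaningful only if it is measurable. The
  neighbourhood is open, hence a countable union of boxes with centres in a countable dense
  set and radii \<open>1 / (m + 1)\<close>.
\<close>

lemma sets_sup_nbhd: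
  assumes I: "finite I" and \<epsilon>: "\<epsilon> > 0"
  shows "sup_nbhd I \<epsilon> B \<in> sets (PiM I (\<lambda>_. borel))"
proof -
  obtain D :: "complex set" where D: "countable D" "\<And>X. open X \<Longrightarrow> X \<noteq> {} \<Longrightarrow> \<exists>d\<in>D. d \<in> X"
    using countable_dense_setE by blast
  define box where "box q m = {x \<in> I \<rightarrow>\<^sub>E (UNIV :: complex set). \<forall>k\<in>I. norm (x k - q k) < 1 / real (Suc m)}" for q m
  define Q where "Q = {z \<in> (I \<rightarrow>\<^sub>E D) \<times> (UNIV :: nat set). box (fst z) (snd z) \<subseteq> sup_nbhd I \<epsilon> B}"
  have "sup_nbhd I \<epsilon> B = (\<Union>z\<in>Q. box (fst z) (snd z))"
  proof (intro equalityI subsetI)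
    fix x assume "x \<in> sup_nbhd I \<epsilon> B"
    then obtain y where x: "x \<in> I \<rightarrow>\<^sub>E UNIV" and y: "y \<in> B" "\<And>k. k \<in> I \<Longrightarrow> norm (x k - y k) < \<epsilon>"
      by (auto simp: sup_nbhd_iff[OF I \<epsilon>])
    have "eventually (\<lambda>m. norm (x k - y k) + 2 / real (Suc m) < \<epsilon>) sequentially" if "k \<in> I" for k
    proof -
      have "(\<lambda>m. norm (x k - y k) + 2 * inverse (real (Suc m))) \<longlonglongrightarrow> norm (x k - y k) + 2 * 0"
        by (intro tendsto_intros LIMSEQ_inverse_real_of_nat)
      from order_tendstoD(2)[OF this] y(2)[OF that] show ?thesis by (simp add: divide_inverse)
    qed
    then have "eventually (\<lambda>m. \<forall>k\<in>I. norm (x k - y k) + 2 / real (Suc m) < \<epsilon>) sequentially"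
      using I by (intro eventually_ball_finite) auto
    then obtain m where m: "\<And>k. k \<in> I \<Longrightarrow> norm (x k - y k) + 2 / real (Suc m) < \<epsilon>"
      by (auto simp: eventually_sequentially)
    have "\<exists>q\<in>D. norm (x k - q) < 1 / real (Suc m)" for k
      using D(2)[of "ball (x k) (1 / real (Suc m))"] by (auto simp: dist_norm)
    then obtain q where q: "\<And>k. q k \<in> D" "\<And>k. norm (x k - q k) < 1 / real (Suc m)" by metis
    let ?q = "restrict q I"
    have "box ?q m \<subseteq> sup_nbhd I \<epsilon> B"
    proof
      fix w assume w: "w \<in> box ?q m"
      have "norm (w k - y k) < \<epsilon>" if k: "k \<in> I" for k
      proof -
        have "norm (w k - y k) = norm ((w k - q k) - (x k - q k) + (x k - y k))" by simp
        also have "\<dots> \<le> norm (w k - q k) + norm (x k - q k) + norm (x k - y k)"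
          by (meson add_mono_thms_linordered_semiring(3) norm_triangle_ineq norm_triangle_ineq4 order_trans)
        also have "\<dots> < 1 / real (Suc m) + 1 / real (Suc m) + norm (x k - y k)"
          using w k q(2)[of k] by (intro add_strict_right_mono add_strict_mono) (auto simp: box_def)
        also have "\<dots> < \<epsilon>" using m[OF k] by simp
        finally show ?thesis .
      qed
      then show "w \<in> sup_nbhd I \<epsilon> B" using w y(1) by (auto simp: sup_nbhd_iff[OF I \<epsilon>] box_def)
    qed
    then have "(?q, m) \<in> Q" using q(1) by (auto simp: Q_def)
    moreover have "x \<in> box ?q m" using x q(2) by (auto simp: box_def)
    ultimately show "x \<in> (\<Union>z\<in>Q. box (fst z) (snd z))" by (metis (no_types, lifting) UN_I fst_conv snd_conv)
  qed (auto simp: Q_def)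
  moreover have "countable Q"
  proof (rule countable_subset)
    show "Q \<subseteq> (I \<rightarrow>\<^sub>E D) \<times> UNIV" by (auto simp: Q_def)
    show "countable ((I \<rightarrow>\<^sub>E D) \<times> (UNIV :: nat set))" using I D(1) by (intro countable_SIGMA countable_PiE) auto
  qed
  moreover have "box q m \<in> sets (PiM I (\<lambda>_. borel))" for q m
  proof -
    have "box q m = {x \<in> space (PiM I (\<lambda>_. borel)). \<forall>k\<in>I. norm (x k - q k) < 1 / real (Suc m)}"
      by (auto simp: box_def space_PiM)
    also have "\<dots> \<in> sets (PiM I (\<lambda>_. borel))" using I by measurable
    finally show ?thesis .
  qed
  ultimately show ?thesis by (auto intro!: sets.countable_UN')
qed

text \<open>
  Either \<open>B\<close> misses the \<open>\<eta>\<close>-ball around zero and has small mass, or it contains a point of that ball;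
  then the \<open>3 * \<eta>\<close>-neighbourhood of \<open>B\<close> contains the whole ball and has mass at least \<open>1 - \<eta>\<close>.
\<close>

lemma levy_prokhorov_one_sided:
  assumes I: "finite I" and \<eta>: "\<eta> > 0" and \<mu>: "prob_space \<mu>" "sets \<mu> = sets (PiM I (\<lambda>_. borel))"
    and \<nu>: "prob_space \<nu>" "sets \<nu> = sets (PiM I (\<lambda>_. borel))"
    and \<mu>Z: "measure \<mu> {x \<in> I \<rightarrow>\<^sub>E UNIV. \<forall>k\<in>I. norm (x k) \<le> \<eta>} \<ge> 1 - \<eta>"
    and \<nu>Z: "measure \<nu> {x \<in> I \<rightarrow>\<^sub>E UNIV. \<forall>k\<in>I. norm (x k) \<le> \<eta>} \<ge> 1 - \<eta>"
    and B: "B \<in> sets (PiM I (\<lambda>_. borel))"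
  shows "measure \<mu> B \<le> measure \<nu> (sup_nbhd I (3 * \<eta>) B) + 3 * \<eta>"
proof -
  interpret \<mu>: prob_space \<mu> by fact
  interpret \<nu>: prob_space \<nu> by fact
  let ?Z = "{x \<in> I \<rightarrow>\<^sub>E (UNIV :: complex set). \<forall>k\<in>I. norm (x k) \<le> \<eta>}"
  have "?Z = {x \<in> space (PiM I (\<lambda>_. borel)). \<forall>k\<in>I. norm (x k) \<le> \<eta>}" by (auto simp: space_PiM)
  also have "\<dots> \<in> sets (PiM I (\<lambda>_. borel))" using I by measurable
  finally have Z: "?Z \<in> sets (PiM I (\<lambda>_. borel))" .
  show ?thesis
  proof (cases "B \<inter> ?Z = {}")
    case True
    have "measure \<mu> B \<le> measure \<mu> (space \<mu> - ?Z)"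
      using True B Z \<mu>(2) sets.sets_into_space[of B \<mu>] by (intro \<mu>.finite_measure_mono) auto
    also have "\<dots> = 1 - measure \<mu> ?Z" using Z \<mu>(2) by (intro \<mu>.prob_compl) auto
    finally have "measure \<mu> B \<le> \<eta>" using \<mu>Z by simp
    moreover have "0 \<le> measure \<nu> (sup_nbhd I (3 * \<eta>) B)" by simp
    ultimately show ?thesis using \<eta> by linarith
  next
    case False
    then obtain y where y: "y \<in> B" "y \<in> ?Z" by auto
    have "?Z \<subseteq> sup_nbhd I (3 * \<eta>) B"
    proof
      fix x assume x: "x \<in> ?Z"
      have "norm (x k - y k) < 3 * \<eta>" if k: "k \<in> I" for k
      proof -
        have "norm (x k - y k) \<le> norm (x k) + norm (y k)" by (rule norm_triangle_ineq4)
        also have "\<dots> \<le> \<eta> + \<eta>" using x y k by (intro add_mono) auto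
        also have "\<dots> < 3 * \<eta>" using \<eta> by simp
        finally show ?thesis .
      qed
      then show "x \<in> sup_nbhd I (3 * \<eta>) B" using x y \<eta> by (auto simp: sup_nbhd_iff[OF I])
    qed
    then have "measure \<nu> ?Z \<le> measure \<nu> (sup_nbhd I (3 * \<eta>) B)"
      using sets_sup_nbhd[OF I, of "3 * \<eta>" B] \<eta> \<nu>(2) by (intro \<nu>.finite_measure_mono) auto
    moreover have "measure \<mu> B \<le> 1" by simp
    ultimately show ?thesis using \<nu>Z \<eta> by linarith
  qed
qed

lemma levy_prokhorov_le_if_concentrated:
  assumes I: "finite I" and \<eta>: "\<eta> > 0" and \<mu>: "prob_space \<mu>" "sets \<mu> = sets (PiM I (\<lambda>_. borel))"
    and \<nu>: "prob_space \<nu>" "sets \<nu> = sets (PiM I (\<lambda>_. borel))"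
    and \<mu>Z: "measure \<mu> {x \<in> I \<rightarrow>\<^sub>E UNIV. \<forall>k\<in>I. norm (x k) \<le> \<eta>} \<ge> 1 - \<eta>"
    and \<nu>Z: "measure \<nu> {x \<in> I \<rightarrow>\<^sub>E UNIV. \<forall>k\<in>I. norm (x k) \<le> \<eta>} \<ge> 1 - \<eta>"
  shows "levy_prokhorov I \<mu> \<nu> \<le> 3 * \<eta>" "0 \<le> levy_prokhorov I \<mu> \<nu>"
proof -
  let ?S = "{\<epsilon>. \<epsilon> > 0 \<and> (\<forall>B\<in>sets (PiM I (\<lambda>_. borel)).
          measure \<mu> B \<le> measure \<nu> (sup_nbhd I \<epsilon> B) + \<epsilon> \<and>
          measure \<nu> B \<le> measure \<mu> (sup_nbhd I \<epsilon> B) + \<epsilon>)}"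
  have mem: "3 * \<eta> \<in> ?S"
    using \<eta> levy_prokhorov_one_sided[OF I \<eta> \<mu> \<nu> \<mu>Z \<nu>Z] levy_prokhorov_one_sided[OF I \<eta> \<nu> \<mu> \<nu>Z \<mu>Z] by simp
  have bdd: "bdd_below ?S" by (rule bdd_belowI[of _ 0]) auto
  show "levy_prokhorov I \<mu> \<nu> \<le> 3 * \<eta>"
    unfolding levy_prokhorov_def by (rule cInf_lower[OF mem bdd])
  show "0 \<le> levy_prokhorov I \<mu> \<nu>"
    unfolding levy_prokhorov_def
  proof (rule cInf_greatest)
    show "?S \<noteq> {}" using mem by blast
  qed auto
qed

lemma wt_law_concentrated:
  assumes "prob_space M" and X [measurable]: "\<And>j. X j \<in> borel_measurable M"
    and E: "E \<in> sets M" "measure M E \<le> \<eta>"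
    and le: "\<And>\<omega> i l. \<omega> \<in> space M - E \<Longrightarrow> i \<in> {1..n} \<Longrightarrow> l \<in> {1..d} \<Longrightarrow>
        norm (of_real (sqrt (s l)) * disc_wt \<psi> A n (\<lambda>j. X j \<omega>) i (s l)) \<le> \<eta>"
  shows "prob_space (wt_law M \<psi> A d s X n)"
    and "sets (wt_law M \<psi> A d s X n) = sets (PiM (cmat_idx n d) (\<lambda>_. borel))"
    and "measure (wt_law M \<psi> A d s X n) {x \<in> cmat_idx n d \<rightarrow>\<^sub>E UNIV. \<forall>k\<in>cmat_idx n d. norm (x k) \<le> \<eta>} \<ge> 1 - \<eta>"
proof -
  interpret prob_space M by fact
  let ?I = "cmat_idx n d"
  let ?f = "\<lambda>\<omega>. \<lambda>(i, l)\<in>?I. of_real (sqrt (s l)) * disc_wt \<psi> A n (\<lambda>j. X j \<omega>) i (s l)"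
  have f [measurable]: "?f \<in> measurable M (PiM ?I (\<lambda>_. borel))"
  proof (rule measurable_restrict)
    fix k show "(\<lambda>\<omega>. case k of (i, l) \<Rightarrow> complex_of_real (sqrt (s l)) * disc_wt \<psi> A n (\<lambda>j. X j \<omega>) i (s l)) \<in> borel_measurable M"
      by (cases k) (simp add: disc_wt_def)
  qed
  show "prob_space (wt_law M \<psi> A d s X n)" unfolding wt_law_def by (rule prob_space_distr) (rule f)
  show sets: "sets (wt_law M \<psi> A d s X n) = sets (PiM ?I (\<lambda>_. borel))" by (simp add: wt_law_def)
  let ?Z = "{x \<in> ?I \<rightarrow>\<^sub>E (UNIV :: complex set). \<forall>k\<in>?I. norm (x k) \<le> \<eta>}"
  have "?Z = {x \<in> space (PiM ?I (\<lambda>_. borel)). \<forall>k\<in>?I. norm (x k) \<le> \<eta>}" by (auto simp: space_PiM)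
  also have "\<dots> \<in> sets (PiM ?I (\<lambda>_. borel))" by measurable
  finally have Z: "?Z \<in> sets (PiM ?I (\<lambda>_. borel))" .
  have "1 - \<eta> \<le> prob (space M - E)" using E by (subst prob_compl) auto
  also have "\<dots> \<le> prob (?f -` ?Z \<inter> space M)"
  proof (rule finite_measure_mono)
    show "space M - E \<subseteq> ?f -` ?Z \<inter> space M" using le by auto
    show "?f -` ?Z \<inter> space M \<in> events" by (rule measurable_sets[OF f Z])
  qed
  also have "\<dots> = measure (wt_law M \<psi> A d s X n) ?Z"
    unfolding wt_law_def by (rule measure_distr[symmetric, OF f Z])
  finally show "measure (wt_law M \<psi> A d s X n) ?Z \<ge> 1 - \<eta>" .
qed

text \<open>
  The value of \<open>\<eta>\<close> solves \<open>C * n powr (1/2 - p/4) / \<eta> powr p = \<eta>\<close>, so that the tail bound at \<open>\<eta>\<close>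
  is \<open>\<eta>\<close> itself.
\<close>

theorem levy_prokhorov_wavelet_rate:
  fixes X :: "int \<Rightarrow> 'a \<Rightarrow> real" and Y :: "int \<Rightarrow> 'b \<Rightarrow> real"
    and \<psi> :: "real \<Rightarrow> complex" and s :: "nat \<Rightarrow> real"
  assumes p: "p > 2" and M: "prob_space M" and N: "prob_space N"
    and X: "\<And>j. X j \<in> borel_measurable M" and Y: "\<And>j. Y j \<in> borel_measurable N"
    and KX: "KX \<ge> 0" and KY: "KY \<ge> 0"
    and momX: "\<And>u m. (\<integral>\<^sup>+\<omega>. ennreal (\<bar>\<Sum>j\<in>{u<..u + int m}. X j \<omega>\<bar> powr p) \<partial>M) \<le> ennreal (KX * real m powr (p/2))"
    and momY: "\<And>u m. (\<integral>\<^sup>+\<omega>. ennreal (\<bar>\<Sum>j\<in>{u<..u + int m}. Y j \<omega>\<bar> powr p) \<partial>N) \<le> ennreal (KY * real m powr (p/2))"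
    and \<psi>: "abs_continuous \<psi>" and A: "A > 0" and d: "d \<ge> 1" and s: "\<And>l. l \<in> {1..d} \<Longrightarrow> s l > 0"
  shows "\<exists>C. \<forall>n\<ge>1. \<bar>levy_prokhorov (cmat_idx n d) (wt_law M \<psi> A d s X n) (wt_law N \<psi> A d s Y n)\<bar>
            \<le> C * real n powr (- ((p - 2) / (4 * (p + 1))))"
proof -
  obtain CX where CX: "CX > 0" "\<forall>n\<ge>1. \<forall>\<eta>>0. \<exists>E\<in>sets M. measure M E \<le> CX * real n powr (1/2 - p/4) / \<eta> powr p \<and>
     (\<forall>\<omega>\<in>space M - E. \<forall>i\<in>{1..n}. \<forall>l\<in>{1..d}.
        norm (of_real (sqrt (s l)) * disc_wt \<psi> A n (\<lambda>j. X j \<omega>) i (s l)) \<le> \<eta>)"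
    using prob_space.wavelet_sup_tail[where s = s, OF M p X KX momX \<psi> A d s] by blast
  obtain CY where CY: "CY > 0" "\<forall>n\<ge>1. \<forall>\<eta>>0. \<exists>E\<in>sets N. measure N E \<le> CY * real n powr (1/2 - p/4) / \<eta> powr p \<and>
     (\<forall>\<omega>\<in>space N - E. \<forall>i\<in>{1..n}. \<forall>l\<in>{1..d}.
        norm (of_real (sqrt (s l)) * disc_wt \<psi> A n (\<lambda>j. Y j \<omega>) i (s l)) \<le> \<eta>)"
    using prob_space.wavelet_sup_tail[where s = s, OF N p Y KY momY \<psi> A d s] by blast
  define C where "C = max CX CY"
  have C: "C > 0" "CX \<le> C" "CY \<le> C" using CX(1) by (auto simp: C_def)
  define \<theta> where "\<theta> = (p - 2) / (4 * (p + 1))"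
  show ?thesis
  proof (intro exI[of _ "3 * C powr (1 / (p + 1))"] allI impI)
    fix n :: nat assume n: "n \<ge> 1"
    define \<eta> where "\<eta> = C powr (1 / (p + 1)) * real n powr (- \<theta>)"
    have \<eta>: "\<eta> > 0" using C n by (simp add: \<eta>_def)
    have balance: "C * real n powr (1/2 - p/4) / \<eta> powr p = \<eta>"
    proof -
      have "\<eta> powr p = C powr (p / (p + 1)) * real n powr (- (\<theta> * p))"
        by (simp add: \<eta>_def powr_mult powr_powr)
      then have "C * real n powr (1/2 - p/4) / \<eta> powr p
          = (C / C powr (p / (p + 1))) * (real n powr (1/2 - p/4) / real n powr (- (\<theta> * p)))"
        by (simp only: times_divide_times_eq)
      also have "C / C powr (p / (p + 1)) = C powr (1 - p / (p + 1))"
        using C by (simp add: powr_diff)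
      also have "real n powr (1/2 - p/4) / real n powr (- (\<theta> * p)) = real n powr (1/2 - p/4 - - (\<theta> * p))"
        by (rule powr_diff[symmetric])
      also have "1 - p / (p + 1) = 1 / (p + 1)" using p by (simp add: field_simps)
      also have "1/2 - p/4 - - (\<theta> * p) = - \<theta>"
        using p by (simp add: \<theta>_def divide_simps) (simp add: algebra_simps)
      finally show ?thesis by (simp add: \<eta>_def)
    qed
    have shrink: "c * real n powr (1/2 - p/4) / \<eta> powr p \<le> \<eta>" if "c \<le> C" for c
    proof -
      have "c * real n powr (1/2 - p/4) / \<eta> powr p \<le> C * real n powr (1/2 - p/4) / \<eta> powr p"
        using that by (intro divide_right_mono mult_right_mono) auto
      then show ?thesis by (simp only: balance)
    qed
    obtain FX where FX: "FX \<in> sets M" "measure M FX \<le> \<eta>"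
      "\<And>\<omega> i l. \<omega> \<in> space M - FX \<Longrightarrow> i \<in> {1..n} \<Longrightarrow> l \<in> {1..d} \<Longrightarrow>
        norm (of_real (sqrt (s l)) * disc_wt \<psi> A n (\<lambda>j. X j \<omega>) i (s l)) \<le> \<eta>"
    proof -
      obtain E where "E \<in> sets M" "measure M E \<le> CX * real n powr (1/2 - p/4) / \<eta> powr p"
        "\<forall>\<omega>\<in>space M - E. \<forall>i\<in>{1..n}. \<forall>l\<in>{1..d}.
          norm (of_real (sqrt (s l)) * disc_wt \<psi> A n (\<lambda>j. X j \<omega>) i (s l)) \<le> \<eta>"
        using CX(2) n \<eta> by blast
      then show thesis using shrink[OF C(2)] by (intro that[of E]) (auto intro: order.trans)
    qed
    obtain FY where FY: "FY \<in> sets N" "measure N FY \<le> \<eta>"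
      "\<And>\<omega> i l. \<omega> \<in> space N - FY \<Longrightarrow> i \<in> {1..n} \<Longrightarrow> l \<in> {1..d} \<Longrightarrow>
        norm (of_real (sqrt (s l)) * disc_wt \<psi> A n (\<lambda>j. Y j \<omega>) i (s l)) \<le> \<eta>"
    proof -
      obtain E where "E \<in> sets N" "measure N E \<le> CY * real n powr (1/2 - p/4) / \<eta> powr p"
        "\<forall>\<omega>\<in>space N - E. \<forall>i\<in>{1..n}. \<forall>l\<in>{1..d}.
          norm (of_real (sqrt (s l)) * disc_wt \<psi> A n (\<lambda>j. Y j \<omega>) i (s l)) \<le> \<eta>"
        using CY(2) n \<eta> by blast
      then show thesis using shrink[OF C(3)] by (intro that[of E]) (auto intro: order.trans)
    qed
    note lawX = wt_law_concentrated[where s = s, OF M X FX]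
    note lawY = wt_law_concentrated[where s = s, OF N Y FY]
    have "finite (cmat_idx n d)" by simp
    from levy_prokhorov_le_if_concentrated[OF this \<eta> lawX(1,2) lawY(1,2) lawX(3) lawY(3)]
    show "\<bar>levy_prokhorov (cmat_idx n d) (wt_law M \<psi> A d s X n) (wt_law N \<psi> A d s Y n)\<bar>
            \<le> 3 * C powr (1 / (p + 1)) * real n powr (- ((p - 2) / (4 * (p + 1))))"
      by (simp add: \<eta>_def \<theta>_def)
  qed
qed

section \<open>Causal and Gaussian sequences\<close>

lemma iid_sequence_law:
  assumes "prob_space M" and iid: "iid_sequence M e"
  shows "e j \<in> borel_measurable M"
    and "distr M (PiM UNIV (\<lambda>_. borel)) (\<lambda>\<omega> j. e j \<omega>) = PiM UNIV (\<lambda>_. distr M borel (e 0))"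
proof -
  interpret prob_space M by fact
  have e: "e j \<in> borel_measurable M" for j using iid by (auto simp: iid_sequence_def indep_vars_def2)
  then show "e j \<in> borel_measurable M" .
  have "distr M (PiM UNIV (\<lambda>_. borel)) (\<lambda>\<omega>. \<lambda>j\<in>UNIV. e j \<omega>) = PiM UNIV (\<lambda>j. distr M borel (e j))"
    using iid e by (subst indep_vars_iff_distr_eq_PiM[symmetric]) (auto simp: iid_sequence_def)
  moreover have "(\<lambda>j. distr M borel (e j)) = (\<lambda>_. distr M borel (e 0))"
    using iid unfolding iid_sequence_def by blast
  ultimately show "distr M (PiM UNIV (\<lambda>_. borel)) (\<lambda>\<omega> j. e j \<omega>) = PiM UNIV (\<lambda>_. distr M borel (e 0))"
    by (simp only: restrict_UNIV)
qed

lemma summable_powr_minus_2: "summable (\<lambda>k. real (k + 1) powr (-2))"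
proof -
  have "summable (\<lambda>k. real k powr (-2))" by (subst summable_real_powr_iff) simp
  then show ?thesis by (subst summable_iff_shift[of "\<lambda>k. real k powr (-2)" 1]) 
qed

text \<open>
  The sequence is transported to the space of i.i.d. coordinates, where the pair of \<open>e\<close> and its
  independent copy has the product law, so the coupling distances are those of the dependence
  measure. Moment bounds make the supremum in that measure one of a bounded set and
  supply the coupling bound at lag 0, which the decay condition leaves open. The decay enters
  through the summable bound \<open>O((k + 1) powr (-2))\<close>.
\<close>

theorem causal_sequence_block_moments:
  fixes e e' \<epsilon> :: "int \<Rightarrow> 'a \<Rightarrow> real" and H :: "int \<Rightarrow> (nat \<Rightarrow> real) \<Rightarrow> real"
  assumes M: "prob_space M" and iid: "iid_sequence M e" and copy: "indep_copy M e e'"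
    and H: "\<And>j. H j \<in> borel_measurable (PiM UNIV (\<lambda>_. borel))"
    and \<epsilon>: "\<And>j \<omega>. \<omega> \<in> space M \<Longrightarrow> \<epsilon> j \<omega> = H j (past e j \<omega>)"
    and mean: "\<And>j. prob_space.expectation M (\<epsilon> j) = 0"
    and p: "p > 2" and chi: "chi > 1" and a: "a \<ge> 0"
    and mom: "\<And>j. (\<integral>\<^sup>+\<omega>. ennreal (\<bar>\<epsilon> j \<omega>\<bar> powr p) \<partial>M) \<le> ennreal (B powr p)" and B: "B > 0"
    and dep: "dep_measure M H e e' p
           \<in> O[principal {1..}](\<lambda>k. real (k + 1) powr (-(chi + 1)) * ln (real (k + 1)) powr (-a))"
  shows "\<exists>K\<ge>0. \<forall>u m. (\<integral>\<^sup>+\<omega>. ennreal (\<bar>\<Sum>j\<in>{u<..u + int m}. \<epsilon> j \<omega>\<bar> powr p) \<partial>M) \<le> ennreal (K * real m powr (p/2))"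
proof -
  interpret prob_space M by fact
  define \<mu> where "\<mu> = distr M borel (e 0)"
  have e [measurable]: "e j \<in> borel_measurable M" for j by (rule iid_sequence_law(1)[OF M iid])
  interpret S: iid_space \<mu>
    unfolding iid_space_def \<mu>_def by (rule prob_space_distr) measurable
  let ?P = "PiM (UNIV :: int set) (\<lambda>_. \<mu>)" and ?B = "PiM (UNIV :: int set) (\<lambda>_. borel :: real measure)"
  let ?E = "\<lambda>\<omega> j. e j \<omega>" and ?E' = "\<lambda>\<omega> j. e' j \<omega>"
  have law: "distr M ?B ?E = ?P"
    unfolding \<mu>_def by (rule iid_sequence_law(2)[OF M iid])
  have sets_P [measurable_cong]: "sets ?P = sets ?B"
    by (rule sets_PiM_cong) (simp_all add: \<mu>_def)
  have E' [measurable]: "?E' \<in> measurable M ?B" and E [measurable]: "?E \<in> measurable M ?B"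
    and joint: "distr M (?B \<Otimes>\<^sub>M ?B) (\<lambda>\<omega>. (?E \<omega>, ?E' \<omega>)) = ?P \<Otimes>\<^sub>M ?P"
    using copy law by (auto simp: indep_copy_def indep_var_distribution_eq)
  define h where "h j x = H j (\<lambda>k. x (j - int k))" for j and x :: "int \<Rightarrow> real"
  have "(\<lambda>x k. x (j - int k)) \<in> measurable ?B (PiM UNIV (\<lambda>_. borel))" for j :: int
    by (rule measurable_PiM_single') auto
  from measurable_compose[OF this H] have hB [measurable]: "h j \<in> borel_measurable ?B" for j
    unfolding h_def[abs_def] .
  then have h [measurable]: "h j \<in> borel_measurable ?P" for j
    by (simp cong: measurable_cong_sets add: sets_P)
  have \<epsilon>h: "\<epsilon> j \<omega> = h j (?E \<omega>)" if "\<omega> \<in> space M" for j \<omega>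
    using \<epsilon>[OF that] by (simp add: h_def past_def)
  have nn: "(\<integral>\<^sup>+x. g x \<partial>?P) = (\<integral>\<^sup>+\<omega>. g (?E \<omega>) \<partial>M)" if "g \<in> borel_measurable ?B" for g
    unfolding law[symmetric] using that by (intro nn_integral_distr) auto
  have hmom: "(\<integral>\<^sup>+x. ennreal (\<bar>h j x\<bar> powr p) \<partial>?P) \<le> ennreal (B powr p)" for j
  proof -
    have "(\<integral>\<^sup>+x. ennreal (\<bar>h j x\<bar> powr p) \<partial>?P) = (\<integral>\<^sup>+\<omega>. ennreal (\<bar>h j (?E \<omega>)\<bar> powr p) \<partial>M)"
      by (rule nn) measurable
    also have "\<dots> = (\<integral>\<^sup>+\<omega>. ennreal (\<bar>\<epsilon> j \<omega>\<bar> powr p) \<partial>M)" by (intro nn_integral_cong) (simp add: \<epsilon>h)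
    finally show ?thesis using mom[of j] by simp
  qed
  let ?g = "\<lambda>j k z. h j (fst z) - h j (patch (- {j - int k}) (fst z) (snd z))"
  define c where "c j k = expectation (\<lambda>\<omega>. \<bar>H j (past e j \<omega>) - H j (past_coupled e e' j k \<omega>)\<bar> powr p)" for j k
  have PPc: "(\<integral>\<^sup>+z. ennreal (\<bar>?g j k z\<bar> powr p) \<partial>(?P \<Otimes>\<^sub>M ?P)) = ennreal (c j k)" "c j k \<le> (2 * B) powr p" for j k
  proof -
    let ?w = "\<lambda>\<omega>. H j (past e j \<omega>) - H j (past_coupled e e' j k \<omega>)"
    have w: "?w \<omega> = ?g j k (?E \<omega>, ?E' \<omega>)" for \<omega>
      by (auto simp: h_def past_def past_coupled_def patch_def intro!: arg_cong[where f = "H j"])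
    have spl: "(\<lambda>z. patch (- {j - int k}) (fst z) (snd z)) \<in> measurable (?P \<Otimes>\<^sub>M ?P) ?P" by measurable
    have m: "?g j k \<in> borel_measurable (?P \<Otimes>\<^sub>M ?P)"
      using measurable_compose[OF spl h] measurable_compose[OF measurable_fst h] by simp
    have mB: "?g j k \<in> borel_measurable (?B \<Otimes>\<^sub>M ?B)"
      using m sets_pair_measure_cong[OF sets_P sets_P] by (simp cong: measurable_cong_sets)
    have wm: "?w \<in> borel_measurable M"
      unfolding w by (rule measurable_compose[OF _ mB]) measurable
    have eq: "(\<integral>\<^sup>+z. ennreal (\<bar>?g j k z\<bar> powr p) \<partial>(?P \<Otimes>\<^sub>M ?P)) = (\<integral>\<^sup>+\<omega>. ennreal (\<bar>?w \<omega>\<bar> powr p) \<partial>M)"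
      unfolding joint[symmetric] w using mB by (subst nn_integral_distr) auto
    have "(\<integral>\<^sup>+z. ennreal (\<bar>\<Sum>i\<in>{0, 1::nat}. (if i = 0 then h j (fst z) else - h j (patch (- {j - int k}) (fst z) (snd z)))\<bar> powr p) \<partial>(?P \<Otimes>\<^sub>M ?P))
        \<le> ennreal ((\<Sum>i\<in>{0, 1::nat}. B) powr p)"
    proof (rule nn_integral_sum_powr_le)
      fix i :: nat assume "i \<in> {0, 1}"
      have 0: "(\<integral>\<^sup>+z. ennreal (\<bar>h j (patch T (fst z) (snd z))\<bar> powr p) \<partial>(?P \<Otimes>\<^sub>M ?P)) \<le> ennreal (B powr p)" for T
      proof -
        have "(\<integral>\<^sup>+z. ennreal (\<bar>h j (patch T (fst z) (snd z))\<bar> powr p) \<partial>(?P \<Otimes>\<^sub>M ?P))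
            = (\<integral>\<^sup>+x. \<integral>\<^sup>+y. ennreal (\<bar>h j (patch T x y)\<bar> powr p) \<partial>?P \<partial>?P)"
          by (subst S.P.nn_integral_fst[symmetric]) auto
        also have "\<dots> = (\<integral>\<^sup>+x. ennreal (\<bar>h j x\<bar> powr p) \<partial>?P)"
          by (rule S.nn_integral_patch) measurable
        finally show ?thesis using hmom by simp
      qed
      show "(\<integral>\<^sup>+z. ennreal (\<bar>if i = 0 then h j (fst z) else - h j (patch (- {j - int k}) (fst z) (snd z))\<bar> powr p) \<partial>(?P \<Otimes>\<^sub>M ?P))
          \<le> ennreal (B powr p)"
        using 0[of UNIV] 0[of "- {j - int k}"] by (cases "i = 0") (simp_all add: patch_def)
      show "(\<lambda>z. if i = 0 then h j (fst z) else - h j (patch (- {j - int k}) (fst z) (snd z))) \<in> borel_measurable (?P \<Otimes>\<^sub>M ?P)"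
        using measurable_compose[OF spl h] measurable_compose[OF measurable_fst h] by simp
    qed (use p B in auto)
    then have le: "(\<integral>\<^sup>+\<omega>. ennreal (\<bar>?w \<omega>\<bar> powr p) \<partial>M) \<le> ennreal ((2 * B) powr p)"
      unfolding eq[symmetric] by simp
    then have "integrable M (\<lambda>\<omega>. \<bar>?w \<omega>\<bar> powr p)" and c2: "c j k \<le> (2 * B) powr p"
      using nn_integral_powr_le_iff[OF wm, of "(2 * B) powr p" p] by (auto simp: c_def)
    then have "(\<integral>\<^sup>+\<omega>. ennreal (\<bar>?w \<omega>\<bar> powr p) \<partial>M) = ennreal (c j k)"
      unfolding c_def by (intro nn_integral_eq_integral) auto
    then show "(\<integral>\<^sup>+z. ennreal (\<bar>?g j k z\<bar> powr p) \<partial>(?P \<Otimes>\<^sub>M ?P)) = ennreal (c j k)" "c j k \<le> (2 * B) powr p"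
      using eq c2 by auto
  qed
  have c0: "c j k \<ge> 0" for j k unfolding c_def by simp
  have root: "c j k powr (1/p) \<le> 2 * B" for j k
  proof -
    have "c j k powr (1/p) \<le> ((2 * B) powr p) powr (1/p)" using PPc c0 p by (intro powr_mono2) auto
    also have "\<dots> = 2 * B" using p B by (simp add: powr_powr)
    finally show ?thesis .
  qed
  have dep_ge: "c j k powr (1/p) \<le> dep_measure M H e e' p k" for j k
    unfolding dep_measure_def c_def[symmetric] by (rule cSUP_upper) (auto intro!: bdd_aboveI[of _ "2 * B"] root)
  obtain L where L: "L > 0" "\<And>k. k \<ge> 1 \<Longrightarrow> norm (dep_measure M H e e' p k)
      \<le> L * norm (real (k + 1) powr (-(chi + 1)) * ln (real (k + 1)) powr (-a))"
    using dep by (auto elim!: landau_o.bigE simp: eventually_principal)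
  define \<delta> where "\<delta> k = (2 * B + L * ln 2 powr (-a)) * real (k + 1) powr (-2)" for k
  have \<delta>pos: "\<delta> k > 0" for k
    unfolding \<delta>_def using B L by (intro mult_pos_pos add_pos_nonneg) auto
  have \<delta>sum: "summable \<delta>" unfolding \<delta>_def by (intro summable_mult summable_powr_minus_2)
  have c\<delta>: "c j k powr (1/p) \<le> \<delta> k" for j k
  proof (cases "k = 0")
    case True
    then show ?thesis using root[of j k] L by (simp add: \<delta>_def add_increasing2)
  next
    case False
    then have k: "k \<ge> 1" by simp
    have "c j k powr (1/p) \<le> L * norm (real (k + 1) powr (-(chi + 1)) * ln (real (k + 1)) powr (-a))"
      using dep_ge[of j k] L(2)[OF k] by simp
    also have "\<dots> = L * (real (k + 1) powr (-(chi + 1)) * ln (real (k + 1)) powr (-a))" by simp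
    also have "\<dots> \<le> L * (real (k + 1) powr (-2) * ln 2 powr (-a))"
    proof (intro mult_left_mono mult_mono)
      show "real (k + 1) powr (-(chi + 1)) \<le> real (k + 1) powr (-2)" using chi by (intro powr_mono) auto
      show "ln (real (k + 1)) powr (-a) \<le> ln 2 powr (-a)"
        using k a by (intro powr_mono2') auto
    qed (use L in auto)
    also have "\<dots> \<le> \<delta> k" using B by (simp add: \<delta>_def algebra_simps)
    finally show ?thesis .
  qed
  have coupling: "(\<integral>\<^sup>+x. \<integral>\<^sup>+y. ennreal (\<bar>h j x - h j (patch (- {j - int k}) x y)\<bar> powr p) \<partial>?P \<partial>?P)
             \<le> ennreal (\<delta> k powr p)" for j k
  proof -
    have "(\<integral>\<^sup>+x. \<integral>\<^sup>+y. ennreal (\<bar>h j x - h j (patch (- {j - int k}) x y)\<bar> powr p) \<partial>?P \<partial>?P)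
       = (\<integral>\<^sup>+z. ennreal (\<bar>?g j k z\<bar> powr p) \<partial>(?P \<Otimes>\<^sub>M ?P))"
      by (subst S.P.nn_integral_fst[symmetric]) auto
    also have "\<dots> = ennreal ((c j k powr (1/p)) powr p)"
      using p c0[of j k] by (simp add: PPc powr_powr)
    also have "\<dots> \<le> ennreal (\<delta> k powr p)"
      using c\<delta> p by (intro ennreal_leI powr_mono2) auto
    finally show ?thesis .
  qed
  have block: "(\<integral>\<^sup>+x. ennreal (\<bar>\<Sum>j\<in>{u<..u + int m}. h j x\<bar> powr p) \<partial>?P)
      \<le> ennreal ((2 * mart_const p * (suminf \<delta>)\<^sup>2) powr (p/2) * real m powr (p/2))" for u m
  proof (rule S.block_moment_bound[OF p h _ _ _ \<delta>pos \<delta>sum coupling])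
    show "integrable ?P (\<lambda>x. \<bar>h j x\<bar> powr p)" for j
      using hmom[of j] nn_integral_powr_le_iff[OF h, of "B powr p" j p] by auto
    show "(\<integral>x. h j x \<partial>?P) = 0" for j
    proof -
      have "(\<integral>x. h j x \<partial>?P) = (\<integral>\<omega>. h j (?E \<omega>) \<partial>M)"
        unfolding law[symmetric] by (rule integral_distr) auto
      also have "\<dots> = expectation (\<epsilon> j)" by (intro Bochner_Integration.integral_cong) (auto simp: \<epsilon>h)
      finally show ?thesis using mean by simp
    qed
    show "h j (patch {..j} x y) = h j x" for j x y
      by (simp add: h_def patch_def)
  qed
  show ?thesis
  proof (intro exI[of _ "(2 * mart_const p * (suminf \<delta>)\<^sup>2) powr (p/2)"] conjI allI)
    fix u :: int and m :: nat
    have "(\<integral>\<^sup>+\<omega>. ennreal (\<bar>\<Sum>j\<in>{u<..u + int m}. \<epsilon> j \<omega>\<bar> powr p) \<partial>M)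
       = (\<integral>\<^sup>+\<omega>. ennreal (\<bar>\<Sum>j\<in>{u<..u + int m}. h j (?E \<omega>)\<bar> powr p) \<partial>M)"
      by (intro nn_integral_cong) (simp add: \<epsilon>h)
    also have "\<dots> = (\<integral>\<^sup>+x. ennreal (\<bar>\<Sum>j\<in>{u<..u + int m}. h j x\<bar> powr p) \<partial>?P)"
      by (rule nn[symmetric]) measurable
    finally show "(\<integral>\<^sup>+\<omega>. ennreal (\<bar>\<Sum>j\<in>{u<..u + int m}. \<epsilon> j \<omega>\<bar> powr p) \<partial>M)
        \<le> ennreal ((2 * mart_const p * (suminf \<delta>)\<^sup>2) powr (p/2) * real m powr (p/2))"
      using block[of u m] by simp
  qed simp
qed

abbreviation std_normal :: "real measure" where
  "std_normal \<equiv> density lborel (\<lambda>x. ennreal (std_normal_density x))"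

lemma std_normal_abs_moment:
  assumes p: "p \<ge> 0"
  shows "integrable std_normal (\<lambda>x. \<bar>x\<bar> powr p)"
proof -
  define k where "k = nat \<lceil>p\<rceil>"
  have "integrable std_normal (\<lambda>x. 1 + \<bar>x\<bar> ^ k)"
    using integrable_std_normal_moment_abs[of 0] integrable_std_normal_moment_abs[of k]
    by (subst integrable_real_density) (auto simp: distrib_left)
  then show ?thesis
  proof (rule Bochner_Integration.integrable_bound)
    show "AE x in std_normal. norm (\<bar>x\<bar> powr p) \<le> norm (1 + \<bar>x\<bar> ^ k)"
    proof (rule AE_I2)
      fix x :: real
      have "\<bar>x\<bar> powr p \<le> 1 + \<bar>x\<bar> ^ k"
      proof (cases "\<bar>x\<bar> \<le> 1")
        case True
        then have "\<bar>x\<bar> powr p \<le> 1 powr p" using p by (intro powr_mono2) auto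
        then show ?thesis by (simp add: add_increasing2)
      next
        case False
        then have "\<bar>x\<bar> powr p \<le> \<bar>x\<bar> powr real k" using p unfolding k_def by (intro powr_mono) linarith+
        also have "\<dots> = \<bar>x\<bar> ^ k" using False by (subst powr_realpow) auto
        finally show ?thesis by simp
      qed
      then show "norm (\<bar>x\<bar> powr p) \<le> norm (1 + \<bar>x\<bar> ^ k)" by simp
    qed
  qed simp
qed

text \<open>
  Scaling i.i.d. standard normal coordinates covers the degenerate case \<open>\<sigma> j = 0\<close> and presents
  the sequence as a causal one whose coupling distances vanish at all positive lags, so that
  \<open>block_moment_bound\<close> applies to it as well.
\<close>

theorem gaussian_sequence_exists:
  fixes \<sigma> :: "int \<Rightarrow> real"
  assumes p: "p > 2" and \<sigma>: "\<And>j. 0 \<le> \<sigma> j" "\<And>j. \<sigma> j \<le> S"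
  defines "N \<equiv> PiM (UNIV :: int set) (\<lambda>_. std_normal)" and "z \<equiv> \<lambda>j \<omega>. \<sigma> j * \<omega> j"
  shows "prob_space N" "prob_space.indep_vars N (\<lambda>_. borel) z UNIV"
    and "\<And>j. z j \<in> borel_measurable N"
    and "\<And>j. gaussian_var N (z j)" "\<And>j. prob_space.expectation N (z j) = 0"
    and "\<And>j. prob_space.variance N (z j) = (\<sigma> j)\<^sup>2"
    and "\<exists>K\<ge>0. \<forall>u m. (\<integral>\<^sup>+\<omega>. ennreal (\<bar>\<Sum>j\<in>{u<..u + int m}. z j \<omega>\<bar> powr p) \<partial>N) \<le> ennreal (K * real m powr (p/2))"
proof -
  interpret S: iid_space std_normal
    unfolding iid_space_def by (rule prob_space_normal_density) simp
  interpret N: prob_space N unfolding N_def by (rule S.P.prob_space_axioms)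
  show "prob_space N" by (rule N.prob_space_axioms)
  have sets_N [measurable_cong]: "sets N = sets (PiM UNIV (\<lambda>_::int. borel :: real measure))"
    unfolding N_def by (rule sets_PiM_cong) simp_all
  have z [measurable]: "z j \<in> borel_measurable N" for j unfolding z_def by measurable
  then show "\<And>j. z j \<in> borel_measurable N" .
  have coord: "(\<lambda>\<omega>. \<omega> j) \<in> measurable N std_normal" for j unfolding N_def by measurable
  have comp: "distr N std_normal (\<lambda>\<omega>. \<omega> j) = std_normal" for j
    unfolding N_def by (rule S.PiM_component) simp
  have compb: "distr N borel (\<lambda>\<omega>. \<omega> j) = std_normal" for j
    using comp[of j] by (simp cong: distr_cong)
  have ind: "N.indep_vars (\<lambda>_. borel) (\<lambda>j \<omega>. \<omega> j) UNIV"
  proof (subst N.indep_vars_iff_distr_eq_PiM)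
    have "distr N (PiM UNIV (\<lambda>_. borel)) (\<lambda>x. x) = N"
      using sets_N by (intro distr_id2) simp
    then show "distr N (PiM UNIV (\<lambda>_. borel)) (\<lambda>x. \<lambda>j\<in>UNIV. x j) = PiM UNIV (\<lambda>j. distr N borel (\<lambda>\<omega>. \<omega> j))"
      unfolding compb by (simp add: N_def restrict_UNIV)
  qed (auto simp: measurable_cong_sets[OF sets_N])
  show "N.indep_vars (\<lambda>_. borel) z UNIV"
    unfolding z_def by (rule N.indep_vars_compose2[OF ind]) measurable
  have dist: "distributed N lborel (\<lambda>\<omega>. \<omega> j) (\<lambda>x. ennreal (std_normal_density x))" for j
    unfolding distributed_def using coord[of j] comp[of j] by (simp cong: distr_cong)
  show "gaussian_var N (z j)" for j
  proof (cases "\<sigma> j = 0")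
    case True
    then show ?thesis unfolding gaussian_var_def by (intro conjI z disjI1 exI[of _ 0]) (simp add: z_def)
  next
    case False
    then have "\<sigma> j > 0" using \<sigma>(1)[of j] by simp
    then show ?thesis
      using N.normal_density_affine[OF dist[of j], of "\<sigma> j" 0] z[of j]
      unfolding gaussian_var_def z_def by (intro conjI disjI2 exI[of _ 0] exI[of _ "\<sigma> j"]) auto
  qed
  have int: "integrable N (\<lambda>\<omega>. g (\<omega> j))" "(\<integral>\<omega>. g (\<omega> j) \<partial>N) = (\<integral>x. g x \<partial>std_normal)"
    if "integrable std_normal g" for g :: "real \<Rightarrow> real" and j
  proof -
    have "integrable (distr N std_normal (\<lambda>\<omega>. \<omega> j)) g" unfolding comp by (rule that)
    then show "integrable N (\<lambda>\<omega>. g (\<omega> j))" by (rule integrable_distr[OF coord])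
    show "(\<integral>\<omega>. g (\<omega> j) \<partial>N) = (\<integral>x. g x \<partial>std_normal)"
      using integral_distr[OF coord, of g j] that by (simp add: comp borel_measurable_integrable)
  qed
  have E0: "N.expectation (z j) = 0" for j
  proof -
    have "integrable std_normal (\<lambda>x. x)" "(\<integral>x. x \<partial>std_normal) = 0"
      using integrable_std_normal_moment[of 1] integral_std_normal_moment_odd[of 0]
      by (auto simp: integrable_real_density integral_real_density)
    then show ?thesis using int[of "\<lambda>x. x" j] by (simp add: z_def)
  qed
  then show "\<And>j. N.expectation (z j) = 0" .
  show "N.variance (z j) = (\<sigma> j)\<^sup>2" for j
  proof -
    have "integrable std_normal (\<lambda>x. x\<^sup>2)" "(\<integral>x. x\<^sup>2 \<partial>std_normal) = 1"
      using integrable_std_normal_moment[of 2] integral_std_normal_moment_even[of 1]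
      by (auto simp: integrable_real_density integral_real_density)
    then show ?thesis unfolding E0 using int[of "\<lambda>x. x\<^sup>2" j] by (simp add: z_def power_mult_distrib)
  qed
  define b where "b = (\<integral>x. \<bar>x\<bar> powr p \<partial>std_normal)"
  have b: "(\<integral>\<^sup>+x. ennreal (\<bar>x\<bar> powr p) \<partial>std_normal) = ennreal b"
    unfolding b_def using std_normal_abs_moment[of p] p by (intro nn_integral_eq_integral) auto
  have b0: "b \<ge> 0" unfolding b_def by simp
  have S: "S \<ge> 0" using \<sigma>[of 0] by linarith
  define c where "c = S * b powr (1/p) + 1"
  have c: "c > 0" unfolding c_def using S by (simp add: add_nonneg_pos)
  define \<delta> where "\<delta> k = 2 * c * real (k + 1) powr (-2)" for k
  have zmom: "(\<integral>\<^sup>+\<omega>. ennreal (\<bar>z j \<omega>\<bar> powr p) \<partial>N) \<le> ennreal (c powr p)" for j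
  proof -
    have "(\<integral>\<^sup>+\<omega>. ennreal (\<bar>z j \<omega>\<bar> powr p) \<partial>N) = (\<integral>\<^sup>+\<omega>. ennreal (\<sigma> j powr p) * ennreal (\<bar>\<omega> j\<bar> powr p) \<partial>N)"
      using \<sigma>(1)[of j] by (intro nn_integral_cong) (simp add: z_def abs_mult powr_mult ennreal_mult)
    also have "\<dots> = ennreal (\<sigma> j powr p) * (\<integral>\<^sup>+\<omega>. ennreal (\<bar>\<omega> j\<bar> powr p) \<partial>N)"
      by (rule nn_integral_cmult) measurable
    also have "(\<integral>\<^sup>+\<omega>. ennreal (\<bar>\<omega> j\<bar> powr p) \<partial>N) = (\<integral>\<^sup>+x. ennreal (\<bar>x\<bar> powr p) \<partial>distr N std_normal (\<lambda>\<omega>. \<omega> j))"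
      by (rule nn_integral_distr[symmetric, OF coord]) measurable
    also have "ennreal (\<sigma> j powr p) * \<dots> = ennreal (\<sigma> j powr p * b)"
      unfolding comp b using b0 by (simp add: ennreal_mult)
    also have "\<dots> \<le> ennreal (c powr p)"
    proof (rule ennreal_leI)
      have "\<sigma> j powr p * b = (\<sigma> j * b powr (1/p)) powr p"
        using b0 p by (simp add: powr_mult powr_powr)
      also have "\<dots> \<le> c powr p"
      proof (rule powr_mono2)
        have "\<sigma> j * b powr (1/p) \<le> S * b powr (1/p)" using \<sigma>(2) by (intro mult_right_mono) auto
        then show "\<sigma> j * b powr (1/p) \<le> c" by (simp add: c_def)
      qed (use p \<sigma>(1) in auto)
      finally show "\<sigma> j powr p * b \<le> c powr p" .
    qed
    finally show ?thesis .
  qed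
  have block: "(\<integral>\<^sup>+x. ennreal (\<bar>\<Sum>j\<in>{u<..u + int m}. z j x\<bar> powr p) \<partial>N)
      \<le> ennreal ((2 * mart_const p * (suminf \<delta>)\<^sup>2) powr (p/2) * real m powr (p/2))" for u m
    unfolding N_def
  proof (rule S.block_moment_bound[OF p])
    show "z j \<in> borel_measurable S.P" for j using z[of j] by (simp add: N_def)
    show "integrable S.P (\<lambda>x. \<bar>z j x\<bar> powr p)" for j
      using zmom[of j] nn_integral_powr_le_iff[OF z, of "c powr p" j p] by (auto simp: N_def)
    show "(\<integral>x. z j x \<partial>S.P) = 0" for j using E0[of j] by (simp add: N_def)
    show "z j (patch {..j} x y) = z j x" for j x y by (simp add: z_def patch_def)
    show "\<delta> k > 0" for k using c by (simp add: \<delta>_def)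
    show "summable \<delta>" unfolding \<delta>_def by (intro summable_mult summable_powr_minus_2)
    show "(\<integral>\<^sup>+x. \<integral>\<^sup>+y. ennreal (\<bar>z j x - z j (patch (- {j - int k}) x y)\<bar> powr p) \<partial>S.P \<partial>S.P) \<le> ennreal (\<delta> k powr p)" for j k
    proof (cases "k = 0")
      case False
      then have "z j (patch (- {j - int k}) x y) = z j x" for x y by (simp add: z_def patch_def)
      then show ?thesis using p by simp
    next
      case True
      have e: "z j x - z j (patch (- {j - int k}) x y) = z j x - z j y" for x y
        using True by (simp add: z_def patch_def)
      have zP [measurable]: "z j \<in> borel_measurable S.P" using z[of j] by (simp add: N_def)
      have "(\<integral>\<^sup>+x. \<integral>\<^sup>+y. ennreal (\<bar>z j x - z j y\<bar> powr p) \<partial>S.P \<partial>S.P)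
        = (\<integral>\<^sup>+q. ennreal (\<bar>\<Sum>i\<in>{0, 1::nat}. (if i = 0 then z j (fst q) else - z j (snd q))\<bar> powr p) \<partial>S.PP)"
        by (subst S.P.nn_integral_fst[symmetric]) auto
      also have "\<dots> \<le> ennreal ((\<Sum>i\<in>{0, 1::nat}. c) powr p)"
      proof (rule nn_integral_sum_powr_le)
        fix i :: nat
        have "(\<integral>\<^sup>+q. ennreal (\<bar>z j (fst q)\<bar> powr p) \<partial>S.PP) \<le> ennreal (c powr p)"
          "(\<integral>\<^sup>+q. ennreal (\<bar>z j (snd q)\<bar> powr p) \<partial>S.PP) \<le> ennreal (c powr p)"
          using zmom[of j] by (subst S.P.nn_integral_fst[symmetric]; simp add: N_def S.P.emeasure_space_1)+
        then show "(\<integral>\<^sup>+q. ennreal (\<bar>if i = 0 then z j (fst q) else - z j (snd q)\<bar> powr p) \<partial>S.PP) \<le> ennreal (c powr p)"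
          by (cases "i = 0") simp_all
        show "(\<lambda>q. if i = 0 then z j (fst q) else - z j (snd q)) \<in> borel_measurable S.PP" by measurable
      qed (use p c in auto)
      also have "\<dots> = ennreal (\<delta> k powr p)" using True by (simp add: \<delta>_def)
      finally show ?thesis unfolding e .
    qed
  qed
  show "\<exists>K\<ge>0. \<forall>u m. (\<integral>\<^sup>+\<omega>. ennreal (\<bar>\<Sum>j\<in>{u<..u + int m}. z j \<omega>\<bar> powr p) \<partial>N) \<le> ennreal (K * real m powr (p/2))"
    using block by (intro exI[of _ "(2 * mart_const p * (suminf \<delta>)\<^sup>2) powr (p/2)"] conjI allI) auto
qed

section \<open>The rate\<close>

text \<open>
  With \<open>u = 1/p\<close> and \<open>v = 1/\<kappa>\<close> the numerator factors, so that
  \<open>G = (1/2 - u) * (1 - 2 * v) / (1 - u - v)\<close>, and \<open>u \<le> v < 1/2\<close>.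
\<close>

lemma rate_G_le:
  assumes p: "p > 2" and chi: "chi > 1"
  shows "rate_G p chi \<le> 1/2 - 1/p"
proof -
  define u where "u = 1/p"
  define v where "v = kappa_inv p chi"
  define x where "x = 1 / (sqrt (chi + 1) * p)"
  define m where "m = max (2 / (sqrt (chi + 1) * p)) (1/chi * (1/2 - 1/p))"
  have u: "0 < u" "u < 1/2" using p by (auto simp: u_def field_simps)
  have "1 < sqrt (chi + 1)" using chi by simp
  then have "1 * p < sqrt (chi + 1) * p" using p by (intro mult_strict_right_mono) auto
  then have sp: "2 < sqrt (chi + 1) * p" using p by linarith
  then have x: "0 < x" "x < 1/2" by (auto simp: x_def field_simps)
  have m1: "m < 1"
  proof -
    have "2 / (sqrt (chi + 1) * p) < 1" using sp by (simp add: field_simps)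
    moreover have "1/chi * (1/2 - u) < 1 * 1" using chi u by (intro mult_strict_mono') auto
    ultimately show ?thesis by (simp add: m_def u_def)
  qed
  have "(1/2 - x) * m < (1/2 - x) * 1" using x m1 by (intro mult_strict_left_mono) auto
  then have "x + (1/2 - x) * m < 1/2" by simp
  moreover have v_def': "v = max u (x + (1/2 - x) * m)"
    by (simp add: v_def kappa_inv_def u_def x_def m_def)
  ultimately have v: "v < 1/2" "u \<le> v" using u by (auto simp: less_max_iff_disj max_def)
  have "rate_G p chi = (1/2 - u) * (1 - 2 * v) / (1 - v - u)"
    by (simp add: rate_G_def u_def v_def field_simps)
  also have "\<dots> \<le> (1/2 - u) * 1"
    unfolding times_divide_eq_right[symmetric] using u v by (intro mult_left_mono) (auto simp: divide_le_eq)
  finally show ?thesis by (simp add: u_def)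
qed

lemma polynomial_rate_smallo:
  fixes f :: "nat \<Rightarrow> real"
  assumes f: "\<And>n. n \<ge> 1 \<Longrightarrow> \<bar>f n\<bar> \<le> C * real n powr (- \<theta>)" and \<theta>: "g < \<theta>" and c: "c \<ge> 0"
  shows "f \<in> o(\<lambda>n. real n powr (- g) * ln (real n) powr c)"
proof -
  have "f \<in> O(\<lambda>n. real n powr (- \<theta>))"
    using f by (intro bigoI[of _ C] eventually_sequentiallyI[of 1]) auto
  also have "(\<lambda>n. real n powr (- \<theta>)) \<in> o(\<lambda>n. real n powr (- g))"
    using \<theta> by (subst powr_smallo_iff) (auto simp: filterlim_real_sequentially)
  also have "(\<lambda>n. real n powr (- g)) \<in> O(\<lambda>n. real n powr (- g) * ln (real n) powr c)"
  proof (intro bigoI[of _ 1])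
    have "eventually (\<lambda>n. real n \<ge> exp 1) sequentially"
      using filterlim_real_sequentially unfolding filterlim_at_top by blast
    then show "eventually (\<lambda>n. norm (real n powr (- g)) \<le> 1 * norm (real n powr (- g) * ln (real n) powr c)) sequentially"
    proof eventually_elim
      case (elim n)
      then have "real n > 0" by (rule less_le_trans[OF exp_gt_zero])
      with elim have "ln (real n) \<ge> 1" by (simp add: ln_ge_iff)
      then have "ln (real n) powr c \<ge> 1" using c by (rule ge_one_powr_ge_zero)
      then have "real n powr (- g) * 1 \<le> real n powr (- g) * ln (real n) powr c" by (intro mult_left_mono) auto
      then show ?case by simp
    qed
  qed
  finally show ?thesis .
qed

theorem proposition8:
  fixes \<psi> \<psi>' :: "real \<Rightarrow> complex"
    and A p chi a :: real
    and d :: nat and s :: "nat \<Rightarrow> real"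
    and M :: "'a measure"
    and e e' \<epsilon> :: "int \<Rightarrow> 'a \<Rightarrow> real"
    and H :: "int \<Rightarrow> (nat \<Rightarrow> real) \<Rightarrow> real"
  assumes "integrable lborel \<psi>"
    and "integrable lborel (\<lambda>x. (norm (\<psi> x))\<^sup>2)"
    and "abs_continuous \<psi>"
    and "AE x in lborel. (\<psi> has_vector_derivative \<psi>' x) (at x)"
    and "integrable lborel \<psi>'"
    and "d \<ge> 1" and "0 < s 1" and "strict_mono_on {1..d} s"
    and "A > 0"
    and "prob_space M"
    and "iid_sequence M e"
    and "indep_copy M e e'"
    and "\<And>j. H j \<in> borel_measurable (PiM UNIV (\<lambda>_. borel))"
    and "\<And>j \<omega>. \<omega> \<in> space M \<Longrightarrow> \<epsilon> j \<omega> = H j (past e j \<omega>)"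
    and "\<And>j. prob_space.expectation M (\<epsilon> j) = 0"
    and "p > 2" and "chi > 1" and "a > sqrt chi + 1"
    and "(SUP j. \<integral>\<^sup>+\<omega>. ennreal (\<bar>\<epsilon> j \<omega>\<bar> powr p) \<partial>M) < \<infinity>"
    and "dep_measure M H e e' p
           \<in> O[principal {1..}](\<lambda>k. real (k + 1) powr (-(chi + 1)) * ln (real (k + 1)) powr (-a))"
  shows "\<exists>(N :: (int \<Rightarrow> real) measure) (z :: int \<Rightarrow> (int \<Rightarrow> real) \<Rightarrow> real).
      prob_space N \<and>
      prob_space.indep_vars N (\<lambda>_. borel) z UNIV \<and>
      (\<forall>j. gaussian_var N (z j) \<and>
           prob_space.expectation N (z j) = 0 \<and>
           prob_space.variance N (z j) = prob_space.variance M (\<epsilon> j)) \<and>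
      (\<forall>\<delta>>0.
         (\<lambda>n. levy_prokhorov (cmat_idx n d) (wt_law M \<psi> A d s \<epsilon> n) (wt_law N \<psi> A d s z n))
           \<in> o(\<lambda>n. real n powr (- rate_G p chi / 3) * ln (real n) powr (4/3 + \<delta>)))"
proof -
  interpret prob_space M by fact
  have s: "s l > 0" if "l \<in> {1..d}" for l
  proof (cases "l = 1")
    case False
    then have "s 1 < s l" using that assms(6) by (intro strict_mono_onD[OF assms(8)]) auto
    then show ?thesis using assms(7) by linarith
  qed (use assms(7) in simp)
  define B where "B = enn2real (SUP j. \<integral>\<^sup>+\<omega>. ennreal (\<bar>\<epsilon> j \<omega>\<bar> powr p) \<partial>M) + 1"
  have B1: "B \<ge> 1" by (simp add: B_def)
  have momB: "(\<integral>\<^sup>+\<omega>. ennreal (\<bar>\<epsilon> j \<omega>\<bar> powr p) \<partial>M) \<le> ennreal B" for j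
  proof -
    let ?S = "SUP j. \<integral>\<^sup>+\<omega>. ennreal (\<bar>\<epsilon> j \<omega>\<bar> powr p) \<partial>M"
    have "(\<integral>\<^sup>+\<omega>. ennreal (\<bar>\<epsilon> j \<omega>\<bar> powr p) \<partial>M) \<le> ?S" by (rule SUP_upper) simp
    also have "?S = ennreal (enn2real ?S)" using assms(19) by (simp add: less_top)
    also have "\<dots> \<le> ennreal B" unfolding B_def by (intro ennreal_leI) simp
    finally show ?thesis .
  qed
  have \<epsilon>m: "\<epsilon> j \<in> borel_measurable M" for j
  proof -
    have e: "e i \<in> borel_measurable M" for i by (rule iid_sequence_law(1)[OF assms(10,11)])
    have "past e j \<in> measurable M (PiM UNIV (\<lambda>_. borel))"
      unfolding past_def[abs_def] by (rule measurable_PiM_single') (use e in auto)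
    from measurable_compose[OF this assms(13)] have "(\<lambda>\<omega>. H j (past e j \<omega>)) \<in> borel_measurable M" .
    then show ?thesis by (rule measurable_cong[THEN iffD2, rotated]) (rule assms(14))
  qed
  have mom: "(\<integral>\<^sup>+\<omega>. ennreal (\<bar>\<epsilon> j \<omega>\<bar> powr p) \<partial>M) \<le> ennreal ((B powr (1/p)) powr p)" for j
    using momB[of j] B1 assms(16) by (simp add: powr_powr)
  have "a \<ge> 0" using assms(17,18) by (smt (verit) real_sqrt_ge_zero)
  then obtain K where K: "K \<ge> 0"
    "\<And>u m. (\<integral>\<^sup>+\<omega>. ennreal (\<bar>\<Sum>j\<in>{u<..u + int m}. \<epsilon> j \<omega>\<bar> powr p) \<partial>M) \<le> ennreal (K * real m powr (p/2))"
    using causal_sequence_block_moments[OF assms(10-17) _ mom _ assms(20)] B1 by auto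
  define \<sigma> where "\<sigma> j = sqrt (variance (\<epsilon> j))" for j
  have var0: "variance (\<epsilon> j) \<ge> 0" for j by simp
  have \<sigma>0: "0 \<le> \<sigma> j" for j by (simp add: \<sigma>_def)
  have \<sigma>B: "\<sigma> j \<le> sqrt (1 + B)" for j
  proof -
    have \<epsilon>p: "integrable M (\<lambda>\<omega>. \<bar>\<epsilon> j \<omega>\<bar> powr p)" "expectation (\<lambda>\<omega>. \<bar>\<epsilon> j \<omega>\<bar> powr p) \<le> B"
      using momB[of j] B1 nn_integral_powr_le_iff[OF \<epsilon>m, of B j p] by auto
    have le: "(\<epsilon> j \<omega>)\<^sup>2 \<le> 1 + \<bar>\<epsilon> j \<omega>\<bar> powr p" for \<omega>
      using powr_Young[of 1 "\<bar>\<epsilon> j \<omega>\<bar>" 2 p] assms(16) by simp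
    have "variance (\<epsilon> j) = expectation (\<lambda>\<omega>. (\<epsilon> j \<omega>)\<^sup>2)" by (simp add: assms(15))
    also have "\<dots> \<le> expectation (\<lambda>\<omega>. 1 + \<bar>\<epsilon> j \<omega>\<bar> powr p)"
      using \<epsilon>p le by (intro integral_mono' ) auto
    also have "\<dots> \<le> 1 + B" using \<epsilon>p by (simp add: prob_space)
    finally show ?thesis unfolding \<sigma>_def by (intro real_sqrt_le_mono)
  qed
  let ?N = "PiM (UNIV :: int set) (\<lambda>_. std_normal)" and ?z = "\<lambda>j \<omega>. \<sigma> j * \<omega> j"
  note z = gaussian_sequence_exists[where \<sigma> = \<sigma>, OF assms(16) \<sigma>0 \<sigma>B]
  obtain KZ where KZ: "KZ \<ge> 0"
    "\<And>u m. (\<integral>\<^sup>+\<omega>. ennreal (\<bar>\<Sum>j\<in>{u<..u + int m}. ?z j \<omega>\<bar> powr p) \<partial>?N) \<le> ennreal (KZ * real m powr (p/2))"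
    using z(7) by blast
  obtain C where C: "\<And>n. n \<ge> 1 \<Longrightarrow> \<bar>levy_prokhorov (cmat_idx n d) (wt_law M \<psi> A d s \<epsilon> n) (wt_law ?N \<psi> A d s ?z n)\<bar>
            \<le> C * real n powr (- ((p - 2) / (4 * (p + 1))))"
    using levy_prokhorov_wavelet_rate[where s = s, OF assms(16,10) z(1) \<epsilon>m z(3) K(1) KZ(1) K(2) KZ(2) assms(3,9,6) s]
    by blast
  \<comment> \<open>The strict inequality between the exponents absorbs the constant.\<close>
  have rate: "rate_G p chi / 3 < (p - 2) / (4 * (p + 1))"
  proof -
    have "rate_G p chi / 3 \<le> (1/2 - 1/p) / 3" using rate_G_le[OF assms(16,17)] by simp
    also have "\<dots> = (p - 2) / (6 * p)" using assms(16) by (simp add: field_simps)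
    also have "\<dots> < (p - 2) / (4 * (p + 1))" using assms(16) by (intro divide_strict_left_mono) auto
    finally show ?thesis .
  qed
  show ?thesis
  proof (intro exI[of _ ?N] exI[of _ ?z] conjI allI impI)
    show "(\<lambda>n. levy_prokhorov (cmat_idx n d) (wt_law M \<psi> A d s \<epsilon> n) (wt_law ?N \<psi> A d s ?z n))
           \<in> o(\<lambda>n. real n powr (- rate_G p chi / 3) * ln (real n) powr (4/3 + \<delta>))" if "\<delta> > 0" for \<delta>
      using polynomial_rate_smallo[OF C rate, of "4/3 + \<delta>"] that by simp
    show "prob_space.variance ?N (?z j) = variance (\<epsilon> j)" for j
      using z(6)[of j] var0[of j] by (simp add: \<sigma>_def)
  qed (use z(1-5) in auto)
qed

end
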